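(* Let $G$ be an $n\times n$ grid with $n$ even. Every non-partitive initial configuration of $k\ge3$ robots on distinct nodes of $G$ in which no corner of the minimum enclosing square is occupied is gatherable despite at most one crash fault.
   Context: Model. The grid is the anonymous grid graph. A configuration is $f:V(G)\to\{0,1,2\}$ ($0$ empty, $1$ singleton, $2$ multiplicity = at least two robots). Robots are anonymous, identical, oblivious, cannot communicate, share no coordinate system, orientation or chirality, run the same deterministic algorithm in Look–Compute–Move cycles (snapshot of the whole configuration with weak multiplicity detection; deterministic decision to stay or move to an adjacent node; instantaneous move), fully asynchronously (finite but unbounded adversarial delays; every non-crashed robot activated infinitely often; moves may use outdated snapshots). At most one robot may crash at an adversarial time: it stops forever, stays visible, indistinguishable. Gatherable despite at most one crash fault: some such algorithm guarantees in every execution with at most one crash that after finite time all non-crashed robots are on one node and remain there. Partitive: some automorphism $\varphi$ of $(G,f)$ (graph automorphism with $f\circ\varphi=f$) of order $p>1$ has all orbits of $V(G)$ under $\langle\varphi\rangle$ of size exactly $p$. Minimum enclosing square: the smallest square subgrid with the same geometric center as the grid containing all occupied nodes; its corners are its four corner nodes. *)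

theory Defs
  imports Main
begin

type_synonym node = "nat \<times> nat"

definition grid :: "nat \<Rightarrow> node set" where
  "grid n = {(i, j). i < n \<and> j < n}"

definition grid_adj :: "node \<Rightarrow> node \<Rightarrow> bool" where
  "grid_adj u v \<longleftrightarrow>
     (fst u = fst v \<and> (snd u = Suc (snd v) \<or> snd v = Suc (snd u))) \<or>
     (snd u = snd v \<and> (fst u = Suc (fst v) \<or> fst v = Suc (fst u)))"

definition grid_aut :: "nat \<Rightarrow> (node \<Rightarrow> node) \<Rightarrow> bool" where
  "grid_aut n \<phi> \<longleftrightarrow> bij_betw \<phi> (grid n) (grid n) \<and>
     (\<forall>u\<in>grid n. \<forall>v\<in>grid n. grid_adj u v \<longleftrightarrow> grid_adj (\<phi> u) (\<phi> v))"

text \<open>Configuration (weak multiplicity): 0 empty, 1 singleton, 2 multiplicity,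
  for robots 0..k-1 at positions pos.\<close>
definition cfg :: "nat \<Rightarrow> (nat \<Rightarrow> node) \<Rightarrow> node \<Rightarrow> nat" where
  "cfg k pos v = (let c = card {r. r < k \<and> pos r = v} in if c = 0 then 0 else if c = 1 then 1 else 2)"

definition perm_order :: "nat \<Rightarrow> (node \<Rightarrow> node) \<Rightarrow> nat" where
  "perm_order n \<phi> = (LEAST m. m > 0 \<and> (\<forall>v\<in>grid n. (\<phi> ^^ m) v = v))"

definition orbit :: "(node \<Rightarrow> node) \<Rightarrow> node \<Rightarrow> node set" where
  "orbit \<phi> v = {(\<phi> ^^ i) v | i. True}"

definition partitive :: "nat \<Rightarrow> (node \<Rightarrow> nat) \<Rightarrow> bool" where
  "partitive n f \<longleftrightarrow> (\<exists>\<phi> p. grid_aut n \<phi> \<and> (\<forall>v\<in>grid n. f (\<phi> v) = f v) \<and>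
      p > 1 \<and> perm_order n \<phi> = p \<and> (\<forall>v\<in>grid n. card (orbit \<phi> v) = p))"

text \<open>Minimum enclosing square (grid of even side n): the centred square subgrid
  [s, n-1-s]^2 with largest s containing all occupied nodes.\<close>
definition mes_offset :: "nat \<Rightarrow> (node \<Rightarrow> nat) \<Rightarrow> nat" where
  "mes_offset n f = (GREATEST s. s < n div 2 \<and>
     (\<forall>i j. (i, j) \<in> grid n \<and> f (i, j) \<noteq> 0 \<longrightarrow> s \<le> i \<and> i + s < n \<and> s \<le> j \<and> j + s < n))"

definition mes_corners :: "nat \<Rightarrow> (node \<Rightarrow> nat) \<Rightarrow> node set" where
  "mes_corners n f = (let s = mes_offset n f; e = n - 1 - s in {(s, s), (s, e), (e, s), (e, e)})"

text \<open>Algorithms: given the snapshot in the robot's local frame and its own local position,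
  return a node that is equal or adjacent.\<close>
type_synonym algo = "(node \<Rightarrow> nat) \<Rightarrow> node \<Rightarrow> node"

definition valid_algo :: "nat \<Rightarrow> algo \<Rightarrow> bool" where
  "valid_algo n A \<longleftrightarrow> (\<forall>g u. u \<in> grid n \<longrightarrow> A g u \<in> grid n \<and> (A g u = u \<or> grid_adj u (A g u)))"

text \<open>Snapshot seen through local frame \<phi> (a grid automorphism mapping local to global nodes).\<close>
definition view :: "nat \<Rightarrow> (node \<Rightarrow> nat) \<Rightarrow> (node \<Rightarrow> node) \<Rightarrow> node \<Rightarrow> nat" where
  "view n f \<phi> = (\<lambda>u. if u \<in> grid n then f (\<phi> u) else 0)"

datatype event = Look nat "node \<Rightarrow> node" | Move nat

definition active :: "(nat \<Rightarrow> nat option) \<Rightarrow> nat \<Rightarrow> nat \<Rightarrow> bool" where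
  "active crash r t \<longleftrightarrow> (case crash r of None \<Rightarrow> True | Some c \<Rightarrow> t < c)"

text \<open>Asynchronous execution: Look (snapshot + compute, with adversarial frame) and
  instantaneous Move events of individual robots interleaved arbitrarily; crash r = Some c means
  robot r crashes at time c and takes no further events.\<close>
definition execution :: "nat \<Rightarrow> nat \<Rightarrow> algo \<Rightarrow> (nat \<Rightarrow> node) \<Rightarrow> (nat \<Rightarrow> nat \<Rightarrow> node) \<Rightarrow>
    (nat \<Rightarrow> nat \<Rightarrow> node option) \<Rightarrow> (nat \<Rightarrow> event) \<Rightarrow> (nat \<Rightarrow> nat option) \<Rightarrow> bool" where
  "execution n k A pos0 pos pend ev crash \<longleftrightarrow>
     pos 0 = pos0 \<and> (\<forall>r<k. pend 0 r = None) \<and>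
     (\<forall>t. case ev t of
        Look r \<phi> \<Rightarrow> r < k \<and> active crash r t \<and> grid_aut n \<phi> \<and> pend t r = None \<and>
          pos (Suc t) = pos t \<and>
          (\<exists>u\<in>grid n. \<phi> u = pos t r \<and>
             pend (Suc t) = (pend t)(r := Some (\<phi> (A (view n (cfg k (pos t)) \<phi>) u))))
      | Move r \<Rightarrow> r < k \<and> active crash r t \<and>
          (\<exists>q. pend t r = Some q \<and> pos (Suc t) = (pos t)(r := q) \<and> pend (Suc t) = (pend t)(r := None)))"

definition at_most_one_crash :: "nat \<Rightarrow> (nat \<Rightarrow> nat option) \<Rightarrow> bool" where
  "at_most_one_crash k crash \<longleftrightarrow> card {r. r < k \<and> crash r \<noteq> None} \<le> 1"

definition fair :: "nat \<Rightarrow> (nat \<Rightarrow> event) \<Rightarrow> (nat \<Rightarrow> nat option) \<Rightarrow> bool" where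
  "fair k ev crash \<longleftrightarrow> (\<forall>r<k. crash r = None \<longrightarrow> (\<forall>T. \<exists>t\<ge>T. \<exists>\<phi>. ev t = Look r \<phi>))"

definition gathered :: "nat \<Rightarrow> (nat \<Rightarrow> nat \<Rightarrow> node) \<Rightarrow> (nat \<Rightarrow> nat option) \<Rightarrow> bool" where
  "gathered k pos crash \<longleftrightarrow> (\<exists>T p. \<forall>t\<ge>T. \<forall>r<k. crash r = None \<longrightarrow> pos t r = p)"

definition gatherable_one_crash :: "nat \<Rightarrow> nat \<Rightarrow> (nat \<Rightarrow> node) \<Rightarrow> bool" where
  "gatherable_one_crash n k pos0 \<longleftrightarrow> (\<exists>A. valid_algo n A \<and>
     (\<forall>pos pend ev crash. execution n k A pos0 pos pend ev crash \<and> at_most_one_crash k crash \<and>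
        fair k ev crash \<longrightarrow> gathered k pos crash))"

end

theory Submission
  imports Defs
begin

text \<open>
The gathering point is a corner of the grid, and no corner is occupied initially. If every
stabiliser of the initial configuration fixes all robots, the target is a corner nearest to a robot;
ties are broken by a weighted sum of distances. Robots reduce their larger coordinate (relative to the
target) first, hence never come close to another corner; as soon as the target is the only nearest
corner it stays so, and all robots may move. While there are ties, at least two robots can break
them, and the order of preference survives all their moves.

Otherwise the configuration is symmetric in a diagonal and has a robot off that diagonal. Two mirror
images walk towards that end of the diagonal on whose side the centre of mass lies, all other robots
waiting. The sums of the coordinates identify the target in every intermediate configuration except
when exactly one walker has moved along a straight line from a balanced start; there a chase through
reflections excludes a mirror symmetry. Once a corner is occupied it is the target of all robots.

In both cases at least two robots are always entitled to move, so a single crash cannot block.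
\<close>

section \<open>Automorphisms of the grid\<close>

text \<open>Robots are oblivious and their frames are chosen by an adversary, so the danger in every
  stage is a second frame in which the same snapshot also looks legitimate but points to a different
  corner. Both strategies are shaped by excluding such frames: through a quantity that singles out
  one corner (the score), or through quantities that a wrong frame would have to negate (the
  coordinate sums). The algorithm may depend on the initial configuration, so a tie there can be
  settled by naming a corner, as long as no symmetry of the configuration moves it. Outdated
  snapshots impose a second condition: whatever a robot was once allowed to do must remain allowed
  after any moves of the others. The hypothesis on the enclosing square enters through two bounds on
  the least distance \<open>d\<close> from a robot to a corner, \<open>0 < d\<close> and
  \<open>d < n - 2\<close>; below \<open>n - 2\<close>, a step towards the target surely leads away
  from the other corners.\<close>

definition flip :: "nat \<Rightarrow> bool \<Rightarrow> nat \<Rightarrow> nat" where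
  "flip n b i = (if b then n - 1 - i else i)"

text \<open>The eight symmetries of the square in normal form: an optional transposition, followed
  by two independent coordinate flips. A quarter turn is a transposition with exactly one
  flip.\<close>

definition dih :: "nat \<Rightarrow> bool \<Rightarrow> bool \<Rightarrow> bool \<Rightarrow> node \<Rightarrow> node" where
  "dih n s a b v = (if s then (flip n a (snd v), flip n b (fst v)) else (flip n a (fst v), flip n b (snd v)))"

lemma mem_grid [simp]: "(i, j) \<in> grid n \<longleftrightarrow> i < n \<and> j < n"
  by (simp add: grid_def)

lemma mem_grid_iff: "v \<in> grid n \<longleftrightarrow> fst v < n \<and> snd v < n"
  by (cases v) simp

lemma finite_grid [simp]: "finite (grid n)"
proof -
  have "grid n = {..<n} \<times> {..<n}" by (auto simp: grid_def)
  then show ?thesis by simp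
qed

lemma flip_less: "i < n \<Longrightarrow> flip n b i < n"
  by (auto simp: flip_def)

lemma flip_flip [simp]: "i < n \<Longrightarrow> flip n b (flip n b i) = i"
  by (auto simp: flip_def)

lemma flip_xor: "i < n \<Longrightarrow> flip n p (flip n a i) = flip n (p \<noteq> a) i"
  by (auto simp: flip_def)

lemma dih_in: "v \<in> grid n \<Longrightarrow> dih n s a b v \<in> grid n"
  by (auto simp: mem_grid_iff dih_def flip_less)

lemma dih_inverse:
  "v \<in> grid n \<Longrightarrow> dih n s (if s then b else a) (if s then a else b) (dih n s a b v) = v"
  by (auto simp: mem_grid_iff dih_def)

lemma bij_betw_dih: "bij_betw (dih n s a b) (grid n) (grid n)"
proof (rule bij_betw_byWitness[where f' = "dih n s (if s then b else a) (if s then a else b)"])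
  show "\<forall>v\<in>grid n. dih n s (if s then b else a) (if s then a else b) (dih n s a b v) = v"
    using dih_inverse by blast
  show "\<forall>v\<in>grid n. dih n s a b (dih n s (if s then b else a) (if s then a else b) v) = v"
    by (auto simp: mem_grid_iff dih_def)
qed (auto intro: dih_in simp del: mem_grid)

lemma flip_Suc_cases:
  "i < n \<Longrightarrow> j < n \<Longrightarrow>
   (flip n a i = Suc (flip n a j) \<or> flip n a j = Suc (flip n a i)) \<longleftrightarrow> (i = Suc j \<or> j = Suc i)"
  unfolding flip_def by auto

lemma flip_eq_iff [simp]: "i < n \<Longrightarrow> j < n \<Longrightarrow> flip n a i = flip n a j \<longleftrightarrow> i = j"
  unfolding flip_def by auto

lemma grid_aut_dih: "grid_aut n (dih n s a b)"
  unfolding grid_aut_def grid_adj_def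
  by (auto simp: bij_betw_dih mem_grid_iff dih_def flip_Suc_cases)

section \<open>The group of grid automorphisms\<close>

lemma grid_aut_bij: "grid_aut n \<phi> \<Longrightarrow> bij_betw \<phi> (grid n) (grid n)"
  by (simp add: grid_aut_def)

lemma grid_aut_inj: "grid_aut n \<phi> \<Longrightarrow> u \<in> grid n \<Longrightarrow> v \<in> grid n \<Longrightarrow> \<phi> u = \<phi> v \<longleftrightarrow> u = v"
  by (meson bij_betw_imp_inj_on grid_aut_bij inj_on_eq_iff)

lemma grid_aut_in: "grid_aut n \<phi> \<Longrightarrow> u \<in> grid n \<Longrightarrow> \<phi> u \<in> grid n"
  by (meson bij_betwE grid_aut_bij)

lemma grid_aut_adj:
  "grid_aut n \<phi> \<Longrightarrow> u \<in> grid n \<Longrightarrow> v \<in> grid n \<Longrightarrow> grid_adj (\<phi> u) (\<phi> v) \<longleftrightarrow> grid_adj u v"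
  by (auto simp: grid_aut_def)

lemma grid_aut_surj: "grid_aut n \<phi> \<Longrightarrow> v \<in> grid n \<Longrightarrow> \<exists>u\<in>grid n. \<phi> u = v"
  by (metis bij_betw_imp_surj_on grid_aut_bij imageE)

lemma grid_aut_comp: "grid_aut n \<phi> \<Longrightarrow> grid_aut n \<psi> \<Longrightarrow> grid_aut n (\<phi> \<circ> \<psi>)"
  using grid_aut_adj[of n] grid_aut_in[of n \<psi>]
  by (auto simp: grid_aut_bij grid_aut_def[of n "\<phi> \<circ> \<psi>"] intro: bij_betw_trans[of \<psi> "grid n" "grid n"]
      simp del: mem_grid split_paired_All split_paired_Ball_Sigma)

lemma grid_aut_inv:
  assumes "grid_aut n \<phi>"
  shows "grid_aut n (inv_into (grid n) \<phi>)"
  unfolding grid_aut_def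
proof (intro conjI ballI)
  show b: "bij_betw (inv_into (grid n) \<phi>) (grid n) (grid n)"
    by (rule bij_betw_inv_into[OF grid_aut_bij[OF assms]])
  have r: "\<phi> (inv_into (grid n) \<phi> w) = w" "inv_into (grid n) \<phi> w \<in> grid n" if "w \<in> grid n" for w
    using bij_betw_inv_into_right[OF grid_aut_bij[OF assms] that] bij_betwE[OF b] that by auto
  fix u v assume "u \<in> grid n" "v \<in> grid n"
  then show "grid_adj u v \<longleftrightarrow> grid_adj (inv_into (grid n) \<phi> u) (inv_into (grid n) \<phi> v)"
    using grid_aut_adj[OF assms, of "inv_into (grid n) \<phi> u" "inv_into (grid n) \<phi> v"] r by simp
qed

lemma grid_aut_inv_left: "grid_aut n \<phi> \<Longrightarrow> u \<in> grid n \<Longrightarrow> inv_into (grid n) \<phi> (\<phi> u) = u"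
  by (meson bij_betw_inv_into_left grid_aut_bij)

lemma grid_aut_inv_right: "grid_aut n \<phi> \<Longrightarrow> u \<in> grid n \<Longrightarrow> \<phi> (inv_into (grid n) \<phi> u) = u"
  by (meson bij_betw_inv_into_right grid_aut_bij)

text \<open>Two nodes of distance two in diagonal position have exactly two common neighbours, so
  fixing the lower antidiagonals forces the next one to be fixed.\<close>
lemma grid_aut_fixed:
  assumes aut: "grid_aut n \<phi>" and n: "2 \<le> n"
    and f0: "\<phi> (0, 0) = (0, 0)" and f1: "\<phi> (1, 0) = (1, 0)" and f2: "\<phi> (0, 1) = (0, 1)"
    and "v \<in> grid n"
  shows "\<phi> v = v"
  using assms(6)
proof (induction "fst v + snd v" arbitrary: v rule: less_induct)
  case less
  have inner: "\<phi> (Suc i, Suc j) = (Suc i, Suc j)"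
    if "Suc i < n" "Suc j < n" and fx: "\<phi> (i, j) = (i, j)" "\<phi> (i, Suc j) = (i, Suc j)" "\<phi> (Suc i, j) = (Suc i, j)" for i j
  proof -
    obtain p q where pq: "\<phi> (Suc i, Suc j) = (p, q)" by fastforce
    have "grid_adj (p, q) (i, Suc j)" "grid_adj (p, q) (Suc i, j)"
      using grid_aut_adj[OF aut, of "(Suc i, Suc j)" "(i, Suc j)"]
        grid_aut_adj[OF aut, of "(Suc i, Suc j)" "(Suc i, j)"] that pq
      by (auto simp: grid_adj_def)
    moreover have "(p, q) \<noteq> (i, j)"
      using grid_aut_inj[OF aut, of "(Suc i, Suc j)" "(i, j)"] that pq by auto
    ultimately show ?thesis using pq by (auto simp: grid_adj_def)
  qed
  have bound1: "\<phi> (Suc (Suc j), 0) = (Suc (Suc j), 0)"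
    if "Suc (Suc j) < n" and fx: "\<phi> (j, 0) = (j, 0)" "\<phi> (Suc j, 0) = (Suc j, 0)" "\<phi> (Suc j, 1) = (Suc j, 1)" for j
  proof -
    obtain p q where pq: "\<phi> (Suc (Suc j), 0) = (p, q)" by fastforce
    have "grid_adj (p, q) (Suc j, 0)"
      using grid_aut_adj[OF aut, of "(Suc (Suc j), 0)" "(Suc j, 0)"] that pq
      by (auto simp: grid_adj_def)
    moreover have "(p, q) \<noteq> (j, 0)" "(p, q) \<noteq> (Suc j, 1)"
      using grid_aut_inj[OF aut, of "(Suc (Suc j), 0)" "(j, 0)"]
        grid_aut_inj[OF aut, of "(Suc (Suc j), 0)" "(Suc j, 1)"] that pq by auto
    ultimately show ?thesis using pq by (auto simp: grid_adj_def)
  qed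
  have bound2: "\<phi> (0, Suc (Suc j)) = (0, Suc (Suc j))"
    if "Suc (Suc j) < n" and fx: "\<phi> (0, j) = (0, j)" "\<phi> (0, Suc j) = (0, Suc j)" "\<phi> (1, Suc j) = (1, Suc j)" for j
  proof -
    obtain p q where pq: "\<phi> (0, Suc (Suc j)) = (p, q)" by fastforce
    have "grid_adj (p, q) (0, Suc j)"
      using grid_aut_adj[OF aut, of "(0, Suc (Suc j))" "(0, Suc j)"] that pq
      by (auto simp: grid_adj_def)
    moreover have "(p, q) \<noteq> (0, j)" "(p, q) \<noteq> (1, Suc j)"
      using grid_aut_inj[OF aut, of "(0, Suc (Suc j))" "(0, j)"]
        grid_aut_inj[OF aut, of "(0, Suc (Suc j))" "(1, Suc j)"] that pq by auto
    ultimately show ?thesis using pq by (auto simp: grid_adj_def)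
  qed
  obtain x y where v: "v = (x, y)" by fastforce
  have IH: "\<phi> (i, j) = (i, j)" if "i + j < x + y" "i < n" "j < n" for i j
    using less(1)[of "(i, j)"] that v by auto
  have xy: "x < n" "y < n" using less(2) v by auto
  consider (a) "x = 0" "y = 0" | (b) "x = 1" "y = 0" | (c) "x = 0" "y = 1"
    | (d) i j where "x = Suc i" "y = Suc j" | (e) j where "x = Suc (Suc j)" "y = 0" | (f) j where "x = 0" "y = Suc (Suc j)"
    by (cases x; cases y) (metis One_nat_def not0_implies_Suc)+
  then show ?case
  proof cases
    case d then show ?thesis using inner[of i j] IH[of i j] IH[of i "Suc j"] IH[of "Suc i" j] xy v by simp
  next
    case e
    \<comment> \<open>\<open>(Suc j, 1)\<close> lies on the same antidiagonal as \<open>v\<close>,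
      so the induction hypothesis does not cover it; the argument for nodes with both coordinates
      positive does.\<close>
    have "\<phi> (Suc j, 1) = (Suc j, 1)"
      using inner[of j 0] IH[of j 0] IH[of "Suc j" 0] IH[of j 1] e xy by simp
    then show ?thesis using bound1[of j] IH[of j 0] IH[of "Suc j" 0] xy v e by simp
  next
    case f
    have "\<phi> (1, Suc j) = (1, Suc j)"
      using inner[of 0 j] IH[of 0 j] IH[of 0 "Suc j"] IH[of 1 j] f xy by simp
    then show ?thesis using bound2[of j] IH[of 0 j] IH[of 0 "Suc j"] xy v f by simp
  qed (use f0 f1 f2 v in auto)
qed

lemma grid_adj_origin: "grid_adj (0, 0) v \<longleftrightarrow> v = (1, 0) \<or> v = (0, 1)"
  by (cases v) (auto simp: grid_adj_def)

text \<open>Corners are the nodes with only two neighbours, so the origin goes to a corner. Flips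
  and a transposition undo the effect of \<open>\<phi>\<close> on the origin and its two neighbours;
  what remains fixes these three nodes and is the identity.\<close>

lemma grid_aut_cases:
  assumes aut: "grid_aut n \<phi>" and n: "2 \<le> n"
  obtains s a b where "\<And>v. v \<in> grid n \<Longrightarrow> \<phi> v = dih n s a b v"
proof -
  obtain p q where pq: "\<phi> (0, 0) = (p, q)" by fastforce
  have pqn: "p < n" "q < n" using grid_aut_in[OF aut, of "(0, 0)"] pq n by auto
  have corner: "(p = 0 \<or> p = n - 1) \<and> (q = 0 \<or> q = n - 1)"
  proof (rule ccontr)
    assume c: "\<not> ?thesis"
    \<comment> \<open>a node that is no corner has three neighbours, their preimages are neighbours of a corner\<close>
    obtain x y z where xyz: "x \<in> grid n" "y \<in> grid n" "z \<in> grid n" "distinct [x, y, z]"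
      "grid_adj (p, q) x" "grid_adj (p, q) y" "grid_adj (p, q) z"
    proof (cases "p = 0 \<or> p = n - 1")
      case False
      have "\<exists>z. z \<in> grid n \<and> grid_adj (p, q) z \<and> fst z = p"
        using n pqn by (intro exI[of _ "(p, if q = 0 then 1 else q - 1)"]) (auto simp: grid_adj_def)
      then obtain z where z: "z \<in> grid n" "grid_adj (p, q) z" "fst z = p" by blast
      have "distinct [(p - 1, q), (p + 1, q), z]" "p + 1 < n" "Suc (p - 1) = p" "p - 1 < n"
        using pqn z(3) False by (cases z; auto)+
      then show ?thesis using that[of "(p - 1, q)" "(p + 1, q)" z] z False pqn
        by (simp add: grid_adj_def)
    next
      case True
      then have q: "q \<noteq> 0" "q \<noteq> n - 1" using c by auto
      have "\<exists>z. z \<in> grid n \<and> grid_adj (p, q) z \<and> snd z = q"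
        using n pqn by (intro exI[of _ "(if p = 0 then 1 else p - 1, q)"]) (auto simp: grid_adj_def)
      then obtain z where z: "z \<in> grid n" "grid_adj (p, q) z" "snd z = q" by blast
      have "distinct [(p, q - 1), (p, q + 1), z]" "q + 1 < n" "Suc (q - 1) = q" "q - 1 < n"
        using pqn z(3) q by (cases z; auto)+
      then show ?thesis using that[of "(p, q - 1)" "(p, q + 1)" z] z q pqn
        by (simp add: grid_adj_def)
    qed
    obtain x' y' z' where xyz': "x' \<in> grid n" "y' \<in> grid n" "z' \<in> grid n"
      "\<phi> x' = x" "\<phi> y' = y" "\<phi> z' = z"
      using grid_aut_surj[OF aut] xyz by meson
    have "distinct [x', y', z']" using xyz xyz' by auto
    moreover have "grid_adj (0, 0) x'" "grid_adj (0, 0) y'" "grid_adj (0, 0) z'"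
      using grid_aut_adj[OF aut, of "(0, 0)" x'] grid_aut_adj[OF aut, of "(0, 0)" y']
        grid_aut_adj[OF aut, of "(0, 0)" z'] xyz xyz' pq n by auto
    ultimately show False unfolding grid_adj_origin by auto
  qed
  define a where "a = (p \<noteq> 0)"
  define b where "b = (q \<noteq> 0)"
  define \<psi> where "\<psi> = dih n False a b \<circ> \<phi>"
  have aut\<psi>: "grid_aut n \<psi>" unfolding \<psi>_def by (intro grid_aut_comp grid_aut_dih aut)
  have \<psi>0: "\<psi> (0, 0) = (0, 0)"
    using corner by (auto simp: \<psi>_def pq dih_def flip_def a_def b_def)
  have nb: "\<psi> (1, 0) \<in> {(1, 0), (0, 1)}" "\<psi> (0, 1) \<in> {(1, 0), (0, 1)}"
    using grid_aut_adj[OF aut\<psi>, of "(0, 0)" "(1, 0)"] grid_aut_adj[OF aut\<psi>, of "(0, 0)" "(0, 1)"] \<psi>0 n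
    by (auto simp: grid_adj_origin)
  have ne: "\<psi> (1, 0) \<noteq> \<psi> (0, 1)"
    using grid_aut_inj[OF aut\<psi>, of "(1, 0)" "(0, 1)"] n by auto
  define s where "s = (\<psi> (1, 0) = (0, 1))"
  define \<chi> where "\<chi> = dih n s False False \<circ> \<psi>"
  have aut\<chi>: "grid_aut n \<chi>" unfolding \<chi>_def by (intro grid_aut_comp grid_aut_dih aut\<psi>)
  have \<chi>: "\<chi> (0, 0) = (0, 0)" "\<chi> (1, 0) = (1, 0)" "\<chi> (0, 1) = (0, 1)"
    using \<psi>0 nb ne by (auto simp: \<chi>_def s_def dih_def flip_def)
  have id: "\<chi> v = v" if "v \<in> grid n" for v
    using grid_aut_fixed[OF aut\<chi> n \<chi> that] .
  have "\<phi> v = dih n s a b v" if v: "v \<in> grid n" for v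
  proof -
    have g: "\<phi> v \<in> grid n" by (rule grid_aut_in[OF aut v])
    have "dih n s False False (dih n False a b (\<phi> v)) = v"
      using id[OF v] by (simp add: \<chi>_def \<psi>_def)
    then show ?thesis using g
      by (cases "\<phi> v"; cases v) (auto simp: dih_def flip_def split: if_splits)
  qed
  then show ?thesis using that by blast
qed

lemma involution_partitive:
  assumes aut: "grid_aut n \<phi>" and inv: "\<And>v. v \<in> grid n \<Longrightarrow> \<phi> (\<phi> v) = v"
    and free: "\<And>v. v \<in> grid n \<Longrightarrow> \<phi> v \<noteq> v" and f: "\<And>v. v \<in> grid n \<Longrightarrow> f (\<phi> v) = f v"
    and n: "0 < n"
  shows "partitive n f"
proof -
  have g0: "(0, 0) \<in> grid n" using n by simp
  have two: "(\<phi> ^^ 2) v = v" if "v \<in> grid n" for v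
    using inv[OF that] by (simp add: numeral_2_eq_2)
  have ord: "perm_order n \<phi> = 2"
    unfolding perm_order_def
  proof (rule Least_equality)
    show "(2::nat) > 0 \<and> (\<forall>v\<in>grid n. (\<phi> ^^ 2) v = v)" using two by simp
    fix m :: nat assume m: "m > 0 \<and> (\<forall>v\<in>grid n. (\<phi> ^^ m) v = v)"
    show "2 \<le> m"
    proof (rule ccontr)
      assume "\<not> 2 \<le> m"
      then have "m = 1" using m by auto
      then show False using m free[OF g0] g0 by auto
    qed
  qed
  have pow: "(\<phi> ^^ i) v \<in> {v, \<phi> v}" if "v \<in> grid n" for v i
  proof (induction i)
    case (Suc i)
    then consider "(\<phi> ^^ i) v = v" | "(\<phi> ^^ i) v = \<phi> v" by blast
    then show ?case by cases (simp_all add: inv[OF that])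
  qed simp
  have orb: "orbit \<phi> v = {v, \<phi> v}" if "v \<in> grid n" for v
  proof
    show "orbit \<phi> v \<subseteq> {v, \<phi> v}" using pow[OF that] unfolding orbit_def by blast
    have "v \<in> orbit \<phi> v" unfolding orbit_def by (auto intro: exI[of _ 0])
    moreover have "\<phi> v \<in> orbit \<phi> v" unfolding orbit_def by (auto intro!: exI[of _ 1])
    ultimately show "{v, \<phi> v} \<subseteq> orbit \<phi> v" by auto
  qed
  have "card (orbit \<phi> v) = 2" if "v \<in> grid n" for v
    using orb[OF that] free[OF that] by auto
  then show ?thesis unfolding partitive_def using aut f ord by (intro exI[of _ \<phi>] exI[of _ 2]) auto
qed

lemma even_no_middle: "even n \<Longrightarrow> i < n \<Longrightarrow> flip n True i \<noteq> (i::nat)"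
  unfolding flip_def by (auto, presburger)

text \<open>For even \<open>n\<close> no coordinate is its own flip, so both axis reflections and
  the half turn are involutions without fixed nodes. A configuration that is not partitive has none
  of them as a symmetry.\<close>

lemma dih_invariant_partitive:
  assumes n: "even n" "0 < n" and ab: "a \<or> b"
    and f: "\<And>v. v \<in> grid n \<Longrightarrow> f (dih n False a b v) = f v"
  shows "partitive n f"
proof (rule involution_partitive[of n "dih n False a b"])
  fix v assume v: "v \<in> grid n"
  show "dih n False a b (dih n False a b v) = v" using dih_inverse[OF v, of False] by simp
  show "dih n False a b v \<noteq> v"
    using ab even_no_middle[OF n(1)] v by (cases v) (auto simp: dih_def)
qed (use grid_aut_dih f n in auto)

section \<open>Frame-independent rules and a criterion for gathering\<close>

lemma cfg_cong: "(\<And>r. r < k \<Longrightarrow> pos r = pos' r) \<Longrightarrow> cfg k pos = cfg k pos'"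
proof -
  assume "\<And>r. r < k \<Longrightarrow> pos r = pos' r"
  then have "{r. r < k \<and> pos r = v} = {r. r < k \<and> pos' r = v}" for v by auto
  then show ?thesis by (simp add: cfg_def fun_eq_iff)
qed

lemma cfg_eq_0_iff: "cfg k pos v = 0 \<longleftrightarrow> v \<notin> pos ` {..<k}"
proof -
  have "finite {r. r < k \<and> pos r = v}" by simp
  then show ?thesis by (auto simp: cfg_def Let_def)
qed

lemma cfg_comp:
  assumes "inj_on \<psi> (grid n)" "pos ` {..<k} \<subseteq> grid n" "v \<in> grid n"
  shows "cfg k (\<lambda>r. \<psi> (pos r)) (\<psi> v) = cfg k pos v"
proof -
  have "{r. r < k \<and> \<psi> (pos r) = \<psi> v} = {r. r < k \<and> pos r = v}"
    using assms by (auto dest: inj_onD)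
  then show ?thesis by (simp add: cfg_def)
qed

lemma grid_aut_inj_on: "grid_aut n \<phi> \<Longrightarrow> inj_on \<phi> (grid n)"
  by (meson bij_betw_imp_inj_on grid_aut_bij)

text \<open>Closing a local rule under all frames makes it independent of the frame chosen by the adversary.\<close>
definition frame_closure ::
  "nat \<Rightarrow> ((node \<Rightarrow> nat) \<Rightarrow> node \<Rightarrow> node \<Rightarrow> bool) \<Rightarrow> (node \<Rightarrow> nat) \<Rightarrow> node \<Rightarrow> node \<Rightarrow> bool" where
  "frame_closure n R f v q \<longleftrightarrow>
     (\<exists>\<phi> u w. grid_aut n \<phi> \<and> u \<in> grid n \<and> w \<in> grid n \<and> \<phi> u = v \<and> \<phi> w = q \<and> R (view n f \<phi>) u w)"

text \<open>A rule may allow several targets, for instance when the snapshot is symmetric, and the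
  choice made in a local frame may then differ between frames. The analysis therefore admits every
  node of the closure as the outcome of a look.\<close>

definition rule_algo :: "nat \<Rightarrow> ((node \<Rightarrow> nat) \<Rightarrow> node \<Rightarrow> node \<Rightarrow> bool) \<Rightarrow> algo" where
  "rule_algo n R f u =
     (if \<exists>w. frame_closure n R f u w then SOME w. frame_closure n R f u w else u)"

lemma view_view: "grid_aut n \<phi> \<Longrightarrow> view n (view n f \<psi>) \<phi> = view n f (\<psi> \<circ> \<phi>)"
  by (auto simp: view_def grid_aut_in fun_eq_iff simp del: mem_grid)

text \<open>Frames \<open>\<phi>\<close> of the local snapshot correspond to frames
  \<open>\<psi> \<circ> \<phi>\<close> of the global one, because grid automorphisms form a
  group.\<close>

lemma frame_closure_view:
  assumes \<psi>: "grid_aut n \<psi>" and u: "u \<in> grid n"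
  shows "frame_closure n R (view n f \<psi>) u w \<longleftrightarrow> w \<in> grid n \<and> frame_closure n R f (\<psi> u) (\<psi> w)"
proof
  assume "frame_closure n R (view n f \<psi>) u w"
  then obtain \<phi> u' w' where *: "grid_aut n \<phi>" "u' \<in> grid n" "w' \<in> grid n" "\<phi> u' = u" "\<phi> w' = w"
    "R (view n (view n f \<psi>) \<phi>) u' w'" by (auto simp: frame_closure_def simp del: mem_grid)
  have "grid_aut n (\<psi> \<circ> \<phi>)" using * \<psi> grid_aut_comp by blast
  then have "frame_closure n R f (\<psi> u) (\<psi> w)"
    unfolding frame_closure_def using * by (intro exI[of _ "\<psi> \<circ> \<phi>"] exI[of _ u'] exI[of _ w']) (auto simp: view_view)
  then show "w \<in> grid n \<and> frame_closure n R f (\<psi> u) (\<psi> w)" using * grid_aut_in by blast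
next
  assume *: "w \<in> grid n \<and> frame_closure n R f (\<psi> u) (\<psi> w)"
  then obtain \<phi> u' w' where \<phi>: "grid_aut n \<phi>" "u' \<in> grid n" "w' \<in> grid n" "\<phi> u' = \<psi> u" "\<phi> w' = \<psi> w"
    "R (view n f \<phi>) u' w'" by (auto simp: frame_closure_def simp del: mem_grid)
  let ?\<chi> = "inv_into (grid n) \<psi> \<circ> \<phi>"
  have \<chi>: "grid_aut n ?\<chi>" using \<phi>(1) \<psi> grid_aut_comp grid_aut_inv by blast
  have "view n (view n f \<psi>) ?\<chi> = view n f \<phi>"
    unfolding view_view[OF \<chi>] using grid_aut_inv_right[OF \<psi>] grid_aut_in[OF \<phi>(1)]
    by (auto simp: view_def fun_eq_iff simp del: mem_grid)
  then show "frame_closure n R (view n f \<psi>) u w"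
    unfolding frame_closure_def using \<phi> \<chi> * u \<psi>
    by (intro exI[of _ ?\<chi>] exI[of _ u'] exI[of _ w']) (auto simp: grid_aut_inv_left)
qed

definition adjacent_rule :: "nat \<Rightarrow> ((node \<Rightarrow> nat) \<Rightarrow> node \<Rightarrow> node \<Rightarrow> bool) \<Rightarrow> bool" where
  "adjacent_rule n R \<longleftrightarrow> (\<forall>f. \<forall>u\<in>grid n. \<forall>w\<in>grid n. R f u w \<longrightarrow> grid_adj u w)"

lemma frame_closure_adj:
  assumes "adjacent_rule n R"
    and "frame_closure n R f v q"
  shows "grid_adj v q" "q \<in> grid n"
proof -
  obtain \<phi> u w where *: "grid_aut n \<phi>" "u \<in> grid n" "w \<in> grid n" "\<phi> u = v" "\<phi> w = q"
    "R (view n f \<phi>) u w" using assms(2) unfolding frame_closure_def by blast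
  then show "grid_adj v q" "q \<in> grid n"
    using assms(1)[unfolded adjacent_rule_def, rule_format, OF *(2,3,6)] grid_aut_adj[OF *(1-3)] grid_aut_in[OF *(1,3)] by simp_all
qed

text \<open>This removes local frames from the analysis: seen globally, a look yields some node that
  the closure allows, and the robot stays only if there is none.\<close>

lemma rule_algo_cases:
  assumes \<psi>: "grid_aut n \<psi>" and u: "u \<in> grid n" and q: "q = \<psi> (rule_algo n R (view n f \<psi>) u)"
  shows "frame_closure n R f (\<psi> u) q \<or> (q = \<psi> u \<and> (\<nexists>q. frame_closure n R f (\<psi> u) q))"
proof (cases "\<exists>w. frame_closure n R (view n f \<psi>) u w")
  case True
  then have "frame_closure n R (view n f \<psi>) u (rule_algo n R (view n f \<psi>) u)"
    unfolding rule_algo_def by (auto intro: someI)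
  then show ?thesis using frame_closure_view[OF \<psi> u] q by blast
next
  case False
  have "\<nexists>q. frame_closure n R f (\<psi> u) q"
  proof
    assume "\<exists>q. frame_closure n R f (\<psi> u) q"
    then obtain q where c: "frame_closure n R f (\<psi> u) q" by blast
    then have "q \<in> grid n" using grid_aut_in unfolding frame_closure_def by blast
    then show False using False frame_closure_view[OF \<psi> u] c grid_aut_surj[OF \<psi>] by metis
  qed
  then show ?thesis using False q by (simp add: rule_algo_def)
qed

lemma valid_rule_algo:
  assumes "adjacent_rule n R"
  shows "valid_algo n (rule_algo n R)"
  unfolding valid_algo_def
proof (intro allI impI)
  fix f u assume u: "u \<in> grid n"
  show "rule_algo n R f u \<in> grid n \<and> (rule_algo n R f u = u \<or> grid_adj u (rule_algo n R f u))"
  proof (cases "\<exists>w. frame_closure n R f u w")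
    case True
    then have "frame_closure n R f u (rule_algo n R f u)"
      unfolding rule_algo_def by (auto intro: someI)
    from frame_closure_adj[OF assms this] show ?thesis by blast
  qed (use u in \<open>simp add: rule_algo_def\<close>)
qed

section \<open>Executions and their convergence\<close>

lemma execution_LookD:
  assumes "execution n k A pos0 pos pend ev crash" "ev t = Look r \<phi>"
  shows "r < k" "active crash r t" "grid_aut n \<phi>" "pend t r = None" "pos (Suc t) = pos t"
    "\<exists>u\<in>grid n. \<phi> u = pos t r \<and> pend (Suc t) = (pend t)(r := Some (\<phi> (A (view n (cfg k (pos t)) \<phi>) u)))"
proof -
  have "case ev t of
        Look r \<phi> \<Rightarrow> r < k \<and> active crash r t \<and> grid_aut n \<phi> \<and> pend t r = None \<and>
          pos (Suc t) = pos t \<and>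
          (\<exists>u\<in>grid n. \<phi> u = pos t r \<and>
             pend (Suc t) = (pend t)(r := Some (\<phi> (A (view n (cfg k (pos t)) \<phi>) u))))
      | Move r \<Rightarrow> r < k \<and> active crash r t \<and>
          (\<exists>q. pend t r = Some q \<and> pos (Suc t) = (pos t)(r := q) \<and> pend (Suc t) = (pend t)(r := None))"
    using assms(1) unfolding execution_def by blast
  then show "r < k" "active crash r t" "grid_aut n \<phi>" "pend t r = None" "pos (Suc t) = pos t"
    "\<exists>u\<in>grid n. \<phi> u = pos t r \<and> pend (Suc t) = (pend t)(r := Some (\<phi> (A (view n (cfg k (pos t)) \<phi>) u)))"
    unfolding assms(2) by simp_all
qed

lemma execution_MoveD:
  assumes "execution n k A pos0 pos pend ev crash" "ev t = Move r"
  shows "r < k" "active crash r t"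
    "\<exists>q. pend t r = Some q \<and> pos (Suc t) = (pos t)(r := q) \<and> pend (Suc t) = (pend t)(r := None)"
proof -
  have "case ev t of
        Look r \<phi> \<Rightarrow> r < k \<and> active crash r t \<and> grid_aut n \<phi> \<and> pend t r = None \<and>
          pos (Suc t) = pos t \<and>
          (\<exists>u\<in>grid n. \<phi> u = pos t r \<and>
             pend (Suc t) = (pend t)(r := Some (\<phi> (A (view n (cfg k (pos t)) \<phi>) u))))
      | Move r \<Rightarrow> r < k \<and> active crash r t \<and>
          (\<exists>q. pend t r = Some q \<and> pos (Suc t) = (pos t)(r := q) \<and> pend (Suc t) = (pend t)(r := None))"
    using assms(1) unfolding execution_def by blast
  then show "r < k" "active crash r t"
    "\<exists>q. pend t r = Some q \<and> pos (Suc t) = (pos t)(r := q) \<and> pend (Suc t) = (pend t)(r := None)"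
    unfolding assms(2) by simp_all
qed

lemma antimono_nat_eventually_const:
  fixes S :: "nat \<Rightarrow> nat"
  assumes "\<And>t. S (Suc t) \<le> S t"
  obtains T where "\<And>t. T \<le> t \<Longrightarrow> S t = S T"
proof -
  obtain T where T: "\<And>t. S T \<le> S t" using exists_least_iff[of "\<lambda>x. x \<in> range S"]
    by (metis (mono_tags, lifting) linorder_not_less rangeE rangeI)
  have "S t \<le> S T" if "T \<le> t" for t using lift_Suc_antimono_le[of S, OF assms that] .
  then show ?thesis using that T by (meson order_antisym)
qed

text \<open>Moves that lower the distance to the origin make the positions stabilise; in the limit
  configuration one of the robots that are asked to move does not crash, so all are gathered.\<close>
theorem gatherable_by_invariant:
  fixes Inv :: "(nat \<Rightarrow> node) \<Rightarrow> (nat \<Rightarrow> node option) \<Rightarrow> bool"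
  assumes adj: "adjacent_rule n R"
    and init: "\<And>pend. \<forall>r<k. pend r = None \<Longrightarrow> Inv pos0 pend"
    and look: "\<And>pos pend r q. Inv pos pend \<Longrightarrow> r < k \<Longrightarrow> pend r = None \<Longrightarrow>
      q = pos r \<or> frame_closure n R (cfg k pos) (pos r) q \<Longrightarrow> Inv pos (pend(r := Some q))"
    and move: "\<And>pos pend r q. Inv pos pend \<Longrightarrow> r < k \<Longrightarrow> pend r = Some q \<Longrightarrow>
      Inv (pos(r := q)) (pend(r := None))"
    and desc: "\<And>pos pend r q. Inv pos pend \<Longrightarrow> r < k \<Longrightarrow> pend r = Some q \<Longrightarrow>
      q = pos r \<or> fst q + snd q < fst (pos r) + snd (pos r)"
    and prog: "\<And>pos pend c r. Inv pos pend \<Longrightarrow> r < k \<Longrightarrow> r \<noteq> c \<Longrightarrow> pos r \<noteq> (0, 0) \<Longrightarrow>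
      \<exists>r<k. r \<noteq> c \<and> (\<exists>q. frame_closure n R (cfg k pos) (pos r) q)"
  shows "gatherable_one_crash n k pos0"
  unfolding gatherable_one_crash_def
proof (intro exI[of _ "rule_algo n R"] conjI allI impI)
  show "valid_algo n (rule_algo n R)" by (rule valid_rule_algo[OF adj])
  fix pos pend ev crash
  assume A: "execution n k (rule_algo n R) pos0 pos pend ev crash \<and> at_most_one_crash k crash \<and> fair k ev crash"
  then have ex: "execution n k (rule_algo n R) pos0 pos pend ev crash" by blast
  have Look_cases: "r < k \<and> pend t r = None \<and> pos (Suc t) = pos t \<and>
    (\<exists>q. pend (Suc t) = (pend t)(r := Some q) \<and>
      (frame_closure n R (cfg k (pos t)) (pos t r) q \<or>
       q = pos t r \<and> (\<nexists>q. frame_closure n R (cfg k (pos t)) (pos t r) q)))"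
    if "ev t = Look r \<phi>" for t r \<phi>
    using execution_LookD[OF ex that] rule_algo_cases by metis
  have inv: "Inv (pos t) (pend t)" for t
  proof (induction t)
    case 0
    show ?case using ex init unfolding execution_def by metis
  next
    case (Suc t)
    show ?case
    proof (cases "ev t")
      case (Look r \<phi>)
      then show ?thesis using Look_cases[OF Look] look[OF Suc] by metis
    next
      case (Move r)
      then show ?thesis using execution_MoveD[OF ex Move] move[OF Suc] by metis
    qed
  qed
  \<comment> \<open>\<open>S\<close> is the total distance to the origin. It drops with every
    genuine move and never grows; once it is constant, nobody changes position any more.\<close>
  define S where "S t = (\<Sum>r<k. fst (pos t r) + snd (pos t r))" for t
  have step: "S (Suc t) \<le> S t \<and> (S (Suc t) = S t \<longrightarrow> (\<forall>r<k. pos (Suc t) r = pos t r))" for t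
  proof (cases "ev t")
    case (Look r \<phi>)
    then show ?thesis using Look_cases[OF Look] by (simp add: S_def)
  next
    case (Move r)
    then obtain q where q: "r < k" "pend t r = Some q" "pos (Suc t) = (pos t)(r := q)"
      using execution_MoveD[OF ex Move] by blast
    show ?thesis
    proof (cases "q = pos t r")
      case True then show ?thesis using q by (simp add: S_def)
    next
      case False
      then have lt: "fst q + snd q < fst (pos t r) + snd (pos t r)" using desc[OF inv q(1,2)] by blast
      have "S (Suc t) < S t"
        unfolding S_def using q lt by (intro sum_strict_mono_ex1) auto
      then show ?thesis by simp
    qed
  qed
  obtain T where T: "\<And>t. T \<le> t \<Longrightarrow> S t = S T"
    using antimono_nat_eventually_const[of S] step by blast
  have const: "pos t r = pos T r" if "T \<le> t" "r < k" for t r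
    using that(1)
  proof (induction rule: dec_induct)
    case (step m)
    then show ?case using \<open>\<And>t. S (Suc t) \<le> S t \<and> _ t\<close>[of m] T[of m] T[of "Suc m"] that(2) by simp
  qed simp
  \<comment> \<open>\<open>c\<close> is the crashed robot; if nobody crashes, the index
    \<open>k\<close>, which belongs to no robot, takes its place.\<close>
  obtain c where c: "\<And>r. r < k \<Longrightarrow> r \<noteq> c \<Longrightarrow> crash r = None" "c < k \<Longrightarrow> crash c \<noteq> None"
  proof (cases "\<exists>c<k. crash c \<noteq> None")
    case True
    then obtain c where cc: "c < k" "crash c \<noteq> None" by blast
    have "r = c" if "r < k" "crash r \<noteq> None" for r
      using A card_le_Suc0_iff_eq[of "{r. r < k \<and> crash r \<noteq> None}"] that cc
      unfolding at_most_one_crash_def by auto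
    then show ?thesis using cc that[of c] by blast
  next
    case False
    then show ?thesis using that[of k] by blast
  qed
  show "gathered k pos crash"
  proof (cases "\<forall>r<k. r \<noteq> c \<longrightarrow> pos T r = (0, 0)")
    case True
    then show ?thesis unfolding gathered_def using const c(2) by metis
  next
    case False
    then obtain r where r: "r < k" "r \<noteq> c" and qex: "\<exists>q. frame_closure n R (cfg k (pos T)) (pos T r) q"
      using prog[OF inv] by metis
    have cfgT: "cfg k (pos t) = cfg k (pos T)" if "T \<le> t" for t
      using cfg_cong const that by blast
    have crash: "crash r = None" using c r by blast
    then obtain t \<phi> where t: "T \<le> t" "ev t = Look r \<phi>" using A r(1) unfolding fair_def by blast
    obtain q where q: "pend (Suc t) r = Some q" "frame_closure n R (cfg k (pos T)) (pos T r) q"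
      using Look_cases[OF t(2)] qex cfgT[OF t(1)] const[OF t(1) r(1)] by auto
    have ne: "q \<noteq> pos T r"
      using frame_closure_adj(1)[OF adj q(2)] by (auto simp: grid_adj_def)
    \<comment> \<open>A genuine move that is pending after \<open>T\<close> cannot be executed
      without changing a position. So it stays pending and blocks every later look of
      \<open>r\<close>, contrary to fairness.\<close>
    have stuck: "pend s r = Some q" if "Suc t \<le> s" for s
      using that
    proof (induction rule: dec_induct)
      case base show ?case by (rule q)
    next
      case (step s)
      have Ts: "T \<le> s" "T \<le> Suc s" using step t by auto
      show ?case
      proof (cases "ev s")
        case (Look r' \<phi>)
        then show ?thesis using Look_cases[OF Look] step by auto
      next
        case (Move r')
        show ?thesis
        proof (cases "r' = r")
          case True
          then have "pos (Suc s) r = q" using execution_MoveD(3)[OF ex Move] step by auto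
          then show ?thesis using const[OF Ts(2) r(1)] ne by simp
        next
          case False
          then show ?thesis using execution_MoveD(3)[OF ex Move] step by auto
        qed
      qed
    qed
    obtain s \<phi>' where "Suc t \<le> s" "ev s = Look r \<phi>'" using A r(1) crash unfolding fair_def by blast
    then show ?thesis using stuck Look_cases by fastforce
  qed
qed

section \<open>Transport of executions along a grid automorphism\<close>

lemma execution_in_grid:
  assumes ex: "execution n k A pos0 pos pend ev crash" and v: "valid_algo n A"
    and pos0: "pos0 ` {..<k} \<subseteq> grid n"
  shows "\<forall>r<k. pos t r \<in> grid n \<and> (\<forall>q. pend t r = Some q \<longrightarrow> q \<in> grid n)"
proof (induction t)
  case 0
  show ?case using ex pos0 unfolding execution_def by auto
next
  case (Suc t)
  show ?case
  proof (cases "ev t")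
    case (Look r \<phi>)
    note L = execution_LookD[OF ex Look]
    obtain u where u: "u \<in> grid n" "\<phi> u = pos t r"
      "pend (Suc t) = (pend t)(r := Some (\<phi> (A (view n (cfg k (pos t)) \<phi>) u)))" using L(6) by blast
    have "A (view n (cfg k (pos t)) \<phi>) u \<in> grid n" using v u(1) unfolding valid_algo_def by blast
    then have "\<phi> (A (view n (cfg k (pos t)) \<phi>) u) \<in> grid n" by (rule grid_aut_in[OF L(3)])
    then show ?thesis using Suc L(5) u(3) by (auto simp del: mem_grid)
  next
    case (Move r)
    then show ?thesis using execution_MoveD[OF ex Move] Suc by (auto simp del: mem_grid split: if_splits)
  qed
qed

text \<open>Composing the positions and every local frame with \<open>\<psi>\<close> leaves all
  local snapshots unchanged, so one algorithm serves both initial configurations. Hence the target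
  corner may be assumed to be the origin.\<close>

lemma gatherable_transport:
  assumes \<psi>: "grid_aut n \<psi>" and pos0: "pos0 ` {..<k} \<subseteq> grid n"
    and g: "gatherable_one_crash n k (\<lambda>r. \<psi> (pos0 r))"
  shows "gatherable_one_crash n k pos0"
proof -
  obtain A where v: "valid_algo n A" and A: "\<And>pos pend ev crash.
    execution n k A (\<lambda>r. \<psi> (pos0 r)) pos pend ev crash \<Longrightarrow> at_most_one_crash k crash \<Longrightarrow>
    fair k ev crash \<Longrightarrow> gathered k pos crash"
    using g unfolding gatherable_one_crash_def by blast
  show ?thesis
    unfolding gatherable_one_crash_def
  proof (intro exI[of _ A] conjI allI impI v)
    fix pos pend ev crash
    assume h: "execution n k A pos0 pos pend ev crash \<and> at_most_one_crash k crash \<and> fair k ev crash"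
    then have ex: "execution n k A pos0 pos pend ev crash" by blast
    have pg: "pos t ` {..<k} \<subseteq> grid n" for t
      using execution_in_grid[OF ex v pos0] by blast
    define pos' where "pos' t r = \<psi> (pos t r)" for t r
    define pend' where "pend' t r = map_option \<psi> (pend t r)" for t r
    define ev' where "ev' t = (case ev t of Look r \<phi> \<Rightarrow> Look r (\<psi> \<circ> \<phi>) | Move r \<Rightarrow> Move r)" for t
    have vw: "view n (cfg k (pos' t)) (\<psi> \<circ> \<phi>) = view n (cfg k (pos t)) \<phi>" if "grid_aut n \<phi>" for t \<phi>
      unfolding view_def pos'_def
      using cfg_comp[OF grid_aut_inj_on[OF \<psi>] pg] grid_aut_in[OF that] by (auto simp: fun_eq_iff simp del: mem_grid)
    have "execution n k A (\<lambda>r. \<psi> (pos0 r)) pos' pend' ev' crash"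
      unfolding execution_def
    proof (intro conjI allI)
      show "pos' 0 = (\<lambda>r. \<psi> (pos0 r))" "\<And>r. r < k \<longrightarrow> pend' 0 r = None"
        using ex by (auto simp: execution_def pos'_def pend'_def)
      fix t
      show "case ev' t of
        Look r \<phi> \<Rightarrow> r < k \<and> active crash r t \<and> grid_aut n \<phi> \<and> pend' t r = None \<and>
          pos' (Suc t) = pos' t \<and>
          (\<exists>u\<in>grid n. \<phi> u = pos' t r \<and>
             pend' (Suc t) = (pend' t)(r := Some (\<phi> (A (view n (cfg k (pos' t)) \<phi>) u))))
      | Move r \<Rightarrow> r < k \<and> active crash r t \<and>
          (\<exists>q. pend' t r = Some q \<and> pos' (Suc t) = (pos' t)(r := q) \<and> pend' (Suc t) = (pend' t)(r := None))"
      proof (cases "ev t")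
        case (Look r \<phi>)
        note L = execution_LookD[OF ex Look]
        obtain u where u: "u \<in> grid n" "\<phi> u = pos t r"
          "pend (Suc t) = (pend t)(r := Some (\<phi> (A (view n (cfg k (pos t)) \<phi>) u)))" using L(6) by blast
        have "pend' (Suc t) = (pend' t)(r := Some ((\<psi> \<circ> \<phi>) (A (view n (cfg k (pos' t)) (\<psi> \<circ> \<phi>)) u)))"
          unfolding vw[OF L(3)] using u(3) by (auto simp: pend'_def)
        then show ?thesis using L u grid_aut_comp[OF \<psi> L(3)]
          by (auto simp: ev'_def Look pos'_def pend'_def intro!: bexI[of _ u])
      next
        case (Move r)
        note M = execution_MoveD[OF ex Move]
        then obtain q where "pend t r = Some q" "pos (Suc t) = (pos t)(r := q)" "pend (Suc t) = (pend t)(r := None)"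
          by blast
        then show ?thesis using M(1,2) by (auto simp: ev'_def Move pos'_def pend'_def fun_eq_iff)
      qed
    qed
    moreover have "fair k ev' crash"
      unfolding fair_def
    proof (intro allI impI)
      fix r T assume "r < k" "crash r = None"
      then obtain t \<phi> where "T \<le> t" "ev t = Look r \<phi>" using h unfolding fair_def by blast
      then show "\<exists>t\<ge>T. \<exists>\<phi>. ev' t = Look r \<phi>" by (intro exI[of _ t]) (simp add: ev'_def)
    qed
    ultimately have "gathered k pos' crash" using A h by blast
    then obtain T p where "\<forall>t\<ge>T. \<forall>r<k. crash r = None \<longrightarrow> \<psi> (pos t r) = p"
      unfolding gathered_def pos'_def by blast
    then have "\<forall>t\<ge>T. \<forall>r<k. crash r = None \<longrightarrow> pos t r = inv_into (grid n) \<psi> p"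
      using pg grid_aut_inv_left[OF \<psi>] by (metis image_subset_iff lessThan_iff)
    then show "gathered k pos crash" unfolding gathered_def by blast
  qed
qed

section \<open>Distances to corners\<close>

text \<open>A corner is encoded by the pair of coordinates in which it differs from the origin.\<close>
definition cdist :: "nat \<Rightarrow> bool \<times> bool \<Rightarrow> node \<Rightarrow> nat" where
  "cdist n c v = flip n (fst c) (fst v) + flip n (snd c) (snd v)"

abbreviation (input) origin :: "bool \<times> bool" where "origin \<equiv> (False, False)"

text \<open>The action of \<open>\<phi>\<close> on the corners, characterised through distances
  because corners enter the rules only in this way.\<close>

definition corner_map :: "nat \<Rightarrow> (node \<Rightarrow> node) \<Rightarrow> (bool \<times> bool \<Rightarrow> bool \<times> bool) \<Rightarrow> bool" where
  "corner_map n \<phi> \<kappa> \<longleftrightarrow> bij \<kappa> \<and> (\<forall>c. \<forall>v\<in>grid n. cdist n (\<kappa> c) (\<phi> v) = cdist n c v)"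

lemma corner_mapD: "corner_map n \<phi> \<kappa> \<Longrightarrow> v \<in> grid n \<Longrightarrow> cdist n (\<kappa> c) (\<phi> v) = cdist n c v"
  unfolding corner_map_def by blast

lemma cdist_origin [simp]: "cdist n origin v = fst v + snd v"
  by (simp add: cdist_def flip_def)

lemma cdist_less: "v \<in> grid n \<Longrightarrow> cdist n c v < 2 * n"
  by (cases v) (auto simp: cdist_def intro!: add_strict_mono[of _ n _ n, simplified mult_2[symmetric]] flip_less)

text \<open>The second conclusion makes automorphisms that fix the origin harmless: the identity and
  the transposition both preserve \<open>toward\<close>.\<close>

lemma grid_aut_corner_map:
  assumes "grid_aut n \<phi>" "2 \<le> n"
  obtains \<kappa> where "corner_map n \<phi> \<kappa>"
    "\<kappa> origin = origin \<Longrightarrow> (\<forall>v\<in>grid n. \<phi> v = v) \<or> (\<forall>v\<in>grid n. \<phi> v = (snd v, fst v))"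
proof -
  obtain s a b where \<phi>: "\<And>v. v \<in> grid n \<Longrightarrow> \<phi> v = dih n s a b v"
    using grid_aut_cases[OF assms] by metis
  define \<kappa> where "\<kappa> c = (if s then (snd c \<noteq> a, fst c \<noteq> b) else (fst c \<noteq> a, snd c \<noteq> b))" for c :: "bool \<times> bool"
  have "inj \<kappa>" unfolding inj_def \<kappa>_def by auto
  then have "bij \<kappa>" by (simp add: bij_def finite_UNIV_inj_surj)
  moreover have "cdist n (\<kappa> c) (\<phi> v) = cdist n c v" if "v \<in> grid n" for c v
    using that unfolding \<phi>[OF that] by (cases v; cases c; cases a; cases b) (auto simp: cdist_def \<kappa>_def dih_def flip_xor)
  ultimately have "corner_map n \<phi> \<kappa>" by (simp add: corner_map_def)
  moreover have "(\<forall>v\<in>grid n. \<phi> v = v) \<or> (\<forall>v\<in>grid n. \<phi> v = (snd v, fst v))" if "\<kappa> origin = origin"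
    using that \<phi> by (auto simp: \<kappa>_def dih_def flip_def split: if_splits)
  ultimately show ?thesis using that by blast
qed

text \<open>Equal distances to two adjacent corners would put \<open>v\<close> on a middle line of
  the grid, which contains no node for even \<open>n\<close>. Distances to opposite corners add up
  to \<open>2 * (n - 1)\<close>, so equal ones would be \<open>n - 1\<close>.\<close>

lemma nearest_corner_unique:
  assumes "even n" "v \<in> grid n" "cdist n c v = d" "cdist n e v = d" "d < n - 1"
  shows "c = e"
proof -
  obtain m where n: "n = 2 * m" using assms(1) by blast
  obtain x y where v: "v = (x, y)" by fastforce
  obtain c1 c2 e1 e2 where ce: "c = (c1, c2)" "e = (e1, e2)" by fastforce
  obtain X Y where XY: "Suc (x + X) = n" "Suc (y + Y) = n"
    using assms(2) v by (metis add_Suc less_iff_Suc_add mem_grid)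
  then have "n - 1 - x = X" "n - 1 - y = Y" by linarith+
  then have eq: "(if c1 then X else x) + (if c2 then Y else y) = d" "(if e1 then X else x) + (if e2 then Y else y) = d"
    using assms(3,4) ce v by (auto simp: cdist_def flip_def)
  have "x \<noteq> X" "y \<noteq> Y" using XY n by presburger+
  moreover have "d < x + X" "d < y + Y" using XY assms(5) by linarith+
  ultimately show ?thesis unfolding ce using eq
    by (cases c1; cases c2; cases e1; cases e2) auto
qed

text \<open>Reducing the larger coordinate first avoids approaching the two corners adjacent to the origin.\<close>
definition toward :: "node \<Rightarrow> node \<Rightarrow> bool" where
  "toward v w \<longleftrightarrow> snd v \<le> fst v \<and> 0 < fst v \<and> w = (fst v - 1, snd v) \<or>
     fst v \<le> snd v \<and> 0 < snd v \<and> w = (fst v, snd v - 1)"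

lemma toward_grid: "v \<in> grid n \<Longrightarrow> toward v w \<Longrightarrow> w \<in> grid n"
  by (auto simp: toward_def mem_grid_iff)

lemma toward_adj: "toward v w \<Longrightarrow> grid_adj v w"
  by (auto simp: toward_def grid_adj_def)

lemma toward_origin: "toward v w \<Longrightarrow> Suc (fst w + snd w) = fst v + snd v"
  by (auto simp: toward_def)

lemma toward_exists: "v \<noteq> (0, 0) \<Longrightarrow> \<exists>w. toward v w"
  unfolding toward_def by (cases v) (metis fst_conv snd_conv gr0I le_zero_eq nle_le)

lemma toward_swap: "toward v w \<Longrightarrow> toward (snd v, fst v) (snd w, fst w)"
  by (auto simp: toward_def)

text \<open>The only way to approach a corner other than the origin is to reduce, say,
  \<open>y\<close> while that corner differs from the origin in \<open>x\<close> alone. Then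
  \<open>x \<le> y\<close>, and the new distance \<open>(n - 1 - x) + (y - 1)\<close> is at least
  \<open>n - 2\<close>. This is the origin of the bound \<open>d < n - 2\<close>.\<close>

lemma toward_far:
  assumes "v \<in> grid n" "toward v w" "c \<noteq> origin"
  shows "cdist n c v < cdist n c w \<or> n - 2 \<le> cdist n c w"
proof -
  obtain x y where "v = (x, y)" by fastforce
  moreover obtain c1 c2 where "c = (c1, c2)" by fastforce
  ultimately show ?thesis using assms
    by (cases c1; cases c2) (auto simp: toward_def cdist_def flip_def)
qed

lemma toward_change:
  assumes "v \<in> grid n" "toward v w"
  shows "cdist n c w = Suc (cdist n c v) \<or> Suc (cdist n c w) = cdist n c v"
proof -
  obtain x y where "v = (x, y)" by fastforce
  moreover obtain c1 c2 where "c = (c1, c2)" by fastforce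
  ultimately show ?thesis using assms
    by (cases c1; cases c2) (auto simp: toward_def cdist_def flip_def)
qed

text \<open>Capital letters stand for flipped coordinates; robots at \<open>(x, y)\<close> and
  \<open>(x', y')\<close> step to the common node \<open>(x', y)\<close>. The combination
  \<open>X + y = x' + Y' = d\<close> would give \<open>2 * d + 2 = 2 * (n - 1)\<close>, against
  \<open>d < n - 2\<close>; the others put a coordinate on a middle line or contradict the
  distances.\<close>

lemma collision_arith:
  fixes x y X Y x' y' X' Y' d n :: nat
  assumes XY: "Suc (x + X) = n" "Suc (y + Y) = n" "Suc (x' + X') = n" "Suc (y' + Y') = n" "even n"
    and s: "x = Suc x'" "y' = Suc y"
    and A: "X + y = d \<or> x + Y = d \<or> X + Y = d" and A': "X' + y' = d \<or> x' + Y' = d \<or> X' + Y' = d"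
    and E: "x + y \<le> X + y \<or> x + y \<le> x + Y \<or> x + y \<le> X + Y"
    and F: "d \<le> x + y" "d \<le> X + y" "d \<le> x + Y" "d \<le> X + Y" and F': "d \<le> x' + Y'"
    and d: "d < n - 2"
  shows False
proof -
  have ne: "x \<noteq> X" "y \<noteq> Y" using XY(1,2,5) by presburger+
  have X': "X' = Suc X" "Y = Suc Y'" using XY s by auto
  show False using A
  proof (elim disjE)
    assume "X + y = d"
    then show False using A' X' s ne XY(1,2) d by auto
  next
    assume "x + Y = d"
    then show False using F' X' s by auto
  next
    assume "X + Y = d"
    then show False using F E ne by auto
  qed
qed

text \<open>The hypothesis on \<open>e\<close> excludes that \<open>v\<close> is near the corner opposite to the origin; robots coming
  from there can collide.\<close>
lemma toward_no_collision:
  assumes n: "even n" and v: "v \<in> grid n" "v' \<in> grid n" "toward v q" "toward v' q" "v \<noteq> v'"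
    and c: "c \<noteq> origin" "cdist n c v = d" and c': "c' \<noteq> origin" "cdist n c' v' = d"
    and d: "d < n - 2" and e: "e \<noteq> origin" "cdist n origin v \<le> cdist n e v"
    and far: "\<forall>c. d \<le> cdist n c v" "\<forall>c. d \<le> cdist n c v'"
  shows False
proof -
  obtain x y where xy: "v = (x, y)" by fastforce
  obtain x' y' where xy': "v' = (x', y')" by fastforce
  obtain X Y where XY: "Suc (x + X) = n" "Suc (y + Y) = n"
    using v(1) xy by (metis add_Suc less_iff_Suc_add mem_grid)
  obtain X' Y' where XY': "Suc (x' + X') = n" "Suc (y' + Y') = n"
    using v(2) xy' by (metis add_Suc less_iff_Suc_add mem_grid)
  have fl: "n - 1 - x = X" "n - 1 - y = Y" "n - 1 - x' = X'" "n - 1 - y' = Y'" using XY XY' by auto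
  \<comment> \<open>Two different nodes stepping onto the same node arrive from perpendicular
    directions, so there is one picture up to exchanging the coordinates.\<close>
  have q: "x = Suc x' \<and> y' = Suc y \<and> y \<le> x \<and> x' \<le> y' \<or> y = Suc y' \<and> x' = Suc x \<and> x \<le> y \<and> y' \<le> x'"
    using v(3-5) xy xy' by (auto simp: toward_def)
  have A: "X + y = d \<or> x + Y = d \<or> X + Y = d"
    using c xy fl by (cases c) (auto simp: cdist_def flip_def split: if_splits)
  have A': "X' + y' = d \<or> x' + Y' = d \<or> X' + Y' = d"
    using c' xy' fl by (cases c') (auto simp: cdist_def flip_def split: if_splits)
  have E: "x + y \<le> X + y \<or> x + y \<le> x + Y \<or> x + y \<le> X + Y"
    using e xy fl by (cases e) (auto simp: cdist_def flip_def split: if_splits)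
  have F: "d \<le> x + y" "d \<le> X + y" "d \<le> x + Y" "d \<le> X + Y"
    using far(1)[rule_format, of "(False, False)"] far(1)[rule_format, of "(True, False)"]
      far(1)[rule_format, of "(False, True)"] far(1)[rule_format, of "(True, True)"] xy fl
    by (simp_all add: cdist_def flip_def)
  have F': "d \<le> x' + y'" "d \<le> X' + y'" "d \<le> x' + Y'" "d \<le> X' + Y'"
    using far(2)[rule_format, of "(False, False)"] far(2)[rule_format, of "(True, False)"]
      far(2)[rule_format, of "(False, True)"] far(2)[rule_format, of "(True, True)"] xy' fl
    by (simp_all add: cdist_def flip_def)
  show False
    using q
  proof (elim disjE conjE)
    assume "x = Suc x'" "y' = Suc y"
    then show False using collision_arith[OF XY XY' n] A A' E F F' d by blast
  next
    assume "y = Suc y'" "x' = Suc x"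
    then show False
      using collision_arith[OF XY(2,1) XY'(2,1) n, of d] A A' E F F' d by (simp add: add.commute; blast)
  qed
qed

section \<open>Nearest corners and their scores\<close>

definition near :: "nat \<Rightarrow> (node \<Rightarrow> nat) \<Rightarrow> bool \<times> bool \<Rightarrow> bool" where
  "near n f c \<longleftrightarrow> (\<exists>v\<in>grid n. f v \<noteq> 0 \<and> (\<forall>u\<in>grid n. f u \<noteq> 0 \<longrightarrow> (\<forall>e. cdist n c v \<le> cdist n e u)))"

text \<open>Distances between grid nodes and corners are below \<open>2 * n\<close>, so the
  truncated subtraction is exact and a smaller distance carries a larger weight.\<close>

definition score :: "nat \<Rightarrow> (node \<Rightarrow> nat) \<Rightarrow> bool \<times> bool \<Rightarrow> nat" where
  "score n f c = (\<Sum>v\<in>grid n. f v * (2 * n - cdist n c v)\<^sup>2)"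

definition leads :: "nat \<Rightarrow> (node \<Rightarrow> nat) \<Rightarrow> bool \<times> bool \<Rightarrow> bool" where
  "leads n f c \<longleftrightarrow> near n f c \<and> (\<forall>e. near n f e \<longrightarrow> e \<noteq> c \<longrightarrow> score n f e < score n f c)"

definition minimal :: "nat \<Rightarrow> (node \<Rightarrow> nat) \<Rightarrow> node \<Rightarrow> bool" where
  "minimal n f v \<longleftrightarrow> (\<exists>c. \<forall>u\<in>grid n. f u \<noteq> 0 \<longrightarrow> (\<forall>e. cdist n c v \<le> cdist n e u))"

text \<open>While there are ties, a robot moves only if this favours the origin over every competing corner
  \<open>e\<close>: the squares in the score make a step towards the closer of two corners count more.\<close>
definition approach :: "nat \<Rightarrow> (node \<Rightarrow> nat) \<Rightarrow> node \<Rightarrow> node \<Rightarrow> bool" where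
  "approach n f v w \<longleftrightarrow> toward v w \<and> (\<forall>e. near n f e \<longrightarrow> e \<noteq> origin \<longrightarrow>
     minimal n f v \<and> (cdist n e v < cdist n e w \<or> cdist n origin v < cdist n e v))"

text \<open>Initially the best corners may tie in score, so that none leads; the rule then
  recognises \<open>f0\<close> itself and thereby knows which corner is meant, up to symmetries of
  \<open>f0\<close>.\<close>

definition corner_rule :: "nat \<Rightarrow> (node \<Rightarrow> nat) \<Rightarrow> (node \<Rightarrow> nat) \<Rightarrow> node \<Rightarrow> node \<Rightarrow> bool" where
  "corner_rule n f0 f v w \<longleftrightarrow> (leads n f origin \<or> f = f0) \<and> approach n f v w"

section \<open>Equivariance of the notions about corners\<close>

lemma view_apply: "u \<in> grid n \<Longrightarrow> view n f \<phi> u = f (\<phi> u)"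
  by (simp add: view_def)

lemma ball_grid_aut:
  assumes "grid_aut n \<phi>"
  shows "(\<forall>u\<in>grid n. P (\<phi> u)) \<longleftrightarrow> (\<forall>u\<in>grid n. P u)"
  using grid_aut_surj[OF assms] grid_aut_in[OF assms] by metis

lemma bex_grid_aut:
  assumes "grid_aut n \<phi>"
  shows "(\<exists>u\<in>grid n. P (\<phi> u)) \<longleftrightarrow> (\<exists>u\<in>grid n. P u)"
  using grid_aut_surj[OF assms] grid_aut_in[OF assms] by metis

lemma all_corner_map: "corner_map n \<phi> \<kappa> \<Longrightarrow> (\<forall>c. P (\<kappa> c)) \<longleftrightarrow> (\<forall>c. P c)"
  unfolding corner_map_def by (metis bij_pointE)

lemma lower_bound_view:
  assumes "grid_aut n \<phi>" "corner_map n \<phi> \<kappa>"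
  shows "(\<forall>u\<in>grid n. f u \<noteq> 0 \<longrightarrow> (\<forall>e. d \<le> cdist n e u)) \<longleftrightarrow>
      (\<forall>u\<in>grid n. view n f \<phi> u \<noteq> 0 \<longrightarrow> (\<forall>e. d \<le> cdist n e u))"
proof -
  have "(\<forall>e. d \<le> cdist n e (\<phi> u)) \<longleftrightarrow> (\<forall>e. d \<le> cdist n e u)" if "u \<in> grid n" for u
    using all_corner_map[OF assms(2), where P = "\<lambda>e. d \<le> cdist n e (\<phi> u)"]
    by (simp add: corner_mapD[OF assms(2) that] del: split_paired_All)
  then show ?thesis
    using ball_grid_aut[OF assms(1), where P = "\<lambda>u. f u \<noteq> 0 \<longrightarrow> (\<forall>e. d \<le> cdist n e u)"]
    by (simp add: view_apply cong: ball_cong del: split_paired_All)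
qed

lemma minimal_view:
  assumes "grid_aut n \<phi>" "corner_map n \<phi> \<kappa>" "v \<in> grid n"
  shows "minimal n (view n f \<phi>) v \<longleftrightarrow> minimal n f (\<phi> v)"
proof -
  have cd: "cdist n (\<kappa> c) (\<phi> u) = cdist n c u" if "u \<in> grid n" for c u
    by (rule corner_mapD[OF assms(2) that])
  note * = lower_bound_view[OF assms(1,2), of f]
  have "bij \<kappa>" using assms(2) by (simp add: corner_map_def)
  then show ?thesis unfolding minimal_def * using cd[OF assms(3)] by (metis bij_pointE)
qed

lemma near_view:
  assumes "grid_aut n \<phi>" "corner_map n \<phi> \<kappa>"
  shows "near n (view n f \<phi>) c \<longleftrightarrow> near n f (\<kappa> c)"
proof -
  have cd: "cdist n (\<kappa> c) (\<phi> u) = cdist n c u" if "u \<in> grid n" for c u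
    by (rule corner_mapD[OF assms(2) that])
  note * = lower_bound_view[OF assms(1,2), of f]
  show ?thesis unfolding near_def *
    using bex_grid_aut[OF assms(1), where P = "\<lambda>v. f v \<noteq> 0 \<and>
      (\<forall>u\<in>grid n. view n f \<phi> u \<noteq> 0 \<longrightarrow> (\<forall>e. cdist n (\<kappa> c) v \<le> cdist n e u))"]
    by (simp add: view_apply cd cong: bex_cong del: split_paired_All)
qed

lemma score_view:
  assumes "grid_aut n \<phi>" "corner_map n \<phi> \<kappa>"
  shows "score n (view n f \<phi>) c = score n f (\<kappa> c)"
proof -
  have "(\<Sum>v\<in>grid n. f v * (2 * n - cdist n (\<kappa> c) v)\<^sup>2) =
      (\<Sum>v\<in>grid n. f (\<phi> v) * (2 * n - cdist n (\<kappa> c) (\<phi> v))\<^sup>2)"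
    by (rule sum.reindex_bij_betw[OF grid_aut_bij[OF assms(1)], symmetric])
  then show ?thesis unfolding score_def
    by (simp add: corner_mapD[OF assms(2)] view_apply)
qed

lemma leads_view:
  assumes "grid_aut n \<phi>" "corner_map n \<phi> \<kappa>"
  shows "leads n (view n f \<phi>) c \<longleftrightarrow> leads n f (\<kappa> c)"
proof -
  have "bij \<kappa>" using assms(2) by (simp add: corner_map_def)
  then have i: "\<kappa> e = \<kappa> c \<longleftrightarrow> e = c" for e by (simp add: bij_def inj_eq)
  show ?thesis
    unfolding leads_def near_view[OF assms] score_view[OF assms]
    using all_corner_map[OF assms(2), where P = "\<lambda>e. near n f e \<longrightarrow> e \<noteq> \<kappa> c \<longrightarrow> score n f e < score n f (\<kappa> c)"]
    by (simp add: i)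
qed

lemma leads_unique: "leads n f c \<Longrightarrow> leads n f e \<Longrightarrow> c = e"
  unfolding leads_def by (metis less_asym)

lemma view_id:
  assumes "pos ` {..<k} \<subseteq> grid n"
  shows "view n (cfg k pos) id = cfg k pos"
  using assms cfg_eq_0_iff[of k pos] by (auto simp: view_def fun_eq_iff simp del: mem_grid)

lemma grid_aut_id: "grid_aut n id"
  by (simp add: grid_aut_def)

lemma frame_closure_id:
  assumes "pos ` {..<k} \<subseteq> grid n" "v \<in> grid n" "w \<in> grid n" "R (cfg k pos) v w"
  shows "frame_closure n R (cfg k pos) v w"
  unfolding frame_closure_def
  using assms by (intro exI[of _ id] exI[of _ v] exI[of _ w]) (simp add: grid_aut_id view_id)

section \<open>The nearest corner as target\<close>

lemma cfg_card: "cfg k pos v = min 2 (card {r. r < k \<and> pos r = v})"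
proof -
  have "(let c = x in if c = 0 then 0 else if c = 1 then 1 else 2) = min 2 x" for x :: nat
    by (auto simp: Let_def)
  then show ?thesis unfolding cfg_def .
qed

text \<open>\<open>r\<close> is alone on its node, which therefore empties. Multiplicities are
  capped at 2, so a robot joining one leaves no trace at \<open>q\<close>.\<close>

lemma cfg_update:
  assumes "r < k" "q \<noteq> pos r" "\<And>s. s < k \<Longrightarrow> pos s = pos r \<Longrightarrow> s = r"
  shows "cfg k (pos(r := q)) = (cfg k pos)(pos r := 0, q := min 2 (Suc (cfg k pos q)))"
proof
  fix u
  have "{s. s < k \<and> (pos(r := q)) s = q} = insert r {s. s < k \<and> pos s = q}"
    using assms by auto
  then have q: "cfg k (pos(r := q)) q = min 2 (Suc (cfg k pos q))"
    using assms(2) by (simp add: cfg_card)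
  have "{s. s < k \<and> (pos(r := q)) s = pos r} = {}"
    using assms by (auto split: if_splits)
  then have v: "cfg k (pos(r := q)) (pos r) = 0"
    by (simp only: cfg_card card.empty min_0R)
  have "cfg k (pos(r := q)) u = cfg k pos u" if "u \<noteq> q" "u \<noteq> pos r"
  proof -
    have "{s. s < k \<and> (pos(r := q)) s = u} = {s. s < k \<and> pos s = u}" using that by auto
    then show ?thesis by (simp add: cfg_card)
  qed
  then show "cfg k (pos(r := q)) u = ((cfg k pos)(pos r := 0, q := min 2 (Suc (cfg k pos q)))) u"
    using q v by auto
qed

lemma cfg_eq_1:
  assumes "r < k" "\<And>s. s < k \<Longrightarrow> pos s = pos r \<Longrightarrow> s = r"
  shows "cfg k pos (pos r) = 1"
proof -
  have "{s. s < k \<and> pos s = pos r} = {r}" using assms by auto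
  then show ?thesis by (simp add: cfg_card)
qed

text \<open>\<open>\<delta>\<close> stands for the visible change at \<open>q\<close>: in the
  application it is 1, or 0 if \<open>q\<close> already was a multiplicity. Adding the lost term on
  the left avoids truncated subtraction of scores.\<close>

lemma score_update:
  assumes "v \<in> grid n" "q \<in> grid n" "v \<noteq> q" "f v = 1"
  shows "score n (f(v := 0, q := f q + \<delta>)) c + (2 * n - cdist n c v)\<^sup>2 =
    score n f c + \<delta> * (2 * n - cdist n c q)\<^sup>2"
proof -
  let ?W = "\<lambda>u. (2 * n - cdist n c u)\<^sup>2"
  have "score n (f(v := 0, q := f q + \<delta>)) c + ?W v =
      (\<Sum>u\<in>grid n. (f(v := 0, q := f q + \<delta>)) u * ?W u) + (\<Sum>u\<in>grid n. if u = v then ?W u else 0)"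
    using assms(1) by (simp add: score_def)
  also have "\<dots> = (\<Sum>u\<in>grid n. f u * ?W u) + (\<Sum>u\<in>grid n. if u = q then \<delta> * ?W u else 0)"
    unfolding sum.distrib[symmetric] using assms(3,4) by (intro sum.cong) (auto simp: algebra_simps)
  also have "\<dots> = score n f c + \<delta> * ?W q" using assms(2) by (simp add: score_def)
  finally show ?thesis .
qed

text \<open>\<open>best\<close> allows the origin to share the highest score. Such ties are harmless
  by \<open>stab\<close>: no symmetry of the initial configuration takes the origin to another
  corner, so recognising this configuration identifies the target.\<close>

locale nearest_corner =
  fixes n k d :: nat and pos0 :: "nat \<Rightarrow> node"
  assumes n: "even n" and inj0: "inj_on pos0 {..<k}" and grid0: "pos0 ` {..<k} \<subseteq> grid n"
    and d: "0 < d" "d < n - 2"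
    and near0: "\<exists>r<k. cdist n origin (pos0 r) = d"
    and far0: "\<And>r c. r < k \<Longrightarrow> d \<le> cdist n c (pos0 r)"
    and best: "\<And>e r. r < k \<Longrightarrow> cdist n e (pos0 r) = d \<Longrightarrow> score n (cfg k pos0) e \<le> score n (cfg k pos0) origin"
    and stab: "\<And>\<phi> \<kappa>. grid_aut n \<phi> \<Longrightarrow> corner_map n \<phi> \<kappa> \<Longrightarrow> view n (cfg k pos0) \<phi> = cfg k pos0 \<Longrightarrow> \<kappa> origin = origin"
begin

abbreviation "f0 \<equiv> cfg k pos0"

text \<open>The stage in which the origin is the only nearest corner. The witness \<open>r0\<close>
  need not be the robot closest to the origin, so the same witness survives when others overtake
  it.\<close>

definition settled :: "(nat \<Rightarrow> node) \<Rightarrow> bool" where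
  "settled pos \<longleftrightarrow> (\<exists>r0<k. cdist n origin (pos r0) \<le> d \<and>
     (\<forall>r<k. \<forall>c. c \<noteq> origin \<longrightarrow> cdist n origin (pos r0) < cdist n c (pos r)))"

text \<open>The stage with possible ties. Every displaced robot has made exactly one step, starting
  at distance \<open>d\<close> from a rival corner; this record of the past is what excludes harmful
  collisions.\<close>

definition undecided :: "(nat \<Rightarrow> node) \<Rightarrow> bool" where
  "undecided pos \<longleftrightarrow> (\<exists>r<k. cdist n origin (pos r) = d) \<and> (\<forall>r<k. d \<le> cdist n origin (pos r)) \<and>
     (cfg k pos = f0 \<or> leads n (cfg k pos) origin) \<and>
     (\<forall>r<k. pos r = pos0 r \<or> (\<exists>e. e \<noteq> origin \<and> cdist n e (pos0 r) = d \<and> toward (pos0 r) (pos r)))"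

text \<open>Pending moves stem from older snapshots; the invariant demands that the present
  configuration still justifies them.\<close>

definition inv :: "(nat \<Rightarrow> node) \<Rightarrow> (nat \<Rightarrow> node option) \<Rightarrow> bool" where
  "inv pos pend \<longleftrightarrow> (\<forall>r<k. pos r \<in> grid n) \<and>
     (\<forall>r<k. \<forall>q. pend r = Some q \<longrightarrow> q = pos r \<or> toward (pos r) q) \<and>
     (\<forall>r<k. \<forall>c. c \<noteq> origin \<longrightarrow> d \<le> cdist n c (pos r)) \<and>
     (settled pos \<or> undecided pos \<and>
        (\<forall>r<k. \<forall>q. pend r = Some q \<longrightarrow> q = pos r \<or> approach n (cfg k pos) (pos r) q))"

lemma occupied: "r < k \<Longrightarrow> cfg k pos (pos r) \<noteq> 0"
  by (auto simp: cfg_eq_0_iff)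

lemma near_level:
  assumes "\<forall>r<k. pos r \<in> grid n" "\<exists>r<k. cdist n origin (pos r) = d" "\<forall>r<k. \<forall>c. d \<le> cdist n c (pos r)"
  shows "near n (cfg k pos) e \<longleftrightarrow> (\<exists>r<k. cdist n e (pos r) = d)"
    and "minimal n (cfg k pos) v \<longleftrightarrow> (\<exists>c. cdist n c v \<le> d)"
proof -
  have lb: "(\<forall>u\<in>grid n. cfg k pos u \<noteq> 0 \<longrightarrow> (\<forall>e. x \<le> cdist n e u)) \<longleftrightarrow> x \<le> d" for x
  proof
    assume *: "\<forall>u\<in>grid n. cfg k pos u \<noteq> 0 \<longrightarrow> (\<forall>e. x \<le> cdist n e u)"
    obtain r where "r < k" "cdist n origin (pos r) = d" using assms(2) by blast
    then show "x \<le> d" using * assms(1) occupied by metis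
  next
    assume "x \<le> d"
    then show "\<forall>u\<in>grid n. cfg k pos u \<noteq> 0 \<longrightarrow> (\<forall>e. x \<le> cdist n e u)"
      using assms(3) unfolding cfg_eq_0_iff by (metis dual_order.trans imageE lessThan_iff)
  qed
  show "minimal n (cfg k pos) v \<longleftrightarrow> (\<exists>c. cdist n c v \<le> d)"
    unfolding minimal_def lb ..
  have "near n (cfg k pos) e \<longleftrightarrow> (\<exists>v\<in>grid n. cfg k pos v \<noteq> 0 \<and> cdist n e v \<le> d)"
    unfolding near_def lb ..
  also have "\<dots> \<longleftrightarrow> (\<exists>r<k. cdist n e (pos r) \<le> d)"
    unfolding cfg_eq_0_iff using assms(1) by (auto simp del: mem_grid)
  also have "\<dots> \<longleftrightarrow> (\<exists>r<k. cdist n e (pos r) = d)"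
    using assms(3) by (metis order_antisym order_refl)
  finally show "near n (cfg k pos) e \<longleftrightarrow> (\<exists>r<k. cdist n e (pos r) = d)" .
qed

lemma near_settled:
  assumes "\<forall>r<k. pos r \<in> grid n" "settled pos"
  shows "near n (cfg k pos) e \<longleftrightarrow> e = origin"
proof
  obtain r0 where r0: "r0 < k" "\<forall>r<k. \<forall>c. c \<noteq> origin \<longrightarrow> cdist n origin (pos r0) < cdist n c (pos r)"
    using assms(2) unfolding settled_def by blast
  {
    assume "near n (cfg k pos) e"
    then obtain v where v: "cfg k pos v \<noteq> 0" "\<forall>u\<in>grid n. cfg k pos u \<noteq> 0 \<longrightarrow> (\<forall>c. cdist n e v \<le> cdist n c u)"
      unfolding near_def by blast
    have "cdist n e v \<le> cdist n origin (pos r0)" using v(2) assms(1) r0(1) occupied by blast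
    moreover obtain r where "r < k" "v = pos r" using v(1) unfolding cfg_eq_0_iff by auto
    ultimately show "e = origin" using r0(2) by (metis leD)
  }
  define D where "D = (LEAST x. \<exists>r<k. cdist n origin (pos r) = x)"
  have "\<exists>r<k. cdist n origin (pos r) = D" unfolding D_def by (rule LeastI_ex) (use r0 in blast)
  then obtain r where r: "r < k" "cdist n origin (pos r) = D" by blast
  have least: "D \<le> cdist n origin (pos s)" if "s < k" for s
    unfolding D_def by (rule Least_le) (use that in blast)
  have "D \<le> cdist n c (pos s)" if "s < k" for s c
    using least[OF that] least[OF r0(1)] r0(2) that by (cases "c = origin") (simp, meson le_less_trans less_imp_le)
  then have "\<forall>u\<in>grid n. cfg k pos u \<noteq> 0 \<longrightarrow> (\<forall>c. cdist n origin (pos r) \<le> cdist n c u)"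
    using r(2) unfolding cfg_eq_0_iff by (metis imageE lessThan_iff)
  then have "near n (cfg k pos) origin"
    unfolding near_def using r(1) assms(1) occupied by blast
  then show "e = origin \<Longrightarrow> near n (cfg k pos) e" by simp
qed

lemma leads_settled:
  "\<forall>r<k. pos r \<in> grid n \<Longrightarrow> settled pos \<Longrightarrow> leads n (cfg k pos) origin"
  by (simp add: leads_def near_settled del: split_paired_All)

lemma approach_settled:
  "\<forall>r<k. pos r \<in> grid n \<Longrightarrow> settled pos \<Longrightarrow> approach n (cfg k pos) v w \<longleftrightarrow> toward v w"
  by (auto simp: approach_def near_settled)

lemma grid0': "\<forall>r<k. pos0 r \<in> grid n" using grid0 by auto

lemma near_f0: "near n f0 e \<longleftrightarrow> (\<exists>r<k. cdist n e (pos0 r) = d)"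
  using near_level(1)[OF grid0' near0] far0 by blast

lemma approach_frame:
  assumes \<phi>: "grid_aut n \<phi>" "corner_map n \<phi> \<kappa>" "\<kappa> origin = origin"
    and swap: "(\<forall>v\<in>grid n. \<phi> v = v) \<or> (\<forall>v\<in>grid n. \<phi> v = (snd v, fst v))"
    and u: "u \<in> grid n" "w \<in> grid n" and a: "approach n (view n f \<phi>) u w"
  shows "approach n f (\<phi> u) (\<phi> w)"
proof -
  have t: "toward (\<phi> u) (\<phi> w)"
    using a swap u toward_swap unfolding approach_def by metis
  have cd: "cdist n (\<kappa> c) (\<phi> u) = cdist n c u" "cdist n (\<kappa> c) (\<phi> w) = cdist n c w" for c
    using corner_mapD[OF \<phi>(2)] u by blast+
  have bij: "bij \<kappa>" using \<phi>(2) by (simp add: corner_map_def)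
  show ?thesis unfolding approach_def
  proof (intro conjI allI impI t)
    fix e assume e: "near n f e" "e \<noteq> origin"
    obtain c where c: "e = \<kappa> c" using bij by (metis bij_pointE)
    have c': "near n (view n f \<phi>) c" "c \<noteq> origin" using e c near_view[OF \<phi>(1,2)] \<phi>(3) by auto
    show "minimal n f (\<phi> u)" using a c' minimal_view[OF \<phi>(1,2) u(1)] unfolding approach_def by blast
    have "cdist n c u < cdist n c w \<or> cdist n origin u < cdist n c u"
      using a c' unfolding approach_def by blast
    then show "cdist n e (\<phi> u) < cdist n e (\<phi> w) \<or> cdist n origin (\<phi> u) < cdist n e (\<phi> u)"
      unfolding c using cd[of c] cd[of origin] \<phi>(3) by simp
  qed
qed

text \<open>A frame in which the rule fires sees a leading corner as its origin, or sees
  \<open>f0\<close>. A leader is unique; in \<open>f0\<close> no corner except the origin can lead,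
  by \<open>best\<close>; symmetries of \<open>f0\<close> fix the origin, by \<open>stab\<close>. So
  all such frames fix the origin, and the robots agree on the target.\<close>

lemma frame_closure_corner_rule:
  assumes f: "leads n f origin \<or> f = f0" and c: "frame_closure n (corner_rule n f0) f v q"
  shows "approach n f v q"
proof -
  have n2: "2 \<le> n" using d by simp
  obtain \<phi> u w where \<phi>: "grid_aut n \<phi>" "u \<in> grid n" "w \<in> grid n" "\<phi> u = v" "\<phi> w = q"
    "leads n (view n f \<phi>) origin \<or> view n f \<phi> = f0" "approach n (view n f \<phi>) u w"
    using c unfolding frame_closure_def corner_rule_def by blast
  obtain \<kappa> where \<kappa>: "corner_map n \<phi> \<kappa>"
    "\<kappa> origin = origin \<Longrightarrow> (\<forall>v\<in>grid n. \<phi> v = v) \<or> (\<forall>v\<in>grid n. \<phi> v = (snd v, fst v))"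
    using grid_aut_corner_map[OF \<phi>(1) n2] by blast
  have bij: "bij \<kappa>" using \<kappa>(1) by (simp add: corner_map_def)
  have o0: "near n f0 origin" using near0 near_f0 by blast
  have best': "score n f0 e \<le> score n f0 origin" if "near n f0 e" for e
    using that best unfolding near_f0 by blast
  have "\<kappa> origin = origin"
    using \<phi>(6)
  proof
    assume l: "leads n (view n f \<phi>) origin"
    then have l: "leads n f (\<kappa> origin)" using leads_view[OF \<phi>(1) \<kappa>(1)] by simp
    show ?thesis using f
    proof
      assume "leads n f origin" then show ?thesis using l leads_unique by blast
    next
      assume "f = f0"
      then show ?thesis using l o0 best' unfolding leads_def by (metis leD)
    qed
  next
    assume v: "view n f \<phi> = f0"
    show ?thesis using f
    proof
      assume l: "leads n f origin"
      obtain e where e: "\<kappa> e = origin" using bij by (metis bij_pointE)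
      have "leads n f0 e" using l leads_view[OF \<phi>(1) \<kappa>(1), of f e] e v by simp
      then have "e = origin" using o0 best' unfolding leads_def by (metis leD)
      then show ?thesis using e by simp
    next
      assume "f = f0"
      then show ?thesis using stab[OF \<phi>(1) \<kappa>(1)] v by simp
    qed
  qed
  then show ?thesis using approach_frame[OF \<phi>(1) \<kappa>(1) _ _ \<phi>(2,3,7)] \<kappa>(2) \<phi>(4,5) by blast
qed

section \<open>Preservation of the invariant\<close>

lemma invD:
  assumes "inv pos pend"
  shows "\<forall>r<k. pos r \<in> grid n"
    "\<forall>r<k. \<forall>q. pend r = Some q \<longrightarrow> q = pos r \<or> toward (pos r) q"
    "\<forall>r<k. \<forall>c. c \<noteq> origin \<longrightarrow> d \<le> cdist n c (pos r)"
  using assms[unfolded inv_def] by (rule conjunct1, rule conjunct1[OF conjunct2],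
    rule conjunct1[OF conjunct2[OF conjunct2]])

lemma invD_undecided:
  assumes "inv pos pend" "\<not> settled pos"
  shows "undecided pos"
    "\<forall>r<k. \<forall>q. pend r = Some q \<longrightarrow> q = pos r \<or> approach n (cfg k pos) (pos r) q"
proof -
  have "undecided pos \<and> (\<forall>r<k. \<forall>q. pend r = Some q \<longrightarrow> q = pos r \<or> approach n (cfg k pos) (pos r) q)"
    using conjunct2[OF conjunct2[OF conjunct2[OF assms(1)[unfolded inv_def]]]] assms(2)
    by (elim disjE) (erule notE, assumption, assumption)
  from conjunct1[OF this] conjunct2[OF this] show "undecided pos"
    "\<forall>r<k. \<forall>q. pend r = Some q \<longrightarrow> q = pos r \<or> approach n (cfg k pos) (pos r) q" .
qed

lemma undecided_level:
  assumes "inv pos pend" "undecided pos"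
  shows "\<forall>r<k. pos r \<in> grid n" "\<exists>r<k. cdist n origin (pos r) = d" "\<forall>r<k. \<forall>c. d \<le> cdist n c (pos r)"
proof -
  note u = assms(2)[unfolded undecided_def, THEN conjunct1]
    assms(2)[unfolded undecided_def, THEN conjunct2, THEN conjunct1]
  show "\<forall>r<k. pos r \<in> grid n" by (rule invD(1)[OF assms(1)])
  show "\<exists>r<k. cdist n origin (pos r) = d" by (rule u(1))
  show "\<forall>r<k. \<forall>c. d \<le> cdist n c (pos r)"
    using u(2) invD(3)[OF assms(1)] by metis
qed

text \<open>Consequently, while ties last, a robot at distance \<open>d\<close> from a rival corner
  has not moved yet; as initial nodes are distinct, it is alone on its node.\<close>

lemma moved_far:
  assumes "r < k" "e \<noteq> origin" "toward (pos0 r) v"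
  shows "d < cdist n e v"
proof -
  have "pos0 r \<in> grid n" using grid0' assms(1) by blast
  from toward_far[OF this assms(3,2)] far0[OF assms(1), of e] d(2) show ?thesis by linarith
qed

lemma settled_move:
  assumes pos: "\<forall>r<k. pos r \<in> grid n" "settled pos" and r: "r < k" and q: "toward (pos r) q"
  shows "settled (pos(r := q))"
proof -
  obtain r0 where r0: "r0 < k" "cdist n origin (pos r0) \<le> d"
    "\<And>s c. s < k \<Longrightarrow> c \<noteq> origin \<Longrightarrow> cdist n origin (pos r0) < cdist n c (pos s)"
    using pos(2) unfolding settled_def by blast
  have le: "cdist n origin ((pos(r := q)) r0) \<le> cdist n origin (pos r0)"
    using toward_origin[OF q] by simp
  have "cdist n origin ((pos(r := q)) r0) < cdist n c ((pos(r := q)) s)" if "s < k" "c \<noteq> origin" for s c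
  proof (cases "s = r")
    case False
    then show ?thesis using le r0(3)[OF that] by simp
  next
    case True
    have "cdist n origin (pos r0) < cdist n c q"
      using toward_far[OF _ q that(2), of n] pos(1) r r0(3)[OF r that(2)] r0(2) d(2) by fastforce
    then show ?thesis using le True by simp
  qed
  then show ?thesis unfolding settled_def using r0(1,2) le by (intro exI[of _ r0]) simp
qed

text \<open>The mover gets below \<open>d\<close>, while all distances to other corners stay at
  least \<open>d\<close>: a single such move breaks all ties.\<close>

lemma settled_move_nearest:
  assumes I: "inv pos pend" "undecided pos" and r: "r < k" and q: "toward (pos r) q"
    and dr: "cdist n origin (pos r) = d"
  shows "settled (pos(r := q))"
proof -
  have dq: "cdist n origin q < d" using toward_origin[OF q] dr by simp
  have "cdist n origin q < cdist n c ((pos(r := q)) s)" if s: "s < k" "c \<noteq> origin" for s c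
  proof (cases "s = r")
    case False
    have "d \<le> cdist n c (pos s)" using undecided_level(3)[OF I] s(1) by blast
    then show ?thesis using False dq by simp
  next
    case True
    have "d \<le> cdist n c (pos r)" using undecided_level(3)[OF I] r by blast
    moreover have "pos r \<in> grid n" using undecided_level(1)[OF I] r by blast
    ultimately have "d \<le> cdist n c q" using toward_far[OF _ q s(2), of n] d(2) by linarith
    then show ?thesis using True dq by simp
  qed
  then show ?thesis unfolding settled_def using r dq by (intro exI[of _ r]) simp
qed

text \<open>The mover leaves distance \<open>d\<close> of a rival corner, has not moved before and
  is alone on its node. Its step brings no new corner to distance \<open>d\<close>. The main point
  is that the origin ends up with a strictly higher score than every remaining rival.\<close>

lemma undecided_move:
  assumes I: "inv pos pend" "undecided pos" and r: "r < k"
    and ap: "approach n (cfg k pos) (pos r) q"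
    and c: "c \<noteq> origin" "cdist n c (pos r) = d" and dr: "cdist n origin (pos r) \<noteq> d"
  shows "undecided (pos(r := q))"
    and "\<And>e. near n (cfg k (pos(r := q))) e \<Longrightarrow> near n (cfg k pos) e"
    and "\<And>v. minimal n (cfg k (pos(r := q))) v \<longleftrightarrow> minimal n (cfg k pos) v"
proof -
  note L = undecided_level[OF I]
  let ?p = "pos(r := q)" and ?v = "pos r"
  have tw: "toward ?v q" using ap unfolding approach_def by blast
  have vg: "?v \<in> grid n" using L(1) r by blast
  have qg: "q \<in> grid n" by (rule toward_grid[OF vg tw])
  have qne: "q \<noteq> ?v" using toward_origin[OF tw] by auto
  have hist: "pos s = pos0 s \<or> (\<exists>e. e \<noteq> origin \<and> cdist n e (pos0 s) = d \<and> toward (pos0 s) (pos s))"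
    if "s < k" for s using I(2) that unfolding undecided_def by blast
  have unmoved: "pos s = pos0 s" if "s < k" "cdist n c (pos s) = d" for s
    using hist[OF that(1)] moved_far[OF that(1) c(1)] that(2) by (metis less_irrefl)
  have single: "s = r" if "s < k" "pos s = ?v" for s
    using unmoved[of s] unmoved[of r] that r c(2) inj0 by (auto dest: inj_onD)
  have gt: "d < cdist n origin ?v" using L(3) r dr by (metis le_neq_implies_less)
  have lv: "\<forall>s<k. ?p s \<in> grid n" using L(1) qg by simp
  have far_q: "d < cdist n e q" if "e \<noteq> origin" for e
    using toward_far[OF vg tw that] L(3) r d(2) by (meson diff_le_self le_less_trans less_le_trans)
  have lq: "d \<le> cdist n origin q" using toward_origin[OF tw] gt by simp
  obtain r1 where r1: "r1 < k" "cdist n origin (pos r1) = d" using L(2) by blast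
  have near1: "\<exists>s<k. cdist n origin (?p s) = d" using r1 dr by (intro exI[of _ r1]) auto
  have far1: "\<forall>s<k. \<forall>e. d \<le> cdist n e (?p s)"
  proof (intro allI impI)
    fix s e assume s: "s < k"
    have "d \<le> cdist n e q" using lq far_q[of e] by (cases "e = origin") simp_all
    moreover have "d \<le> cdist n e (pos s)" using L(3) s by blast
    ultimately show "d \<le> cdist n e (?p s)" by simp
  qed
  note L' = near_level[OF lv near1 far1] and L0 = near_level[OF L]
  show near_mono: "near n (cfg k pos) e" if ne: "near n (cfg k ?p) e" for e
  proof (cases "e = origin")
    case True
    then show ?thesis unfolding L0(1) using L(2) by blast
  next
    case False
    obtain s where s: "s < k" "cdist n e (?p s) = d" using ne unfolding L'(1) by blast
    then have "s \<noteq> r" using far_q[OF False] by auto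
    then show ?thesis unfolding L0(1) using s by auto
  qed
  show "minimal n (cfg k ?p) v \<longleftrightarrow> minimal n (cfg k pos) v" for v
    unfolding L'(2) L0(2) ..
  let ?f = "cfg k pos"
  define \<delta> where "\<delta> = min 2 (Suc (?f q)) - ?f q"
  have f2: "?f q \<le> 2" by (simp add: cfg_card)
  then have \<delta>: "?f q + \<delta> = min 2 (Suc (?f q))" "\<delta> = (if ?f q = 2 then 0 else 1)" by (auto simp: \<delta>_def)
  have f': "cfg k ?p = ?f(?v := 0, q := ?f q + \<delta>)"
    unfolding \<delta>(1) by (rule cfg_update[where pos = pos, OF r qne], rule single)
  have f1: "?f ?v = 1" by (rule cfg_eq_1[where pos = pos, OF r], rule single)
  note sc = score_update[where f = ?f and \<delta> = \<delta>, OF vg qg qne[symmetric] f1, folded f']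
  \<comment> \<open>Of two robots on \<open>q\<close>, one must have stepped there, as initial nodes
    are distinct. By the record in \<open>undecided\<close> it came from distance \<open>d\<close>
    of a rival corner, as the collision lemma requires.\<close>
  have collide: False if two: "?f q = 2" and e: "e \<noteq> origin" "cdist n origin ?v \<le> cdist n e ?v" for e
  proof -
    have "\<not> card {s. s < k \<and> pos s = q} \<le> Suc 0" using two unfolding cfg_card by linarith
    then obtain s1 s2 where s12: "s1 < k" "s2 < k" "pos s1 = q" "pos s2 = q" "s1 \<noteq> s2"
      using card_le_Suc0_iff_eq[of "{s. s < k \<and> pos s = q}"] by auto
    have "\<exists>s<k. pos s = q \<and> pos s \<noteq> pos0 s"
      using s12 inj0 by (metis inj_onD lessThan_iff)
    then obtain s where s: "s < k" "pos s = q" "pos s \<noteq> pos0 s" by blast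
    then obtain c' where c': "c' \<noteq> origin" "cdist n c' (pos0 s) = d" "toward (pos0 s) q"
      using hist by metis
    have "s \<noteq> r" using s(2) qne by blast
    then have "?v \<noteq> pos0 s" using unmoved[OF r c(2)] inj0 s(1) r by (metis inj_onD lessThan_iff)
    then show False
      using toward_no_collision[OF n vg _ tw c'(3) _ c c'(1,2) d(2) e] L(3) far0 s(1) grid0' r by blast
  qed
  have lead: "score n (cfg k ?p) e < score n (cfg k ?p) origin" if e: "near n (cfg k ?p) e" "e \<noteq> origin" for e
  proof -
    have ne: "near n ?f e" by (rule near_mono[OF e(1)])
    have le: "score n ?f e \<le> score n ?f origin"
    proof (cases "?f = f0")
      case True
      then show ?thesis using ne best near_f0 by metis
    next
      case False
      then have "leads n ?f origin" using I(2) unfolding undecided_def by blast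
      then show ?thesis using ne e(2) unfolding leads_def by (metis less_imp_le)
    qed
    have alt: "cdist n e ?v < cdist n e q \<or> cdist n origin ?v < cdist n e ?v"
      using ap ne e(2) unfolding approach_def by blast
    define a where "a = 2 * n - cdist n origin ?v"
    define b where "b = 2 * n - cdist n e ?v"
    have oq: "2 * n - cdist n origin q = Suc a"
      using toward_origin[OF tw] cdist_less[OF vg, of origin] by (simp add: a_def)
    have so: "score n (cfg k ?p) origin + a\<^sup>2 = score n ?f origin + \<delta> * (Suc a)\<^sup>2"
      using sc[of origin] oq by (simp add: a_def)
    have se: "score n (cfg k ?p) e + b\<^sup>2 = score n ?f e + \<delta> * (2 * n - cdist n e q)\<^sup>2"
      using sc[of e] by (simp add: b_def)
    show ?thesis
    proof (cases "?f q = 2")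
      case True
      \<comment> \<open>The mover vanishes in a multiplicity, so both corners lose its contribution;
        the rival, being closer, loses more.\<close>
      then have "cdist n e ?v < cdist n origin ?v" using collide e(2) by (meson leI)
      then have "a < b" using cdist_less[OF vg, of origin] by (simp add: a_def b_def)
      then have "a\<^sup>2 < b\<^sup>2" by (simp add: power_strict_mono)
      moreover have "\<delta> = 0" using True \<delta>(2) by simp
      ultimately show ?thesis using so se le by simp
    next
      case False
      then have d1: "\<delta> = 1" using \<delta>(2) by simp
      show ?thesis
      proof (cases "cdist n e ?v < cdist n e q")
        case True
        then have "2 * n - cdist n e q \<le> b" by (simp add: b_def)
        then have "(2 * n - cdist n e q)\<^sup>2 \<le> b\<^sup>2" by (simp add: power_mono)
        moreover have "a\<^sup>2 < (Suc a)\<^sup>2" by (simp add: power_strict_mono)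
        ultimately show ?thesis using so se le unfolding d1 by linarith
      next
        case F: False
        then have "Suc (cdist n e q) = cdist n e ?v" using toward_change[OF vg tw, of e] by linarith
        then have b: "2 * n - cdist n e q = Suc b" using cdist_less[OF vg, of e] unfolding b_def by linarith
        \<comment> \<open>The rival gains \<open>2 * b + 1\<close> and the origin
          \<open>2 * a + 1\<close>; in this case \<open>approach\<close> ensures that the origin was
          the closer of the two.\<close>
        have "b < a" using alt F cdist_less[OF vg, of e] unfolding a_def b_def by linarith
        moreover have "(Suc x)\<^sup>2 = x\<^sup>2 + 2 * x + 1" for x :: nat by (simp add: power2_eq_square)
        ultimately show ?thesis using so se le unfolding d1 b by simp
      qed
    qed
  qed
  have "leads n (cfg k ?p) origin"
    unfolding leads_def using lead L'(1) near1 by blast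
  moreover have "?p s = pos0 s \<or> (\<exists>e. e \<noteq> origin \<and> cdist n e (pos0 s) = d \<and> toward (pos0 s) (?p s))"
    if "s < k" for s
  proof (cases "s = r")
    case True
    have "toward (pos0 s) (?p s)" "cdist n c (pos0 s) = d" using True unmoved[OF r c(2)] c(2) tw by simp_all
    then show ?thesis using c(1) by blast
  next
    case False
    then show ?thesis using hist[OF that] by simp
  qed
  moreover have "\<forall>s<k. d \<le> cdist n origin (?p s)" using far1 by blast
  ultimately show "undecided ?p"
    unfolding undecided_def using near1 by blast
qed

lemma invI:
  assumes "\<forall>r<k. pos r \<in> grid n"
    "\<forall>r<k. \<forall>q. pend r = Some q \<longrightarrow> q = pos r \<or> toward (pos r) q"
    "\<forall>r<k. \<forall>c. c \<noteq> origin \<longrightarrow> d \<le> cdist n c (pos r)"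
    "\<not> settled pos \<Longrightarrow> undecided pos \<and> (\<forall>r<k. \<forall>q. pend r = Some q \<longrightarrow> q = pos r \<or> approach n (cfg k pos) (pos r) q)"
  shows "inv pos pend"
proof -
  have "settled pos \<or> undecided pos \<and>
      (\<forall>r<k. \<forall>q. pend r = Some q \<longrightarrow> q = pos r \<or> approach n (cfg k pos) (pos r) q)"
    using assms(4) by blast
  then show ?thesis unfolding inv_def by (intro conjI assms(1-3))
qed

lemma inv_pend:
  assumes I: "inv pos pend"
    and p: "\<forall>s<k. \<forall>w. pend' s = Some w \<longrightarrow> pend s = Some w \<or> w = pos s \<or> approach n (cfg k pos) (pos s) w"
  shows "inv pos pend'"
proof -
  have "\<forall>s<k. \<forall>w. pend' s = Some w \<longrightarrow> w = pos s \<or> toward (pos s) w"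
    using invD(2)[OF I] p unfolding approach_def by blast
  moreover have "undecided pos \<and> (\<forall>s<k. \<forall>w. pend' s = Some w \<longrightarrow> w = pos s \<or> approach n (cfg k pos) (pos s) w)"
    if "\<not> settled pos"
    using invD_undecided[OF I that] p by blast
  ultimately show ?thesis by (rule invI[OF invD(1)[OF I] _ invD(3)[OF I]])
qed

text \<open>If the configuration stays unsettled, there was a rival before the move, so
  \<open>approach\<close> places the mover at distance \<open>d\<close> from some corner. This
  corner is not the origin, since leaving distance \<open>d\<close> of the origin would settle the
  configuration.\<close>

lemma inv_move:
  assumes I: "inv pos pend" and r: "r < k" and p: "pend r = Some q"
  shows "inv (pos(r := q)) (pend(r := None))"
proof (cases "q = pos r")
  case True
  then have "pos(r := q) = pos" by simp
  moreover have "inv pos (pend(r := None))"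
    by (rule inv_pend[OF I]) (simp del: split_paired_All)
  ultimately show ?thesis by simp
next
  case False
  note g = invD(1)[OF I]
  have tw: "toward (pos r) q" using invD(2)[OF I] r p False by blast
  have g': "\<forall>s<k. (pos(r := q)) s \<in> grid n" using toward_grid[OF _ tw] g r by simp
  have t': "\<forall>s<k. \<forall>w. (pend(r := None)) s = Some w \<longrightarrow> w = (pos(r := q)) s \<or> toward ((pos(r := q)) s) w"
    using invD(2)[OF I] by (simp del: split_paired_All)
  note fr = invD(3)[OF I]
  have f': "\<forall>s<k. \<forall>c. c \<noteq> origin \<longrightarrow> d \<le> cdist n c ((pos(r := q)) s)"
  proof (intro allI impI)
    fix s c assume s: "s < k" "c \<noteq> origin"
    show "d \<le> cdist n c ((pos(r := q)) s)"
    proof (cases "s = r")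
      case True
      have "d \<le> cdist n c (pos r)" using fr r s(2) by blast
      then have "d \<le> cdist n c q" using toward_far[OF _ tw s(2), of n] g r d(2) by fastforce
      then show ?thesis using True by simp
    qed (use fr s in \<open>simp del: split_paired_All\<close>)
  qed
  show ?thesis
  proof (cases "settled (pos(r := q))")
    case True
    then show ?thesis by (intro invI g' t' f') blast
  next
    case ns: False
    then have "\<not> settled pos" using settled_move[OF g _ r tw] by blast
    then have u: "undecided pos"
      and ap: "\<forall>s<k. \<forall>q. pend s = Some q \<longrightarrow> q = pos s \<or> approach n (cfg k pos) (pos s) q"
      using invD_undecided[OF I] by blast+
    have apr: "approach n (cfg k pos) (pos r) q" using ap r p False by blast
    note L = undecided_level[OF I u]
    have "\<exists>e. e \<noteq> origin \<and> near n (cfg k pos) e"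
    proof (rule ccontr)
      assume no: "\<not> ?thesis"
      obtain r0 where r0: "r0 < k" "cdist n origin (pos r0) = d" using L(2) by blast
      have "d < cdist n c (pos s)" if "s < k" "c \<noteq> origin" for s c
        using no L(3) that near_level(1)[OF L, of c] by (metis le_neq_implies_less)
      then have "settled pos" unfolding settled_def using r0 by (intro exI[of _ r0]) simp
      then show False using \<open>\<not> settled pos\<close> by blast
    qed
    then have "minimal n (cfg k pos) (pos r)" using apr unfolding approach_def by blast
    then obtain c where "cdist n c (pos r) \<le> d" using near_level(2)[OF L] by blast
    then have c: "cdist n c (pos r) = d" using L(3) r by (metis order_antisym)
    have dr: "cdist n origin (pos r) \<noteq> d" using settled_move_nearest[OF I u r tw] ns by blast
    then have co: "c \<noteq> origin" using c by blast
    note U = undecided_move[OF I u r apr co c dr]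
    \<comment> \<open>With no new rivals and the same minimal nodes, \<open>approach\<close> can
      only become easier to satisfy, so the moves still pending stay justified.\<close>
    have mono: "\<forall>e. near n (cfg k (pos(r := q))) e \<longrightarrow> near n (cfg k pos) e"
      by (intro allI impI U(2))
    have "\<forall>s<k. \<forall>w. (pend(r := None)) s = Some w \<longrightarrow>
        w = (pos(r := q)) s \<or> approach n (cfg k (pos(r := q))) ((pos(r := q)) s) w"
    proof (intro allI impI)
      fix s w assume s: "s < k" "(pend(r := None)) s = Some w"
      then have sr: "s \<noteq> r" by auto
      then have "w = pos s \<or> approach n (cfg k pos) (pos s) w" using ap s by (simp del: split_paired_All)
      moreover have "approach n (cfg k (pos(r := q))) (pos s) w" if "approach n (cfg k pos) (pos s) w"
        using that mono unfolding approach_def U(3) by blast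
      ultimately show "w = (pos(r := q)) s \<or> approach n (cfg k (pos(r := q))) ((pos(r := q)) s) w"
        using sr by auto
    qed
    then show ?thesis using U(1) by (intro invI g' t' f') blast
  qed
qed

lemma inv_look:
  assumes I: "inv pos pend" and r: "r < k"
    and q: "q = pos r \<or> frame_closure n (corner_rule n f0) (cfg k pos) (pos r) q"
  shows "inv pos (pend(r := Some q))"
proof -
  note g = invD(1)[OF I]
  have "leads n (cfg k pos) origin \<or> cfg k pos = f0"
    using invD_undecided(1)[OF I] leads_settled[OF g] unfolding undecided_def by blast
  then have a: "q = pos r \<or> approach n (cfg k pos) (pos r) q"
    using q frame_closure_corner_rule by blast
  show ?thesis by (rule inv_pend[OF I]) (use a in \<open>simp del: split_paired_All\<close>)
qed

text \<open>One robot is at distance \<open>d\<close> from the origin, the other at distance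
  \<open>d\<close> from a rival; they differ because a corner this close is unique.\<close>

lemma two_approach:
  assumes I: "inv pos pend" "undecided pos" and ns: "\<not> settled pos"
  obtains r1 r2 w1 w2 where "r1 < k" "r2 < k" "r1 \<noteq> r2"
    "approach n (cfg k pos) (pos r1) w1" "approach n (cfg k pos) (pos r2) w2"
proof -
  note L = undecided_level[OF I] and nl = near_level[OF undecided_level[OF I]]
  have dn: "d < n - 1" using d(2) by simp
  obtain r1 where r1: "r1 < k" "cdist n origin (pos r1) = d" using L(2) by blast
  have r1g: "pos r1 \<in> grid n" using L(1) r1(1) by blast
  have "pos r1 \<noteq> (0, 0)" using r1 d(1) by auto
  then obtain w1 where w1: "toward (pos r1) w1" using toward_exists by blast
  have "approach n (cfg k pos) (pos r1) w1"
    unfolding approach_def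
  proof (intro conjI allI impI w1)
    fix e assume e: "near n (cfg k pos) e" "e \<noteq> origin"
    show "minimal n (cfg k pos) (pos r1)" unfolding nl(2) using r1(2) by (metis order_refl)
    have "cdist n e (pos r1) \<noteq> d" using nearest_corner_unique[OF n r1g r1(2) _ dn] e(2) by blast
    then have "d < cdist n e (pos r1)" using L(3) r1(1) by (metis le_neq_implies_less)
    then show "cdist n e (pos r1) < cdist n e w1 \<or> cdist n origin (pos r1) < cdist n e (pos r1)"
      using r1(2) by simp
  qed
  moreover have "\<exists>r2 w2 c. r2 < k \<and> c \<noteq> origin \<and> cdist n c (pos r2) = d \<and> approach n (cfg k pos) (pos r2) w2"
  proof -
    have ex: "\<exists>s c. s < k \<and> c \<noteq> origin \<and> cdist n c (pos s) = d"
    proof (rule ccontr)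
      assume no: "\<not> ?thesis"
      have "d < cdist n c (pos s)" if "s < k" "c \<noteq> origin" for s c
        using no L(3) that by (metis le_neq_implies_less)
      then have "settled pos" unfolding settled_def using r1 by (intro exI[of _ r1]) simp
      then show False using ns by blast
    qed
    \<comment> \<open>A rival adjacent to the origin is preferred. If there is none, the opposite
      corner is the sole rival, and every step towards the origin leads away from it.\<close>
    obtain s c where s: "s < k" "c \<noteq> origin" "cdist n c (pos s) = d"
      and pref: "c = (True, True) \<Longrightarrow> \<forall>e. near n (cfg k pos) e \<longrightarrow> e = origin \<or> e = (True, True)"
    proof (cases "\<exists>s c. s < k \<and> c \<noteq> origin \<and> c \<noteq> (True, True) \<and> cdist n c (pos s) = d")
      case True
      then show ?thesis using that by blast
    next
      case False
      then have "\<forall>e. near n (cfg k pos) e \<longrightarrow> e = origin \<or> e = (True, True)" unfolding nl(1) by blast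
      then show ?thesis using that ex by blast
    qed
    obtain x y where xy: "pos s = (x, y)" by fastforce
    have sg: "pos s \<in> grid n" using L(1) s(1) by blast
    obtain X Y where XY: "Suc (x + X) = n" "Suc (y + Y) = n"
      using sg xy by (metis add_Suc less_iff_Suc_add mem_grid)
    then have fl: "n - 1 - x = X" "n - 1 - y = Y" by linarith+
    have cd: "cdist n (c1, c2) (x, y) = (if c1 then X else x) + (if c2 then Y else y)" for c1 c2
      using fl by (simp add: cdist_def flip_def)
    have far: "d \<le> (if c1 then X else x) + (if c2 then Y else y)" for c1 c2
      using L(3) s(1) xy cd by metis
    have odd: "x \<noteq> X" "y \<noteq> Y" using XY n by presburger+
    obtain c1 c2 where c: "c = (c1, c2)" by fastforce
    have c_eq: "(if c1 then X else x) + (if c2 then Y else y) = d" using s(3) xy cd c by simp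
    have "pos s \<noteq> (0, 0)" using L(3)[rule_format, OF s(1), of origin] d(1) by auto
    then obtain w where w: "toward (pos s) w" using toward_exists by blast
    have "minimal n (cfg k pos) (pos s)" unfolding nl(2) using s(3) by (metis order_refl)
    moreover have "cdist n e (pos s) < cdist n e w \<or> cdist n origin (pos s) < cdist n e (pos s)"
      if e: "near n (cfg k pos) e" "e \<noteq> origin" for e
    proof (cases "c1 \<and> c2")
      case True
      then have "e = c" using pref c e by blast
      then show ?thesis using toward_far[OF sg w e(2)] s(3) d(2) by (meson leD le_less_trans linorder_not_less)
    next
      case False
      obtain e1 e2 where e12: "e = (e1, e2)" by fastforce
      consider "c1" "\<not> c2" | "\<not> c1" "c2" using False s(2) c by auto
      then show ?thesis
      proof cases
        case 1
        \<comment> \<open>\<open>X + y = d < n - 1 = x + X\<close> shows that \<open>toward\<close>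
          must reduce \<open>x\<close>. This leads away from the two corners with flipped first
          coordinate; for the third one the origin has the advantage
          \<open>x + y < x + Y\<close>.\<close>
        have lt: "y < x" using c_eq 1 XY d(2) by simp
        then have w': "w = (x - 1, y)" using w xy by (auto simp: toward_def)
        have "y \<le> Y" using far[of True True] c_eq 1 by simp
        then have "x + y < x + Y" using odd by simp
        then show ?thesis using e(2) e12 xy w' lt XY cd[of e1 e2]
          by (cases e1; cases e2) (auto simp: cdist_def flip_def)
      next
        case 2
        have lt: "x < y" using c_eq 2 XY d(2) by simp
        then have w': "w = (x, y - 1)" using w xy by (auto simp: toward_def)
        have "x \<le> X" using far[of True True] c_eq 2 by simp
        then have "x + y < X + y" using odd by simp
        then show ?thesis using e(2) e12 xy w' lt XY cd[of e1 e2]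
          by (cases e1; cases e2) (auto simp: cdist_def flip_def)
      qed
    qed
    ultimately have "approach n (cfg k pos) (pos s) w" unfolding approach_def using w by blast
    then show ?thesis using s by blast
  qed
  then obtain r2 w2 c where r2: "r2 < k" "c \<noteq> origin" "cdist n c (pos r2) = d" "approach n (cfg k pos) (pos r2) w2"
    by blast
  moreover have "r1 \<noteq> r2"
    using nearest_corner_unique[OF n r1g r1(2) _ dn, of c] r2(2,3) by blast
  ultimately show ?thesis using that r1(1) by blast
qed

theorem gatherable: "gatherable_one_crash n k pos0"
proof (rule gatherable_by_invariant[of n "corner_rule n f0" k inv])
  show "adjacent_rule n (corner_rule n f0)"
    unfolding adjacent_rule_def corner_rule_def approach_def using toward_adj by blast
next
  fix pend :: "nat \<Rightarrow> node option" assume p: "\<forall>r<k. pend r = None"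
  have "undecided pos0" unfolding undecided_def using near0 far0 by blast
  then show "inv pos0 pend" using p grid0' far0 by (intro invI) simp_all
next
  fix pos pend r q assume I: "inv pos pend" "r < k" "pend r = None"
    "q = pos r \<or> frame_closure n (corner_rule n f0) (cfg k pos) (pos r) q"
  show "inv pos (pend(r := Some q))" by (rule inv_look[OF I(1,2,4)])
next
  fix pos pend r q assume I: "inv pos pend" "r < k" "pend r = Some q"
  show "inv (pos(r := q)) (pend(r := None))" by (rule inv_move[OF I])
  have "q = pos r \<or> toward (pos r) q" using invD(2)[OF I(1)] I(2,3) by blast
  then show "q = pos r \<or> fst q + snd q < fst (pos r) + snd (pos r)"
    using toward_origin by (metis lessI)
next
  fix pos pend c r assume I: "inv pos pend" and r: "r < k" "r \<noteq> c" "pos r \<noteq> (0, 0)"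
  note g = invD(1)[OF I]
  have lead: "leads n (cfg k pos) origin \<or> cfg k pos = f0"
    using invD_undecided(1)[OF I] leads_settled[OF g] unfolding undecided_def by blast
  have fc: "frame_closure n (corner_rule n f0) (cfg k pos) (pos s) w"
    if "s < k" "approach n (cfg k pos) (pos s) w" for s w
  proof (rule frame_closure_id)
    show "pos ` {..<k} \<subseteq> grid n" "pos s \<in> grid n" using g that(1) by blast+
    then show "w \<in> grid n" using toward_grid that(2) unfolding approach_def by blast
    show "corner_rule n f0 (cfg k pos) (pos s) w" unfolding corner_rule_def using lead that(2) by blast
  qed
  show "\<exists>r<k. r \<noteq> c \<and> (\<exists>q. frame_closure n (corner_rule n f0) (cfg k pos) (pos r) q)"
  proof (cases "settled pos")
    case True
    obtain w where "toward (pos r) w" using toward_exists r(3) by blast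
    then show ?thesis using fc[OF r(1)] approach_settled[OF g True] r by blast
  next
    case False
    then have "undecided pos" using invD_undecided(1)[OF I] by blast
    then obtain r1 r2 w1 w2 where "r1 < k" "r2 < k" "r1 \<noteq> r2"
      "approach n (cfg k pos) (pos r1) w1" "approach n (cfg k pos) (pos r2) w2"
      using two_approach[OF I _ False] by blast
    then show ?thesis using fc by metis
  qed
qed

end

section \<open>Two walkers on a diagonal symmetry\<close>

definition swap :: "node \<Rightarrow> node" where "swap v = (snd v, fst v)"

lemma swap_simps [simp]: "swap (x, y) = (y, x)" "swap (swap v) = v" "fst (swap v) = snd v" "snd (swap v) = fst v"
  by (simp_all add: swap_def)

lemma swap_in_grid [simp]: "swap v \<in> grid n \<longleftrightarrow> v \<in> grid n"
  by (auto simp: swap_def mem_grid_iff)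

lemma dih_True: "dih n True a b v = dih n False a b (swap v)"
  by (simp add: dih_def)

lemma dih_swap: "dih n False b a (swap v) = swap (dih n False a b v)"
  by (simp add: dih_def swap_def)

lemma dih_id: "v \<in> grid n \<Longrightarrow> dih n False False False v = v"
  by (simp add: dih_def flip_def)

lemma dih_id_image: "S \<subseteq> grid n \<Longrightarrow> dih n False False False ` S = S"
  using image_cong[of S S "dih n False False False" "\<lambda>v. v"] dih_id unfolding image_ident by blast

definition is_corner :: "nat \<Rightarrow> node \<Rightarrow> bool" where
  "is_corner n v \<longleftrightarrow> (fst v = 0 \<or> fst v = n - 1) \<and> (snd v = 0 \<or> snd v = n - 1)"

lemma is_corner_dih: "v \<in> grid n \<Longrightarrow> is_corner n (dih n s a b v) \<longleftrightarrow> is_corner n v"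
  by (cases v) (auto simp: is_corner_def dih_def flip_def)

lemma is_corner_swap [simp]: "is_corner n (swap v) \<longleftrightarrow> is_corner n v"
  by (auto simp: is_corner_def swap_def)

lemma cfg_inj:
  assumes "inj_on pos {..<k}"
  shows "cfg k pos v = (if v \<in> pos ` {..<k} then 1 else 0)"
proof (cases "v \<in> pos ` {..<k}")
  case True
  then obtain r where r: "r < k" "v = pos r" by auto
  have "cfg k pos (pos r) = 1" by (rule cfg_eq_1[OF r(1)]) (use assms r in \<open>auto dest: inj_onD\<close>)
  then show ?thesis using True r by simp
next
  case False
  then show ?thesis using cfg_eq_0_iff by auto
qed

lemma view_eq_cfg_image:
  assumes \<phi>: "grid_aut n \<phi>" and pos: "pos ` {..<k} \<subseteq> grid n" and pos': "pos' ` {..<k} \<subseteq> grid n"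
    and eq: "view n (cfg k pos) \<phi> = cfg k pos'"
  shows "\<phi> ` (pos' ` {..<k}) = pos ` {..<k}"
proof -
  have *: "\<phi> u \<in> pos ` {..<k} \<longleftrightarrow> u \<in> pos' ` {..<k}" if "u \<in> grid n" for u
    using fun_cong[OF eq, of u] that cfg_eq_0_iff[of k pos] cfg_eq_0_iff[of k pos'] by (metis view_apply)
  show ?thesis
  proof (intro equalityI subsetI)
    fix v assume "v \<in> \<phi> ` (pos' ` {..<k})"
    then obtain u where "u \<in> pos' ` {..<k}" "v = \<phi> u" by blast
    then show "v \<in> pos ` {..<k}" using * pos' by blast
  next
    fix v assume v: "v \<in> pos ` {..<k}"
    then obtain u where "u \<in> grid n" "\<phi> u = v" using grid_aut_surj[OF \<phi>] pos by blast
    then show "v \<in> \<phi> ` (pos' ` {..<k})" using * v by blast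
  qed
qed

text \<open>Chasing a displaced node through reflections: \<open>R\<close> is symmetric in the diagonal and \<open>R \<union> {p, q}\<close> is
  symmetric under \<open>x \<mapsto> n - 1 - x\<close>, so a quarter turn maps \<open>R\<close> into \<open>R \<union> {p, q}\<close>.\<close>
lemma no_mirror_horizontal:
  fixes x0 y0 x1 n :: nat
  assumes n: "even n" and lt: "y0 < x1" "x1 < x0" "x0 < n"
    and sym: "\<And>a b. (a, b) \<in> R \<Longrightarrow> (b, a) \<in> R"
    and mir: "\<And>a b. (a, b) \<in> insert (x0, y0) (insert (y0, x1) R) \<Longrightarrow> (n - 1 - a, b) \<in> insert (x0, y0) (insert (y0, x1) R)"
    and R: "(y0, x0) \<notin> R" "(x1, y0) \<notin> R"
  shows False
proof -
  define f where "f z = n - 1 - z" for z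
  have ff: "f (f z) = z" "f z \<noteq> z" if "z < n" for z using that n unfolding f_def by (auto, presburger)
  note mir = mir[folded f_def]
  have turn: "(a, b) \<in> R \<Longrightarrow> (f b, a) \<in> insert (x0, y0) (insert (y0, x1) R)" for a b
    using mir[of b a] sym by simp
  have l: "x0 < n" "x1 < n" "y0 < n" using lt by auto
  show False
  proof (cases "f x0 = y0")
    case False
    then have F: "f y0 \<noteq> x0" using ff l by metis
    have "(f x0, y0) \<in> R" using mir[of x0 y0] ff l lt by auto
    then have "(f y0, f x0) \<in> R" using turn[of "f x0" y0] F ff l by auto
    then have "(x0, f y0) \<in> R" using turn[of "f y0" "f x0"] ff l lt by auto
    then have "(y0, x0) \<in> R" using turn[of x0 "f y0"] ff l lt by auto
    then show False using R by blast
  next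
    case True
    then have F: "f y0 = x0" using ff l by metis
    have "(x0, x1) \<in> R" using mir[of y0 x1] F lt by auto
    then have "(f x1, x0) \<in> R" using turn[of x0 x1] lt by auto
    then have "(y0, f x1) \<in> R" using turn[of "f x1" x0] True ff l lt by auto
    then have "(x1, y0) \<in> R" using turn[of y0 "f x1"] ff l lt by auto
    then show False using R by blast
  qed
qed

text \<open>The same kind of chase when the first walker has gone from \<open>(x0, y0)\<close> to
  \<open>(x0, y1)\<close>: it starts at the mirror image of an exceptional node and applies quarter
  turns until it reaches a node known to be missing.\<close>

lemma no_mirror_vertical:
  fixes x0 y0 y1 n :: nat
  assumes n: "even n" and lt: "y1 < y0" "y0 < x0" "x0 < n"
    and sym: "\<And>a b. (a, b) \<in> R \<Longrightarrow> (b, a) \<in> R"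
    and mir: "\<And>a b. (a, b) \<in> insert (x0, y1) (insert (y0, x0) R) \<Longrightarrow> (n - 1 - a, b) \<in> insert (x0, y1) (insert (y0, x0) R)"
    and R: "(x0, y0) \<notin> R" "(y1, x0) \<notin> R"
  shows False
proof -
  define f where "f z = n - 1 - z" for z
  have ff: "f (f z) = z" "f z \<noteq> z" if "z < n" for z using that n unfolding f_def by (auto, presburger)
  note mir = mir[folded f_def]
  have turn: "(a, b) \<in> R \<Longrightarrow> (f b, a) \<in> insert (x0, y1) (insert (y0, x0) R)" for a b
    using mir[of b a] sym by simp
  have l: "x0 < n" "y1 < n" "y0 < n" using lt by auto
  show False
  proof (cases "f x0 = y0")
    case False
    then have F: "f y0 \<noteq> x0" using ff l by metis
    have "(f y0, x0) \<in> R" using mir[of y0 x0] ff l lt by auto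
    then have "(f x0, f y0) \<in> R" using turn[of "f y0" x0] False F ff l by auto
    then have "(y0, f x0) \<in> R" using turn[of "f x0" "f y0"] ff l lt by auto
    then have "(x0, y0) \<in> R" using turn[of y0 "f x0"] ff l lt by auto
    then show False using R by blast
  next
    case True
    then have F: "f y0 = x0" using ff l by metis
    have "(y0, y1) \<in> R" using mir[of x0 y1] True lt by auto
    then have "(f y1, y0) \<in> R" using turn[of y0 y1] lt by auto
    then have "(x0, f y1) \<in> R" using turn[of "f y1" y0] F ff l lt by auto
    then have "(y1, x0) \<in> R" using turn[of x0 "f y1"] ff l lt by auto
    then show False using R by blast
  qed
qed

text \<open>Both sums are nonnegative and one is minus the other, so all their terms vanish.\<close>

lemma slack_zero:
  fixes A a b c d x y :: int
  assumes "0 \<le> A" "a \<le> x" "b \<le> y" "c \<le> x" "d \<le> y"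
    and "A + 2 * (x - a) + 2 * (y - b) = - (A + 2 * (x - c) + 2 * (y - d))"
  shows "a = x \<and> b = y \<and> c = x \<and> d = y"
  using assms by auto

text \<open>The axis of symmetry is the main diagonal, and \<open>balance\<close> puts the centre of
  mass on the side of the origin. \<open>closest\<close> keeps the paths of the walkers free of
  other robots; \<open>asym\<close> is what non-partitivity provides.\<close>

locale diagonal_pair =
  fixes n k :: nat and pos0 :: "nat \<Rightarrow> node" and m1 m2 x0 y0 :: nat
  assumes n: "even n" and inj0: "inj_on pos0 {..<k}" and grid0: "pos0 ` {..<k} \<subseteq> grid n"
    and corner0: "\<And>r. r < k \<Longrightarrow> \<not> is_corner n (pos0 r)"
    and m: "m1 < k" "m2 < k" "pos0 m1 = (x0, y0)" "pos0 m2 = (y0, x0)" and off: "y0 < x0"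
    and sym: "\<And>v. v \<in> pos0 ` {..<k} \<Longrightarrow> swap v \<in> pos0 ` {..<k}"
    and closest: "\<And>v. v \<in> pos0 ` {..<k} \<Longrightarrow> snd v < fst v \<Longrightarrow> x0 + y0 \<le> fst v + snd v"
    and balance: "0 \<le> (\<Sum>v\<in>pos0 ` {..<k}. int n - 1 - 2 * int (fst v))"
    and asym: "\<And>a b. a \<or> b \<Longrightarrow> dih n False a b ` (pos0 ` {..<k}) \<noteq> pos0 ` {..<k}"
begin

definition R :: "node set" where "R = pos0 ` {..<k} - {(x0, y0), (y0, x0)}"

text \<open>A superset of the nodes visited from \<open>(x0, y0)\<close> by iterating
  \<open>advance\<close> before the origin is reached. The last clause remembers the direction of
  the first step: the coordinate reduced first keeps its initial value only at the start.\<close>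

definition track :: "node \<Rightarrow> bool" where
  "track p \<longleftrightarrow> snd p < fst p \<and> fst p \<le> x0 \<and> snd p \<le> y0 \<and> p \<noteq> (n - 1, 0) \<and>
     (if Suc y0 < x0 \<or> y0 = 0 then fst p = x0 \<longrightarrow> snd p = y0 else snd p = y0 \<longrightarrow> fst p = x0)"

text \<open>Like \<open>toward\<close>, but the walker stays strictly on its own side of the
  diagonal until it enters the origin, so the walkers cannot meet on the way.\<close>

definition advance :: "node \<Rightarrow> node" where
  "advance p = (if Suc (snd p) < fst p \<or> snd p = 0 then (fst p - 1, snd p) else (fst p, snd p - 1))"

text \<open>\<open>p'\<close> is the mirror image of the second walker, so that both arguments range
  over the same track.\<close>

definition place :: "node \<Rightarrow> node \<Rightarrow> nat \<Rightarrow> node" where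
  "place p p' = pos0(m1 := p, m2 := swap p')"

text \<open>The first alternative covers all pairs of track nodes, since asynchronous walkers may
  advance at very different speeds.\<close>

definition walk_rule :: "(node \<Rightarrow> nat) \<Rightarrow> node \<Rightarrow> node \<Rightarrow> bool" where
  "walk_rule g v w \<longleftrightarrow>
     (\<exists>p p'. track p \<and> track p' \<and> g = cfg k (place p p') \<and>
        (v = p \<and> w = advance p \<or> v = swap p' \<and> w = swap (advance p'))) \<or>
     (g (0, 0) \<noteq> 0 \<and> (\<forall>c\<in>grid n. is_corner n c \<longrightarrow> c \<noteq> (0, 0) \<longrightarrow> g c = 0) \<and> toward v w)"

lemma x0_less: "x0 < n" using grid0 m(1,3) by auto

lemma n4: "4 \<le> n"
proof (rule ccontr)
  assume "\<not> 4 \<le> n"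
  then have "n = 2" using n x0_less off by presburger
  then show False using corner0[OF m(1)] m(3) off x0_less by (auto simp: is_corner_def)
qed

lemma n2: "2 \<le> n" using n4 by simp

lemma track_less: "track p \<Longrightarrow> snd p < fst p" by (simp add: track_def)

lemma track_bounds: "track p \<Longrightarrow> int (fst p) \<le> int x0" "track p \<Longrightarrow> int (snd p) \<le> int y0"
  by (simp_all add: track_def)

lemma track_grid: "track p \<Longrightarrow> p \<in> grid n"
  using x0_less off by (auto simp: track_def mem_grid_iff)

lemma track_start: "track (x0, y0)"
  using off corner0[OF m(1)] m(3) by (auto simp: track_def is_corner_def)

lemma track_corner: "track p \<Longrightarrow> \<not> is_corner n p"
  by (cases p) (auto simp: track_def is_corner_def)

text \<open>Such a node has coordinate sum at least \<open>x0 + y0\<close> by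
  \<open>closest\<close>, and at most that by the bounds in \<open>track\<close>.\<close>

lemma track_occupied: "track p \<Longrightarrow> p \<in> pos0 ` {..<k} \<Longrightarrow> p = (x0, y0)"
  using closest[of p] by (cases p) (auto simp: track_def)

lemma track_R: "track p \<Longrightarrow> p \<notin> R" "track p \<Longrightarrow> swap p \<notin> R"
  using track_occupied[of p] sym[of "swap p"] by (auto simp: R_def)

lemma R_sym: "v \<in> R \<Longrightarrow> swap v \<in> R"
  using sym[of v] by (cases v) (auto simp: R_def)

lemma R_grid: "R \<subseteq> grid n" using grid0 by (auto simp: R_def)

lemma finite_R: "finite R" by (simp add: R_def)

lemma start_set: "pos0 ` {..<k} = insert (x0, y0) (insert (swap (x0, y0)) R)"
  using m by (force simp: R_def)

lemma m12: "m1 \<noteq> m2" using m off by auto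

lemma place_start: "place (x0, y0) (x0, y0) = pos0"
  using m by (auto simp: place_def fun_eq_iff)

lemma R_image: "pos0 ` ({..<k} - {m1, m2}) = R"
proof -
  have "pos0 ` ({..<k} - {m1, m2}) = pos0 ` {..<k} - pos0 ` {m1, m2}"
    using inj0 m(1,2) by (intro inj_on_image_set_diff[where C = "{..<k}"]) auto
  then show ?thesis using m by (auto simp: R_def)
qed

lemma place_image: "place p p' ` {..<k} = insert p (insert (swap p') R)"
proof -
  have "place p p' ` {..<k} = place p p' ` (insert m1 (insert m2 ({..<k} - {m1, m2})))"
    using m by (intro arg_cong[where f = "image _"]) auto
  also have "\<dots> = insert p (insert (swap p') (place p p' ` ({..<k} - {m1, m2})))"
    using m12 unfolding image_insert by (simp only: place_def fun_upd_same fun_upd_other not_False_eq_True)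
  also have "place p p' ` ({..<k} - {m1, m2}) = pos0 ` ({..<k} - {m1, m2})"
    by (intro image_cong) (auto simp: place_def)
  finally show ?thesis using R_image by simp
qed

lemma place_inj:
  assumes "track p" "track p'"
  shows "inj_on (place p p') {..<k}"
proof -
  have "inj_on (place p p') ({..<k} - {m1, m2})"
    using inj0 by (auto simp: inj_on_def place_def)
  moreover have "place p p' ` ({..<k} - {m1, m2}) = R"
    using R_image by (auto simp: place_def image_iff)
  moreover have "p \<noteq> swap p'" using track_less[OF assms(1)] track_less[OF assms(2)] by auto
  moreover have "place p p' m1 = p" "place p p' m2 = swap p'" using m12 by (simp_all add: place_def)
  ultimately have "inj_on (place p p') (insert m1 (insert m2 ({..<k} - {m1, m2})))"
    using track_R(1)[OF assms(1)] track_R(2)[OF assms(2)] m12 unfolding inj_on_insert by auto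
  moreover have "insert m1 (insert m2 ({..<k} - {m1, m2})) = {..<k}" using m by auto
  ultimately show ?thesis by simp
qed

lemma place_grid: "track p \<Longrightarrow> track p' \<Longrightarrow> place p p' ` {..<k} \<subseteq> grid n"
  unfolding place_image using track_grid R_grid by (simp del: mem_grid)

lemma place_corner: "track p \<Longrightarrow> track p' \<Longrightarrow> v \<in> place p p' ` {..<k} \<Longrightarrow> \<not> is_corner n v"
  unfolding place_image using track_corner[of p] track_corner[of p'] corner0 by (auto simp: R_def)

lemma advance_track: "track p \<Longrightarrow> advance p = (0, 0) \<or> track (advance p)"
  using n4 x0_less off by (cases p) (auto simp: advance_def track_def split: if_splits)

lemma advance_less: "track p \<Longrightarrow> Suc (fst (advance p) + snd (advance p)) = fst p + snd p"
  by (cases p) (auto simp: advance_def track_def)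

lemma advance_adj: "track p \<Longrightarrow> grid_adj p (advance p)"
  by (cases p) (auto simp: advance_def track_def grid_adj_def)

lemma advance_grid: "track p \<Longrightarrow> advance p \<in> grid n"
  using track_grid[of p] by (cases p) (auto simp: advance_def)

lemma grid_adj_swap: "grid_adj (swap u) (swap v) \<longleftrightarrow> grid_adj u v"
  by (auto simp: grid_adj_def)

section \<open>Coordinate sums and the frames of walking configurations\<close>

lemma sum_place:
  fixes h :: "nat \<Rightarrow> int"
  assumes "track p" "track p'"
  shows "(\<Sum>v\<in>insert p (insert (swap p') R). h (fst v)) = h (fst p) + h (snd p') + (\<Sum>v\<in>R. h (fst v))"
    and "(\<Sum>v\<in>insert p (insert (swap p') R). h (snd v)) = h (snd p) + h (fst p') + (\<Sum>v\<in>R. h (fst v))"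
proof -
  have "p \<noteq> swap p'" using track_less[OF assms(1)] track_less[OF assms(2)] by auto
  then have n: "p \<notin> insert (swap p') R" "swap p' \<notin> R" using track_R assms by auto
  show "(\<Sum>v\<in>insert p (insert (swap p') R). h (fst v)) = h (fst p) + h (snd p') + (\<Sum>v\<in>R. h (fst v))"
    using n finite_R by simp
  have "(\<Sum>v\<in>R. h (snd v)) = (\<Sum>v\<in>R. h (fst v))"
    by (rule sum.reindex_bij_witness[where i = swap and j = swap]) (auto intro: R_sym)
  then show "(\<Sum>v\<in>insert p (insert (swap p') R). h (snd v)) = h (snd p) + h (fst p') + (\<Sum>v\<in>R. h (fst v))"
    using n finite_R by simp
qed

text \<open>The walkers are on different sides of the diagonal and outside \<open>R\<close>, so the
  set of occupied nodes determines both positions.\<close>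

lemma track_eq:
  assumes "track p" "track p'" "track q" "track q'"
    and "insert p (insert (swap p') R) = insert q (insert (swap q') R)"
  shows "p = q" "p' = q'"
proof -
  have "p \<noteq> swap q'" "q \<noteq> swap p'"
    using track_less assms(1-4) by (metis less_asym swap_simps(3,4))+
  then show "p = q" using assms(5) track_R(1)[OF assms(1)] by blast
  have "swap p' \<in> insert q (insert (swap q') R)" using assms(5) by blast
  then have "swap p' = swap q'" using track_R(2)[OF assms(2)] \<open>q \<noteq> swap p'\<close> by auto
  then show "p' = q'" by (metis swap_simps(2))
qed

lemma swap_place_set: "swap ` insert p (insert (swap p') R) = insert p' (insert (swap p) R)"
proof -
  have "swap ` R = R"
  proof (intro equalityI subsetI)
    show "v \<in> R" if "v \<in> swap ` R" for v using that R_sym by blast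
    show "v \<in> swap ` R" if "v \<in> R" for v
      using imageI[OF R_sym[OF that], of swap] unfolding swap_simps .
  qed
  then show ?thesis by auto
qed

text \<open>Total displacements of the robots from the centre, which the two walkers only increase.\<close>
abbreviation "offset z \<equiv> int n - 1 - 2 * int z"

definition xsum :: "node set \<Rightarrow> int" where "xsum S = (\<Sum>v\<in>S. offset (fst v))"
definition ysum :: "node set \<Rightarrow> int" where "ysum S = (\<Sum>v\<in>S. offset (snd v))"

text \<open>By symmetry in the diagonal both sums start from the same value \<open>A\<close>; the
  coordinates of \<open>p'\<close> enter crosswise because it is a mirror image.\<close>

lemma sums_place:
  assumes "track p" "track p'"
  defines "S \<equiv> insert p (insert (swap p') R)" and "A \<equiv> xsum (pos0 ` {..<k})"
  shows "xsum S = A + 2 * (int x0 - int (fst p)) + 2 * (int y0 - int (snd p'))"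
    and "ysum S = A + 2 * (int y0 - int (snd p)) + 2 * (int x0 - int (fst p'))"
    and "0 \<le> A"
proof -
  have "A = offset x0 + offset y0 + xsum R"
    unfolding A_def start_set xsum_def using sum_place(1)[OF track_start track_start, of offset] by simp
  then show "xsum S = A + 2 * (int x0 - int (fst p)) + 2 * (int y0 - int (snd p'))"
    "ysum S = A + 2 * (int y0 - int (snd p)) + 2 * (int x0 - int (fst p'))"
    using sum_place[OF assms(1,2), of offset] by (simp_all add: S_def xsum_def ysum_def)
  show "0 \<le> A" using balance by (simp add: A_def xsum_def)
qed

lemma offset_flip: "z < n \<Longrightarrow> offset (flip n a z) = (if a then - offset z else offset z)"
  by (auto simp: flip_def)

lemma sums_dih:
  assumes "S \<subseteq> grid n"
  shows "xsum (dih n False a b ` S) = (if a then - xsum S else xsum S)"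
    and "ysum (dih n False a b ` S) = (if b then - ysum S else ysum S)"
proof -
  have g: "fst v < n" "snd v < n" if "v \<in> S" for v using assms that mem_grid_iff by blast+
  have offa: "offset (fst (dih n False a b v)) = (if a then - offset (fst v) else offset (fst v))" if "v \<in> S" for v
    unfolding dih_def by (simp only: if_False fst_conv offset_flip[OF g(1)[OF that]])
  have offb: "offset (snd (dih n False a b v)) = (if b then - offset (snd v) else offset (snd v))" if "v \<in> S" for v
    unfolding dih_def by (simp only: if_False snd_conv offset_flip[OF g(2)[OF that]])
  have inj: "inj_on (dih n False a b) S" using bij_betw_dih assms by (meson bij_betw_imp_inj_on inj_on_subset)
  have "xsum (dih n False a b ` S) = (\<Sum>v\<in>S. if a then - offset (fst v) else offset (fst v))"
    unfolding xsum_def sum.reindex[OF inj] using offa by (intro sum.cong) simp_all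
  then show "xsum (dih n False a b ` S) = (if a then - xsum S else xsum S)"
    by (cases a) (simp_all only: xsum_def sum_negf if_True if_False)
  have "ysum (dih n False a b ` S) = (\<Sum>v\<in>S. if b then - offset (snd v) else offset (snd v))"
    unfolding ysum_def sum.reindex[OF inj] using offb by (intro sum.cong) simp_all
  then show "ysum (dih n False a b ` S) = (if b then - ysum S else ysum S)"
    by (cases b) (simp_all only: ysum_def sum_negf if_True if_False)
qed

lemma place_set_grid: "track p \<Longrightarrow> track p' \<Longrightarrow> insert p (insert (swap p') R) \<subseteq> grid n"
  using place_grid place_image by metis

lemma start_pair_set: "p = (x0, y0) \<Longrightarrow> p' = (x0, y0) \<Longrightarrow> insert p (insert (swap p') R) = pos0 ` {..<k}"
  using start_set by simp

text \<open>The reflection negates \<open>xsum\<close>, which is nonnegative in both configurations,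
  so no walker has changed its first coordinate. Preservation of \<open>ysum\<close> and the last
  clause of \<open>track\<close> then force equal positions in both, with at least one walker at its
  start. So the reflection is a symmetry, which \<open>asym\<close> or the chase refutes.\<close>

lemma no_mirror:
  assumes t: "track p" "track p'" "track q" "track q'"
    and eq: "dih n False True False ` insert q (insert (swap q') R) = insert p (insert (swap p') R)"
  shows False
proof -
  let ?S = "insert p (insert (swap p') R)" and ?Q = "insert q (insert (swap q') R)"
  let ?A = "xsum (pos0 ` {..<k})"
  note sp = sums_place[OF t(1,2)] and sq = sums_place[OF t(3,4)]
  have X: "xsum ?S = - xsum ?Q" and Y: "ysum ?S = ysum ?Q"
    using sums_dih[OF place_set_grid[OF t(3,4)], of True False] eq by simp_all
  note bound = t[THEN track_bounds(1)] t[THEN track_bounds(2)]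
  have "int (fst p) = int x0" "int (snd p') = int y0" "int (fst q) = int x0" "int (snd q') = int y0"
    using slack_zero[OF sp(3) bound(1,6,3,8)] X unfolding sp(1) sq(1) by blast+
  then have fixed: "fst p = x0" "snd p' = y0" "fst q = x0" "snd q' = y0" by simp_all
  have "int (snd p) + int (fst p') = int (snd q) + int (fst q')"
    using Y unfolding sp(2) sq(2) by simp
  then have moved: "snd p + fst p' = snd q + fst q'" by linarith
  define x1 y1 where "x1 = fst p'" and "y1 = snd p"
  have p: "p = (x0, y1)" "p' = (x1, y0)"
    using fixed by (simp_all add: x1_def y1_def prod_eq_iff)
  \<comment> \<open>If the first step reduces the larger coordinate, \<open>fst p = x0\<close> puts
    the first walker at its start; otherwise \<open>snd p' = y0\<close> does so for the second. The
    same holds for \<open>q\<close> and \<open>q'\<close>, and \<open>moved\<close> equates the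
    rest.\<close>
  have pq: "q = p \<and> q' = p' \<and> (y1 = y0 \<or> x1 = x0)"
  proof (cases "Suc y0 < x0 \<or> y0 = 0")
    case True
    then have "snd p = y0" "snd q = y0" using t fixed by (auto simp: track_def)
    then show ?thesis using moved fixed p by (auto simp: prod_eq_iff)
  next
    case False
    then have "fst p' = x0" "fst q' = x0" using t fixed by (auto simp: track_def)
    then show ?thesis using moved fixed p by (auto simp: prod_eq_iff)
  qed
  have eq': "dih n False True False ` ?S = ?S" using eq pq by simp
  have mir: "(n - 1 - a, b) \<in> ?S" if "(a, b) \<in> ?S" for a b
  proof -
    have "dih n False True False (a, b) \<in> ?S" using eq' that by blast
    then show ?thesis by (simp add: dih_def flip_def)
  qed
  have Rs: "(b, a) \<in> R" if "(a, b) \<in> R" for a b using R_sym[OF that] by simp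
  have nR: "(x0, y0) \<notin> R" "(y0, x0) \<notin> R" by (auto simp: R_def)
  have nR': "(x1, y0) \<notin> R" "(y1, x0) \<notin> R" using track_R[OF t(2)] track_R[OF t(1)] p by auto
  have le: "x1 \<le> x0" "y1 \<le> y0" using bound p by simp_all
  consider "y1 = y0" "x1 = x0" | "y1 = y0" "x1 < x0" | "x1 = x0" "y1 < y0"
    using pq le by linarith
  then show False
  proof cases
    case 1
    then have "?S = pos0 ` {..<k}" using start_pair_set p by blast
    then show False using asym[of True False] eq' by simp
  next
    case 2
    have "y0 < x1" using track_less[OF t(2)] p by simp
    then show False
      using no_mirror_horizontal[OF n _ 2(2) x0_less Rs mir[unfolded p swap_simps 2(1)] nR(2) nR'(1)] by blast
  next
    case 3
    show False
      using no_mirror_vertical[OF n 3(2) off x0_less Rs mir[unfolded p swap_simps 3(1)] nR(1) nR'(2)] by blast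
  qed
qed

text \<open>A half turn negates both sums, which forces all walkers back to the start, where
  \<open>asym\<close> applies. A flip of the second coordinate turns into one of the first by
  conjugation with the transposition, which exchanges the walkers.\<close>

lemma no_other_frame:
  assumes t: "track p" "track p'" "track q" "track q'" and ab: "a \<or> b"
    and eq: "dih n False a b ` insert q (insert (swap q') R) = insert p (insert (swap p') R)"
  shows False
proof -
  let ?S = "insert p (insert (swap p') R)" and ?Q = "insert q (insert (swap q') R)"
  consider "a" "b" | "a" "\<not> b" | "\<not> a" "b" using ab by blast
  then show False
  proof cases
    case 1
    note sp = sums_place[OF t(1,2)] and sq = sums_place[OF t(3,4)]
    have XY: "xsum ?S = - xsum ?Q" "ysum ?S = - ysum ?Q"
      using sums_dih[OF place_set_grid[OF t(3,4)], of True True] eq 1 by simp_all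
    note b = t[THEN track_bounds(1)] t[THEN track_bounds(2)]
    have "int (fst p) = int x0 \<and> int (snd p') = int y0 \<and> int (fst q) = int x0 \<and> int (snd q') = int y0"
      using slack_zero[OF sp(3) b(1,6,3,8)] XY(1) unfolding sp(1) sq(1) by blast
    moreover have "int (fst p') = int x0 \<and> int (snd p) = int y0 \<and> int (fst q') = int x0 \<and> int (snd q) = int y0"
      using slack_zero[OF sp(3) b(2,5,4,7)] XY(2) unfolding sp(2) sq(2) by (simp add: algebra_simps)
    ultimately have "fst p = x0" "snd p = y0" "fst p' = x0" "snd p' = y0"
      "fst q = x0" "snd q = y0" "fst q' = x0" "snd q' = y0" by simp_all
    then have "p = (x0, y0)" "p' = (x0, y0)" "q = (x0, y0)" "q' = (x0, y0)" by (auto simp: prod_eq_iff)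
    then have "?S = pos0 ` {..<k}" "?Q = pos0 ` {..<k}" using start_pair_set by blast+
    then show False using asym[of True True] eq 1 by simp
  next
    case 2
    then show False using no_mirror[OF t] eq by simp
  next
    case 3
    have "dih n False True False ` swap ` ?Q = swap ` dih n False False True ` ?Q"
      by (simp only: image_image dih_swap)
    also have "\<dots> = swap ` ?S" using eq 3 by simp
    finally show False
      unfolding swap_place_set using no_mirror[OF t(2,1,4,3)] by blast
  qed
qed

text \<open>Decoding a snapshot is unambiguous up to reflection in the diagonal, and this merely
  exchanges the walkers.\<close>

lemma walk_frame:
  assumes t: "track p" "track p'" "track q" "track q'" and \<phi>: "grid_aut n \<phi>"
    and eq: "view n (cfg k (place p p')) \<phi> = cfg k (place q q')"
  shows "(\<forall>v\<in>grid n. \<phi> v = v) \<and> q = p \<and> q' = p' \<or> (\<forall>v\<in>grid n. \<phi> v = swap v) \<and> q = p' \<and> q' = p"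
proof -
  obtain s a b where d: "\<And>v. v \<in> grid n \<Longrightarrow> \<phi> v = dih n s a b v"
    using grid_aut_cases[OF \<phi> n2] by metis
  let ?Q = "insert q (insert (swap q') R)"
  have im: "\<phi> ` ?Q = insert p (insert (swap p') R)"
    using view_eq_cfg_image[OF \<phi> place_grid[OF t(1,2)] place_grid[OF t(3,4)] eq] unfolding place_image .
  then have im: "dih n s a b ` ?Q = insert p (insert (swap p') R)"
    using d place_set_grid[OF t(3,4)] by (metis (no_types, lifting) image_cong subsetD)
  show ?thesis
  proof (cases s)
    case False
    have ab: "\<not> (a \<or> b)"
    proof
      assume "a \<or> b"
      from no_other_frame[OF t this] im False show False by simp
    qed
    have idv: "\<forall>v\<in>grid n. \<phi> v = v" using d ab False dih_id by auto
    have "dih n False False False ` ?Q = ?Q"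
      using place_set_grid[OF t(3,4)] by (rule dih_id_image)
    then have "?Q = insert p (insert (swap p') R)" using im ab False by simp
    then show ?thesis using track_eq[OF t(3,4,1,2)] idv by blast
  next
    case True
    have im2: "dih n False a b ` insert q' (insert (swap q) R) = insert p (insert (swap p') R)"
    proof -
      have "dih n True a b ` ?Q = dih n False a b ` swap ` ?Q" 
        unfolding image_image by (intro image_cong refl) (rule dih_True)
      then show ?thesis using im True unfolding swap_place_set by simp
    qed
    have ab: "\<not> (a \<or> b)"
    proof
      assume "a \<or> b"
      from no_other_frame[OF t(1,2,4,3) this im2] show False .
    qed
    have sv: "\<forall>v\<in>grid n. \<phi> v = swap v" using d ab True by (auto simp: dih_True dih_id)
    have "dih n False False False ` insert q' (insert (swap q) R) = insert q' (insert (swap q) R)"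
      using place_set_grid[OF t(4,3)] by (rule dih_id_image)
    then have "insert q' (insert (swap q) R) = insert p (insert (swap p') R)" using im2 ab by simp
    then show ?thesis using track_eq[OF t(4,3,1,2)] sv by blast
  qed
qed

text \<open>Keeping the other corners empty, pending moves included, makes the occupied corner
  recognisable in every frame.\<close>

definition legal :: "node \<Rightarrow> bool" where
  "legal v \<longleftrightarrow> v \<in> grid n \<and> (is_corner n v \<longrightarrow> v = (0, 0))"

definition walking :: "(nat \<Rightarrow> node) \<Rightarrow> (nat \<Rightarrow> node option) \<Rightarrow> node \<Rightarrow> node \<Rightarrow> bool" where
  "walking pos pend p p' \<longleftrightarrow> track p \<and> track p' \<and> (\<forall>r<k. pos r = place p p' r) \<and>
     (\<forall>r<k. \<forall>w. pend r = Some w \<longrightarrow>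
        w = pos r \<or> r = m1 \<and> w = advance p \<or> r = m2 \<and> w = swap (advance p'))"

definition arrived :: "(nat \<Rightarrow> node) \<Rightarrow> (nat \<Rightarrow> node option) \<Rightarrow> bool" where
  "arrived pos pend \<longleftrightarrow> (\<exists>r<k. pos r = (0, 0)) \<and> (\<forall>r<k. legal (pos r)) \<and>
     (\<forall>r<k. \<forall>w. pend r = Some w \<longrightarrow>
        w = pos r \<or> legal w \<and> fst w + snd w < fst (pos r) + snd (pos r))"

definition inv :: "(nat \<Rightarrow> node) \<Rightarrow> (nat \<Rightarrow> node option) \<Rightarrow> bool" where
  "inv pos pend \<longleftrightarrow> (\<exists>p p'. walking pos pend p p') \<or> arrived pos pend"

section \<open>From the walk to gathering at the occupied corner\<close>

lemma origin_corner: "is_corner n (0, 0)" by (simp add: is_corner_def)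

lemma origin_grid: "(0, 0) \<in> grid n" using n4 by simp

lemma grid_aut_is_corner: "grid_aut n \<phi> \<Longrightarrow> v \<in> grid n \<Longrightarrow> is_corner n (\<phi> v) \<longleftrightarrow> is_corner n v"
  using grid_aut_cases[of n \<phi>] n2 is_corner_dih by metis

lemma grid_aut_origin:
  assumes "grid_aut n \<phi>" "\<phi> (0, 0) = (0, 0)"
  shows "(\<forall>v\<in>grid n. \<phi> v = v) \<or> (\<forall>v\<in>grid n. \<phi> v = swap v)"
proof -
  obtain s a b where d: "\<And>v. v \<in> grid n \<Longrightarrow> \<phi> v = dih n s a b v"
    using grid_aut_cases[OF assms(1) n2] by metis
  have "dih n s a b (0, 0) = (0, 0)" using d[OF origin_grid] assms(2) by simp
  then have "\<not> a \<and> \<not> b" using n4 by (auto simp: dih_def flip_def split: if_splits)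
  then show ?thesis using d by (cases s) (auto simp: dih_True dih_id)
qed

lemma toward_legal: "v \<in> grid n \<Longrightarrow> toward v w \<Longrightarrow> legal w"
  using toward_grid[of v n w] n4 by (cases v) (auto simp: legal_def toward_def is_corner_def)

lemma advance_legal: "track p \<Longrightarrow> legal (advance p)" "track p \<Longrightarrow> legal (swap (advance p))"
  using advance_grid[of p] advance_track[of p] track_corner[of "advance p"]
  unfolding legal_def by (auto simp del: mem_grid)

lemma place_legal: "track p \<Longrightarrow> track p' \<Longrightarrow> r < k \<Longrightarrow> legal (place p p' r)"
  using place_grid[of p p'] place_corner[of p p' "place p p' r"] unfolding legal_def by blast

text \<open>No corner is occupied, so the frame must recognise a walking configuration, and it reads
  off the actual pair, possibly with the walkers exchanged.\<close>

lemma walk_closure: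
  assumes t: "track p" "track p'" and c: "frame_closure n walk_rule (cfg k (place p p')) v w"
  shows "v = p \<and> w = advance p \<or> v = swap p' \<and> w = swap (advance p')"
proof -
  let ?f = "cfg k (place p p')"
  obtain \<phi> u x where \<phi>: "grid_aut n \<phi>" "u \<in> grid n" "x \<in> grid n" "\<phi> u = v" "\<phi> x = w"
    "walk_rule (view n ?f \<phi>) u x" using c unfolding frame_closure_def by blast
  have "view n ?f \<phi> (0, 0) = 0"
  proof -
    have "is_corner n (\<phi> (0, 0))" using grid_aut_is_corner[OF \<phi>(1) origin_grid] origin_corner by blast
    then have "\<phi> (0, 0) \<notin> place p p' ` {..<k}" using place_corner[OF t] by blast
    then show ?thesis using cfg_eq_0_iff view_apply[OF origin_grid] by metis
  qed
  then obtain q q' where q: "track q" "track q'" "view n ?f \<phi> = cfg k (place q q')"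
    "u = q \<and> x = advance q \<or> u = swap q' \<and> x = swap (advance q')"
    using \<phi>(6) unfolding walk_rule_def by blast
  from walk_frame[OF t q(1,2) \<phi>(1) q(3)] show ?thesis
  proof (elim disjE conjE)
    assume "\<forall>v\<in>grid n. \<phi> v = v" "q = p" "q' = p'"
    then show ?thesis using q(4) \<phi>(2-5) by auto
  next
    assume *: "\<forall>v\<in>grid n. \<phi> v = swap v" "q = p'" "q' = p"
    then have "v = swap u" "w = swap x" using \<phi>(2-5) by auto
    then show ?thesis using q(4) *(2,3) by auto
  qed
qed

text \<open>The occupied corner rules out the walking alternative in every frame. The frame's own
  origin is then an occupied corner, hence the actual one, and the two remaining automorphisms
  preserve \<open>toward\<close>.\<close>

lemma arrived_closure:
  assumes a: "arrived pos pend" and c: "frame_closure n walk_rule (cfg k pos) v w"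
  shows "toward v w"
proof -
  obtain \<phi> u x where \<phi>: "grid_aut n \<phi>" "u \<in> grid n" "x \<in> grid n" "\<phi> u = v" "\<phi> x = w"
    "walk_rule (view n (cfg k pos) \<phi>) u x" using c unfolding frame_closure_def by blast
  obtain c where c: "c \<in> grid n" "\<phi> c = (0, 0)" using grid_aut_surj[OF \<phi>(1) origin_grid] by blast
  have cc: "is_corner n c" using grid_aut_is_corner[OF \<phi>(1) c(1)] c(2) origin_corner by simp
  have occ: "view n (cfg k pos) \<phi> c \<noteq> 0"
  proof -
    have "(0, 0) \<in> pos ` {..<k}" using a unfolding arrived_def by (metis imageI lessThan_iff)
    then show ?thesis using cfg_eq_0_iff c view_apply by metis
  qed
  have "\<not> (\<exists>q q'. track q \<and> track q' \<and> view n (cfg k pos) \<phi> = cfg k (place q q'))"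
  proof
    assume "\<exists>q q'. track q \<and> track q' \<and> view n (cfg k pos) \<phi> = cfg k (place q q')"
    then obtain q q' where q: "track q" "track q'" "view n (cfg k pos) \<phi> = cfg k (place q q')" by blast
    then have "c \<in> place q q' ` {..<k}" using occ cfg_eq_0_iff by metis
    then show False using place_corner[OF q(1,2)] cc by blast
  qed
  then have w: "view n (cfg k pos) \<phi> (0, 0) \<noteq> 0" "toward u x"
    using \<phi>(6) unfolding walk_rule_def by blast+
  have "\<phi> (0, 0) \<in> pos ` {..<k}" using w(1) cfg_eq_0_iff view_apply[OF origin_grid] by metis
  then obtain s where s: "s < k" "\<phi> (0, 0) = pos s" by blast
  have "legal (\<phi> (0, 0))" using a s(1) unfolding s(2) arrived_def by blast
  moreover have "is_corner n (\<phi> (0, 0))" using grid_aut_is_corner[OF \<phi>(1) origin_grid] origin_corner by blast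
  ultimately have "\<phi> (0, 0) = (0, 0)" unfolding legal_def by blast
  from grid_aut_origin[OF \<phi>(1) this] show ?thesis
  proof
    assume "\<forall>v\<in>grid n. \<phi> v = v"
    then show ?thesis using w(2) \<phi>(2-5) by simp
  next
    assume "\<forall>v\<in>grid n. \<phi> v = swap v"
    then have "v = swap u" "w = swap x" using \<phi>(2-5) by simp_all
    then show ?thesis using toward_swap[OF w(2)] by (simp add: swap_def)
  qed
qed

lemma walking_m1: "walking pos pend p p' \<Longrightarrow> pos m1 = p"
  using m m12 by (simp add: walking_def place_def)

lemma walking_m2: "walking pos pend p p' \<Longrightarrow> pos m2 = swap p'"
  using m m12 by (simp add: walking_def place_def)

lemma walking_cfg: "walking pos pend p p' \<Longrightarrow> cfg k pos = cfg k (place p p')"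
  by (rule cfg_cong) (simp add: walking_def)

lemma walking_eq:
  assumes "walking pos pend p p'" "r < k" "s < k" "pos r = pos s"
  shows "r = s"
  using assms place_inj[of p p'] unfolding walking_def by (auto dest: inj_onD)

lemma walking_look:
  assumes W: "walking pos pend p p'" and r: "r < k"
    and q: "q = pos r \<or> frame_closure n walk_rule (cfg k pos) (pos r) q"
  shows "walking pos (pend(r := Some q)) p p'"
proof -
  have t: "track p" "track p'" using W by (simp_all add: walking_def)
  have "q = pos r \<or> r = m1 \<and> q = advance p \<or> r = m2 \<and> q = swap (advance p')"
    using q
  proof
    assume "frame_closure n walk_rule (cfg k pos) (pos r) q"
    from walk_closure[OF t this[unfolded walking_cfg[OF W]]]
    show ?thesis
      using walking_eq[OF W r m(1)] walking_eq[OF W r m(2)] walking_m1[OF W] walking_m2[OF W] by metis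
  qed simp
  then have "\<forall>s<k. \<forall>w. (pend(r := Some q)) s = Some w \<longrightarrow>
      w = pos s \<or> s = m1 \<and> w = advance p \<or> s = m2 \<and> w = swap (advance p')"
    using W unfolding walking_def by (metis fun_upd_apply option.inject)
  then show ?thesis using W unfolding walking_def by blast
qed

lemma arrived_look:
  assumes A: "arrived pos pend" and r: "r < k"
    and q: "q = pos r \<or> frame_closure n walk_rule (cfg k pos) (pos r) q"
  shows "arrived pos (pend(r := Some q))"
proof -
  have g: "pos r \<in> grid n" using A r unfolding arrived_def legal_def by blast
  have "q = pos r \<or> toward (pos r) q" using q arrived_closure[OF A] by blast
  then have "q = pos r \<or> legal q \<and> fst q + snd q < fst (pos r) + snd (pos r)"
    using toward_legal[OF g] toward_origin by (metis lessI)
  then show ?thesis using A unfolding arrived_def by (simp del: split_paired_All)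
qed

lemma arrived_move:
  assumes A: "arrived pos pend" and r: "r < k" and q: "pend r = Some q"
  shows "arrived (pos(r := q)) (pend(r := None))"
proof -
  have q': "q = pos r \<or> legal q \<and> fst q + snd q < fst (pos r) + snd (pos r)"
    using A r q unfolding arrived_def by blast
  obtain r0 where r0: "r0 < k" "pos r0 = (0, 0)" using A unfolding arrived_def by blast
  have "(pos(r := q)) r0 = (0, 0)" using r0(2) q' by (cases "r0 = r") auto
  moreover have "\<forall>s<k. legal ((pos(r := q)) s)" using A q' r unfolding arrived_def by auto
  ultimately show ?thesis using A r0(1) unfolding arrived_def by (auto simp del: split_paired_All)
qed

text \<open>The other walker may hold a move computed before the arrival; it stays acceptable
  because \<open>advance\<close> lowers the distance and avoids the other corners.\<close>

lemma walking_arrives: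
  assumes W: "walking pos pend p p'" and r: "r < k" and q: "pend r = Some q" "q = (0, 0)" "q \<noteq> pos r"
  shows "arrived (pos(r := q)) (pend(r := None))"
proof -
  have t: "track p" "track p'" using W by (simp_all add: walking_def)
  have "\<forall>s<k. legal (pos s)" using W place_legal[OF t] by (simp add: walking_def)
  then have l: "\<forall>s<k. legal ((pos(r := q)) s)" using q(2) origin_grid by (simp add: legal_def)
  have "w = pos s \<or> legal w \<and> fst w + snd w < fst (pos s) + snd (pos s)" if s: "s < k" "pend s = Some w" for s w
  proof -
    consider "w = pos s" | "s = m1" "w = advance p" | "s = m2" "w = swap (advance p')"
      using W s unfolding walking_def by blast
    then show ?thesis
    proof cases
      case 2
      then show ?thesis using advance_legal(1)[OF t(1)] advance_less[OF t(1)] walking_m1[OF W] by simp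
    next
      case 3
      then show ?thesis using advance_legal(2)[OF t(2)] advance_less[OF t(2)] walking_m2[OF W] by simp
    qed simp
  qed
  then have "\<forall>s<k. \<forall>w. (pend(r := None)) s = Some w \<longrightarrow>
      w = (pos(r := q)) s \<or> legal w \<and> fst w + snd w < fst ((pos(r := q)) s) + snd ((pos(r := q)) s)"
    by (simp del: split_paired_All)
  moreover have "(pos(r := q)) r = (0, 0)" using q(2) by simp
  ultimately show ?thesis unfolding arrived_def using l r by blast
qed

lemma walking_move:
  assumes W: "walking pos pend p p'" and r: "r < k" and q: "pend r = Some q"
  shows "inv (pos(r := q)) (pend(r := None))"
proof -
  have t: "track p" "track p'" using W by (simp_all add: walking_def)
  have pl: "\<forall>s<k. pos s = place p p' s" using W by (simp add: walking_def)
  have pe: "\<forall>s<k. \<forall>w. pend s = Some w \<longrightarrow>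
      w = pos s \<or> s = m1 \<and> w = advance p \<or> s = m2 \<and> w = swap (advance p')"
    using W unfolding walking_def by blast
  consider "q = pos r" | "q \<noteq> pos r" "q = (0, 0)" | "q \<noteq> (0, 0)" "r = m1" "q = advance p"
    | "q \<noteq> (0, 0)" "r = m2" "q = swap (advance p')"
    using pe r q by blast
  then show ?thesis
  proof cases
    case 1
    then have "pos(r := q) = pos" by simp
    moreover have "walking pos (pend(r := None)) p p'"
      using t pl pe unfolding walking_def by (simp del: split_paired_All)
    ultimately show ?thesis unfolding inv_def by metis
  next
    case 2
    then show ?thesis using walking_arrives[OF W r q] unfolding inv_def by blast
  next
    case 3
    then have t': "track (advance p)" using advance_track[OF t(1)] by simp
    have "\<forall>s<k. (pos(r := q)) s = place (advance p) p' s"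
      using pl 3 m12 by (simp add: place_def)
    moreover have "\<forall>s<k. \<forall>w. (pend(r := None)) s = Some w \<longrightarrow> w = (pos(r := q)) s \<or>
        s = m1 \<and> w = advance (advance p) \<or> s = m2 \<and> w = swap (advance p')"
      using pe 3(2) by (metis fun_upd_apply option.distinct(1))
    ultimately have "walking (pos(r := q)) (pend(r := None)) (advance p) p'"
      using t(2) t' unfolding walking_def by blast
    then show ?thesis unfolding inv_def by blast
  next
    case 4
    then have t': "track (advance p')" using advance_track[OF t(2)] by auto
    have "\<forall>s<k. (pos(r := q)) s = place p (advance p') s"
      using pl 4 m12 by (simp add: place_def)
    moreover have "\<forall>s<k. \<forall>w. (pend(r := None)) s = Some w \<longrightarrow> w = (pos(r := q)) s \<or>
        s = m1 \<and> w = advance p \<or> s = m2 \<and> w = swap (advance (advance p'))"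
      using pe 4(2) by (metis fun_upd_apply option.distinct(1))
    ultimately have "walking (pos(r := q)) (pend(r := None)) p (advance p')"
      using t(1) t' unfolding walking_def by blast
    then show ?thesis unfolding inv_def by blast
  qed
qed

theorem gatherable: "gatherable_one_crash n k pos0"
proof (rule gatherable_by_invariant[of n walk_rule k inv])
  show "adjacent_rule n walk_rule"
    unfolding adjacent_rule_def walk_rule_def using toward_adj advance_adj grid_adj_swap by metis
next
  fix pend :: "nat \<Rightarrow> node option" assume p: "\<forall>r<k. pend r = None"
  then have "walking pos0 pend (x0, y0) (x0, y0)"
    unfolding walking_def place_start using track_start by simp
  then show "inv pos0 pend" unfolding inv_def by blast
next
  fix pos pend r q assume I: "inv pos pend" "r < k" "pend r = None"
    "q = pos r \<or> frame_closure n walk_rule (cfg k pos) (pos r) q"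
  then show "inv pos (pend(r := Some q))"
    unfolding inv_def using walking_look[OF _ I(2,4)] arrived_look[OF _ I(2,4)] by blast
next
  fix pos pend r q assume I: "inv pos pend" "r < k" "pend r = Some q"
  then show "inv (pos(r := q)) (pend(r := None))"
    using walking_move[where pos = pos and pend = pend, OF _ I(2,3)]
      arrived_move[where pos = pos and pend = pend, OF _ I(2,3)] unfolding inv_def by blast
  show "q = pos r \<or> fst q + snd q < fst (pos r) + snd (pos r)"
    using I(1) unfolding inv_def
  proof (elim disjE exE)
    fix p p' assume W: "walking pos pend p p'"
    have t: "track p" "track p'" using W by (simp_all add: walking_def)
    have "q = pos r \<or> r = m1 \<and> q = advance p \<or> r = m2 \<and> q = swap (advance p')"
      using W I(2,3) unfolding walking_def by blast
    then show ?thesis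
      using advance_less[OF t(1)] advance_less[OF t(2)] walking_m1[OF W] walking_m2[OF W] by auto
  next
    assume "arrived pos pend"
    then show ?thesis using I(2,3) unfolding arrived_def by blast
  qed
next
  fix pos pend c r assume I: "inv pos pend" and r: "r < k" "r \<noteq> c" "pos r \<noteq> (0, 0)"
  show "\<exists>r<k. r \<noteq> c \<and> (\<exists>q. frame_closure n walk_rule (cfg k pos) (pos r) q)"
    using I unfolding inv_def
  proof (elim disjE exE)
    fix p p' assume W: "walking pos pend p p'"
    have t: "track p" "track p'" using W by (simp_all add: walking_def)
    have rule: "walk_rule (cfg k (place p p')) p (advance p)"
      "walk_rule (cfg k (place p p')) (swap p') (swap (advance p'))"
      unfolding walk_rule_def using t by blast+
    have "frame_closure n walk_rule (cfg k (place p p')) p (advance p)"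
      by (rule frame_closure_id[OF place_grid[OF t] track_grid[OF t(1)] advance_grid[OF t(1)]]) (rule rule)
    moreover have "frame_closure n walk_rule (cfg k (place p p')) (swap p') (swap (advance p'))"
      by (rule frame_closure_id[OF place_grid[OF t]]) (use rule track_grid[OF t(2)] advance_grid[OF t(2)] in simp_all)
    ultimately show ?thesis
      unfolding walking_cfg[OF W] using m(1,2) m12 walking_m1[OF W] walking_m2[OF W] by metis
  next
    assume A: "arrived pos pend"
    have g: "pos ` {..<k} \<subseteq> grid n" "pos r \<in> grid n" using A r(1) unfolding arrived_def legal_def by blast+
    obtain w where w: "toward (pos r) w" using toward_exists r(3) by blast
    have "(0, 0) \<in> pos ` {..<k}" using A unfolding arrived_def by (metis imageI lessThan_iff)
    moreover have "v \<notin> pos ` {..<k}" if "is_corner n v" "v \<noteq> (0, 0)" for v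
      using A that unfolding arrived_def legal_def by blast
    ultimately have "walk_rule (cfg k pos) (pos r) w"
      unfolding walk_rule_def cfg_eq_0_iff using w by blast
    then have "frame_closure n walk_rule (cfg k pos) (pos r) w"
      by (rule frame_closure_id[OF g toward_grid[OF g(2) w]])
    then show ?thesis using r by blast
  qed
qed

end

section \<open>The minimum enclosing square and the case distinction\<close>

lemma cdist_0_corner: "v \<in> grid n \<Longrightarrow> cdist n c v = 0 \<Longrightarrow> is_corner n v"
  by (cases v; cases c) (auto simp: cdist_def flip_def is_corner_def split: if_splits)

text \<open>Adding the distances to two adjacent corners eliminates one coordinate:
  \<open>2 * x + (n - 1) \<ge> 2 * (n - 2)\<close> gives \<open>x \<ge> m - 1\<close> by parity, and
  the other bounds follow alike.\<close>

lemma central_if_far: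
  assumes n: "n = 2 * m" and v: "(x, y) \<in> grid n" and far: "\<And>c. n - 2 \<le> cdist n c (x, y)"
  shows "m - 1 \<le> x" "x \<le> m" "m - 1 \<le> y" "y \<le> m"
proof -
  obtain X Y where XY: "Suc (x + X) = n" "Suc (y + Y) = n"
    using v by (metis add_Suc less_iff_Suc_add mem_grid)
  then have fl: "n - 1 - x = X" "n - 1 - y = Y" by linarith+
  have "n - 2 \<le> x + y" "n - 2 \<le> X + y" "n - 2 \<le> x + Y" "n - 2 \<le> X + Y"
    using far[of "(False, False)"] far[of "(True, False)"] far[of "(False, True)"] far[of "(True, True)"] fl
    by (simp_all add: cdist_def flip_def)
  then show "m - 1 \<le> x" "x \<le> m" "m - 1 \<le> y" "y \<le> m" using XY n by linarith+
qed

definition encloses :: "nat \<Rightarrow> (node \<Rightarrow> nat) \<Rightarrow> nat \<Rightarrow> bool" where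
  "encloses n f s \<longleftrightarrow> s < n div 2 \<and> (\<forall>i j. (i, j) \<in> grid n \<and> f (i, j) \<noteq> 0 \<longrightarrow>
     s \<le> i \<and> i + s < n \<and> s \<le> j \<and> j + s < n)"

lemma mes_offset_Greatest: "mes_offset n f = (GREATEST s. encloses n f s)"
  unfolding mes_offset_def encloses_def ..

context
  fixes n m k :: nat and pos0 :: "nat \<Rightarrow> node"
  assumes n: "n = 2 * m" "0 < m" and k: "0 < k" and grid0: "pos0 ` {..<k} \<subseteq> grid n"
    and empty: "\<forall>c\<in>mes_corners n (cfg k pos0). cfg k pos0 c = 0"
begin

lemma mes_offset_encloses: "encloses n (cfg k pos0) (mes_offset n (cfg k pos0))"
proof -
  have "encloses n (cfg k pos0) 0" using n(2) unfolding encloses_def n(1) by auto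
  then show ?thesis
    unfolding mes_offset_Greatest
    by (rule GreatestI_nat[where b = "n div 2"]) (simp add: encloses_def)
qed

lemma mes_offset_greatest: "encloses n (cfg k pos0) s \<Longrightarrow> s \<le> mes_offset n (cfg k pos0)"
  unfolding mes_offset_Greatest
  by (rule Greatest_le_nat[where b = "n div 2"]) (auto simp: encloses_def)

lemma mes_corner_empty:
  assumes "r < k" "mes_offset n (cfg k pos0) = s" "e = n - 1 - s"
  shows "pos0 r \<notin> {(s, s), (s, e), (e, s), (e, e)}"
proof -
  have "cfg k pos0 (pos0 r) \<noteq> 0" using assms(1) unfolding cfg_eq_0_iff by blast
  then have "pos0 r \<notin> mes_corners n (cfg k pos0)" using empty by metis
  then show ?thesis using assms(2,3) by (simp add: mes_corners_def Let_def)
qed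

lemma encloses_robot:
  assumes "encloses n (cfg k pos0) s" "r < k" "pos0 r = (x, y)"
  shows "s \<le> x" "x + s < n" "s \<le> y" "y + s < n"
proof -
  have "(x, y) \<in> pos0 ` {..<k}" using assms(2,3) by (metis imageI lessThan_iff)
  then have "(x, y) \<in> grid n" "cfg k pos0 (x, y) \<noteq> 0" using grid0 unfolding cfg_eq_0_iff by blast+
  then show "s \<le> x" "x + s < n" "s \<le> y" "y + s < n" using assms(1) unfolding encloses_def by blast+
qed

text \<open>A robot there would make the whole grid the minimum enclosing square, with an occupied
  corner. This yields \<open>0 < d\<close>.\<close>

lemma no_robot_on_grid_corner:
  assumes r: "r < k"
  shows "\<not> is_corner n (pos0 r)"
proof
  assume c: "is_corner n (pos0 r)"
  obtain x y where xy: "pos0 r = (x, y)" by fastforce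
  define s where "s = mes_offset n (cfg k pos0)"
  have "s \<le> x" "x + s < n" using encloses_robot(1,2)[OF mes_offset_encloses r xy] by (simp_all add: s_def)
  moreover have "x = 0 \<or> x = n - 1" using c xy by (simp add: is_corner_def)
  ultimately have "s = 0" using n by auto
  then show False using mes_corner_empty[OF r, of 0 "n - 1"] c xy by (auto simp: s_def is_corner_def)
qed

text \<open>Otherwise all robots are in the central block of four nodes. This block is then the
  minimum enclosing square, all its nodes are corners, and one is occupied. This yields
  \<open>d < n - 2\<close>.\<close>

lemma some_robot_off_centre: "\<exists>r<k. \<exists>c. cdist n c (pos0 r) < n - 2"
proof (rule ccontr)
  assume "\<not> ?thesis"
  then have far: "n - 2 \<le> cdist n c (pos0 r)" if "r < k" for r c using that by (meson leI)
  have centre: "m - 1 \<le> x" "x \<le> m" "m - 1 \<le> y" "y \<le> m" if "r < k" "pos0 r = (x, y)" for r x y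
  proof -
    have g: "(x, y) \<in> grid n" using that grid0 by force
    have f: "n - 2 \<le> cdist n c (x, y)" for c using far[OF that(1), of c] that(2) by simp
    show "m - 1 \<le> x" "x \<le> m" "m - 1 \<le> y" "y \<le> m" using central_if_far[OF n(1) g f] by blast+
  qed
  have "encloses n (cfg k pos0) (m - 1)"
    unfolding encloses_def
  proof (intro conjI allI impI)
    show "m - 1 < n div 2" using n by simp
    fix i j assume "(i, j) \<in> grid n \<and> cfg k pos0 (i, j) \<noteq> 0"
    then obtain r where "r < k" "pos0 r = (i, j)" unfolding cfg_eq_0_iff by auto
    from centre[OF this] show "m - 1 \<le> i" "i + (m - 1) < n" "m - 1 \<le> j" "j + (m - 1) < n"
      using n by linarith+
  qed
  then have "m - 1 \<le> mes_offset n (cfg k pos0)" by (rule mes_offset_greatest)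
  moreover have "mes_offset n (cfg k pos0) < m" 
    using mes_offset_encloses n(1) unfolding encloses_def by linarith
  ultimately have s: "mes_offset n (cfg k pos0) = m - 1" by simp
  obtain x y where xy: "pos0 0 = (x, y)" by fastforce
  have "m = n - 1 - (m - 1)" using n by simp
  from mes_corner_empty[OF k s this] have "pos0 0 \<notin> {(m - 1, m - 1), (m - 1, m), (m, m - 1), (m, m)}" .
  moreover have "x = m - 1 \<or> x = m" "y = m - 1 \<or> y = m" using centre[OF k xy] by linarith+
  ultimately show False using xy by auto
qed

end

section \<open>Moving the target corner to the origin by flips\<close>

lemma corner_map_flips:
  "corner_map n (dih n False a b) (\<lambda>c. (fst c \<noteq> a, snd c \<noteq> b))"
proof -
  have "inj (\<lambda>c :: bool \<times> bool. (fst c \<noteq> a, snd c \<noteq> b))" unfolding inj_def by auto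
  then have "bij (\<lambda>c :: bool \<times> bool. (fst c \<noteq> a, snd c \<noteq> b))" by (simp add: bij_def finite_UNIV_inj_surj)
  moreover have "cdist n (fst c \<noteq> a, snd c \<noteq> b) (dih n False a b v) = cdist n c v" if "v \<in> grid n" for c v
    using that by (cases v; cases c; cases a; cases b) (auto simp: cdist_def dih_def flip_xor)
  ultimately show ?thesis by (simp add: corner_map_def)
qed

lemma dih_flips_flips: "v \<in> grid n \<Longrightarrow> dih n False a b (dih n False a b v) = v"
  using dih_inverse[where s = False and a = a and b = b] by simp

lemma dih_flips_commute:
  "v \<in> grid n \<Longrightarrow> dih n False a b (dih n False c d v) = dih n False c d (dih n False a b v)"
  by (auto simp: dih_def flip_def)

lemma dih_flips_swap:
  "v \<in> grid n \<Longrightarrow> (a \<noteq> b) = c \<Longrightarrow> swap (dih n False a b v) = dih n False a b (dih n True c c v)"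
  by (cases v; cases a; cases b) (auto simp: dih_def swap_def flip_def)

lemma inj_comp_flips:
  assumes "inj_on pos0 {..<k}" "pos0 ` {..<k} \<subseteq> grid n"
  shows "inj_on (\<lambda>r. dih n False a b (pos0 r)) {..<k}"
  using comp_inj_on[OF assms(1) inj_on_subset[OF grid_aut_inj_on[OF grid_aut_dih] assms(2)]]
  by (simp add: comp_def)

lemma grid_comp_flips:
  "pos0 ` {..<k} \<subseteq> grid n \<Longrightarrow> (\<lambda>r. dih n False a b (pos0 r)) ` {..<k} \<subseteq> grid n"
  using dih_in by blast

lemma view_comp_flips:
  assumes "pos0 ` {..<k} \<subseteq> grid n"
  shows "view n (cfg k (\<lambda>r. dih n False a b (pos0 r))) (dih n False a b) = cfg k pos0"
proof
  fix v
  show "view n (cfg k (\<lambda>r. dih n False a b (pos0 r))) (dih n False a b) v = cfg k pos0 v"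
  proof (cases "v \<in> grid n")
    case True
    then show ?thesis
      using cfg_comp[OF grid_aut_inj_on[OF grid_aut_dih] assms True] by (simp add: view_def del: mem_grid)
  next
    case False
    then have "cfg k pos0 v = 0" using assms cfg_eq_0_iff by blast
    then show ?thesis using False by (simp add: view_def)
  qed
qed

lemma gatherable_rigid:
  assumes n: "even n" and inj0: "inj_on pos0 {..<k}" and grid0: "pos0 ` {..<k} \<subseteq> grid n" and k: "0 < k"
    and corner0: "\<forall>r<k. \<not> is_corner n (pos0 r)" and off: "\<exists>r<k. \<exists>c. cdist n c (pos0 r) < n - 2"
    and rigid: "\<And>\<phi> r. grid_aut n \<phi> \<Longrightarrow> view n (cfg k pos0) \<phi> = cfg k pos0 \<Longrightarrow> r < k \<Longrightarrow> \<phi> (pos0 r) = pos0 r"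
  shows "gatherable_one_crash n k pos0"
proof -
  define d where "d = (LEAST x. \<exists>r<k. \<exists>c. cdist n c (pos0 r) = x)"
  have ex: "\<exists>r<k. \<exists>c. cdist n c (pos0 r) = d" unfolding d_def by (rule LeastI_ex) (use k in blast)
  have least: "d \<le> cdist n c (pos0 r)" if "r < k" for r c
    unfolding d_def by (rule Least_le) (use that in blast)
  have d0: "0 < d"
  proof (rule ccontr)
    assume "\<not> 0 < d"
    then obtain r c where "r < k" "cdist n c (pos0 r) = 0" using ex by auto
    then show False using cdist_0_corner[of "pos0 r" n c] corner0 grid0 by blast
  qed
  have dn: "d < n - 2" using off least by (meson le_less_trans)
  let ?T = "{c. \<exists>r<k. cdist n c (pos0 r) = d}"
  have "finite ?T" by (rule finite_subset[of _ UNIV]) auto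
  moreover have "?T \<noteq> {}" using ex by blast
  ultimately have fin: "finite (score n (cfg k pos0) ` ?T)" "score n (cfg k pos0) ` ?T \<noteq> {}" by blast+
  from Max_in[OF this] obtain c where c: "c \<in> ?T" "Max (score n (cfg k pos0) ` ?T) = score n (cfg k pos0) c"
    by blast
  then have best: "\<forall>e\<in>?T. score n (cfg k pos0) e \<le> score n (cfg k pos0) c"
    using Max_ge[OF fin(1) imageI] by simp
  obtain a b where ab: "c = (a, b)" by fastforce
  define \<psi> where "\<psi> = dih n False a b"
  define \<kappa> where "\<kappa> = (\<lambda>e. (fst e \<noteq> a, snd e \<noteq> b))"
  have \<psi>: "grid_aut n \<psi>" unfolding \<psi>_def by (rule grid_aut_dih)
  have cm: "corner_map n \<psi> \<kappa>" unfolding \<psi>_def \<kappa>_def by (rule corner_map_flips)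
  have \<kappa>\<kappa>: "\<kappa> (\<kappa> e) = e" for e by (cases e) (auto simp: \<kappa>_def)
  have \<kappa>c: "\<kappa> c = (False, False)" by (simp add: \<kappa>_def ab)
  let ?p = "\<lambda>r. \<psi> (pos0 r)"
  have vw: "view n (cfg k ?p) \<psi> = cfg k pos0" unfolding \<psi>_def by (rule view_comp_flips[OF grid0])
  have cd: "cdist n e (?p r) = cdist n (\<kappa> e) (pos0 r)" if "r < k" for e r
  proof -
    have "pos0 r \<in> grid n" using grid0 that by blast
    from corner_mapD[OF cm this, of "\<kappa> e"] show ?thesis unfolding \<kappa>\<kappa> .
  qed
  have sc: "score n (cfg k ?p) e = score n (cfg k pos0) (\<kappa> e)" for e
    using score_view[OF \<psi> cm, of "cfg k ?p" "\<kappa> e"] unfolding vw \<kappa>\<kappa> by simp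
  have \<kappa>o: "\<kappa> (False, False) = c" using \<kappa>\<kappa> \<kappa>c by metis
  have "nearest_corner n k d ?p"
  proof
    show "even n" "0 < d" "d < n - 2" by (fact n d0 dn)+
    show "inj_on ?p {..<k}" unfolding \<psi>_def by (rule inj_comp_flips[OF inj0 grid0])
    show "?p ` {..<k} \<subseteq> grid n" unfolding \<psi>_def by (rule grid_comp_flips[OF grid0])
    show near: "\<exists>r<k. cdist n (False, False) (?p r) = d"
    proof -
      obtain r where "r < k" "cdist n c (pos0 r) = d" using c(1) by blast
      then show ?thesis using cd[of r "(False, False)"] \<kappa>o by auto
    qed
    show "d \<le> cdist n e (?p r)" if "r < k" for r e using cd[OF that] least[OF that] by simp
    show "score n (cfg k ?p) e \<le> score n (cfg k ?p) (False, False)" if "r < k" "cdist n e (?p r) = d" for e r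
    proof -
      have "\<kappa> e \<in> ?T" using that cd by auto
      then show ?thesis using best unfolding sc \<kappa>o by blast
    qed
    show "\<kappa>' (False, False) = (False, False)"
      if \<phi>: "grid_aut n \<phi>" "corner_map n \<phi> \<kappa>'" "view n (cfg k ?p) \<phi> = cfg k ?p" for \<phi> \<kappa>'
    proof -
      \<comment> \<open>Conjugation gives a symmetry of the original configuration, which fixes all
        robots. So \<open>\<phi>\<close> fixes a robot at distance \<open>d\<close> from the origin,
        and with it the unique corner at that distance.\<close>
      let ?\<chi> = "\<psi> \<circ> \<phi> \<circ> \<psi>"
      have \<chi>: "grid_aut n ?\<chi>" by (rule grid_aut_comp[OF grid_aut_comp[OF \<psi> \<phi>(1)] \<psi>])
      have \<psi>\<psi>: "\<psi> (\<psi> v) = v" if "v \<in> grid n" for v unfolding \<psi>_def by (rule dih_flips_flips[OF that])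
      have "view n (cfg k pos0) ?\<chi> = view n (view n (cfg k ?p) \<psi>) ?\<chi>" using vw by simp
      also have "\<dots> = view n (cfg k ?p) (\<psi> \<circ> ?\<chi>)" by (rule view_view[OF \<chi>])
      also have "\<dots> = view n (cfg k ?p) (\<phi> \<circ> \<psi>)"
        using \<psi>\<psi> grid_aut_in[OF \<phi>(1)] grid_aut_in[OF \<psi>] by (auto simp: view_def fun_eq_iff simp del: mem_grid)
      also have "\<dots> = view n (view n (cfg k ?p) \<phi>) \<psi>" by (rule view_view[OF \<psi>, symmetric])
      also have "\<dots> = cfg k pos0" using \<phi>(3) vw by simp
      finally have inv: "view n (cfg k pos0) ?\<chi> = cfg k pos0" .
      obtain r where r: "r < k" "cdist n (False, False) (?p r) = d" using near by blast
      have g: "pos0 r \<in> grid n" using grid0 r(1) by blast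
      have g': "?p r \<in> grid n" by (rule grid_aut_in[OF \<psi> g])
      have "\<psi> (\<phi> (?p r)) = pos0 r" using rigid[OF \<chi> inv r(1)] by simp
      then have fixed: "\<phi> (?p r) = ?p r" using \<psi>\<psi>[OF grid_aut_in[OF \<phi>(1) g']] by metis
      have "cdist n (\<kappa>' (False, False)) (?p r) = d"
        using corner_mapD[OF \<phi>(2) g', of "(False, False)"] r(2) fixed by simp
      from nearest_corner_unique[OF n g' this r(2)] dn show ?thesis by linarith
    qed
  qed
  then have "gatherable_one_crash n k ?p" by (rule nearest_corner.gatherable)
  then show ?thesis by (rule gatherable_transport[OF \<psi> grid0])
qed

text \<open>\<open>c\<close> distinguishes the two diagonals. Flipping the first coordinate negates
  the balance, so some \<open>a\<close> makes it nonnegative; \<open>b\<close> is then forced, as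
  the flips must carry the axis of symmetry to the main diagonal.\<close>

lemma gatherable_symmetric:
  assumes n: "even n" and inj0: "inj_on pos0 {..<k}" and grid0: "pos0 ` {..<k} \<subseteq> grid n"
    and corner0: "\<forall>r<k. \<not> is_corner n (pos0 r)"
    and sym: "dih n True c c ` (pos0 ` {..<k}) = pos0 ` {..<k}"
    and off: "r < k" "dih n True c c (pos0 r) \<noteq> pos0 r"
    and asym: "\<And>a b. a \<or> b \<Longrightarrow> dih n False a b ` (pos0 ` {..<k}) \<noteq> pos0 ` {..<k}"
  shows "gatherable_one_crash n k pos0"
proof -
  let ?O = "pos0 ` {..<k}"
  define h where "h a = (\<Sum>v\<in>?O. int n - 1 - 2 * int (flip n a (fst v)))" for a
  have neg: "h True = - h False"
  proof -
    have "h True = (\<Sum>v\<in>?O. - (int n - 1 - 2 * int (flip n False (fst v))))"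
      unfolding h_def
    proof (rule sum.cong)
      fix v assume "v \<in> ?O"
      then have "fst v < n" using grid0 mem_grid_iff by blast
      then show "int n - 1 - 2 * int (flip n True (fst v)) = - (int n - 1 - 2 * int (flip n False (fst v)))"
        by (auto simp: flip_def)
    qed simp
    then show ?thesis unfolding sum_negf h_def .
  qed
  have "0 \<le> h False \<or> 0 \<le> h True" using neg by linarith
  then obtain a where a: "0 \<le> h a" by blast
  define b where "b = (a \<noteq> c)"
  have abc: "(a \<noteq> b) = c" by (auto simp: b_def)
  define \<psi> where "\<psi> = dih n False a b"
  have \<psi>: "grid_aut n \<psi>" unfolding \<psi>_def by (rule grid_aut_dih)
  let ?p = "\<lambda>r. \<psi> (pos0 r)"
  have img: "?p ` {..<k} = \<psi> ` ?O" by (simp add: image_image)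
  have g: "v \<in> grid n" if "v \<in> ?O" for v using grid0 that by blast
  have symp: "swap v \<in> ?p ` {..<k}" if "v \<in> ?p ` {..<k}" for v
  proof -
    obtain u where u: "u \<in> ?O" "v = \<psi> u" using \<open>v \<in> _\<close> unfolding img by blast
    have "swap v = \<psi> (dih n True c c u)"
      unfolding u(2) \<psi>_def by (rule dih_flips_swap[OF g[OF u(1)] abc])
    moreover have "dih n True c c u \<in> ?O" using sym u(1) by blast
    ultimately show ?thesis unfolding img by blast
  qed
  have "\<exists>v\<in>?p ` {..<k}. snd v < fst v"
  proof -
    let ?v = "\<psi> (pos0 r)"
    have gr: "pos0 r \<in> grid n" using g off(1) by blast
    have "swap ?v = \<psi> (dih n True c c (pos0 r))" unfolding \<psi>_def by (rule dih_flips_swap[OF gr abc])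
    then have "swap ?v \<noteq> ?v" using grid_aut_inj[OF \<psi> dih_in[OF gr] gr] off(2) by simp
    then have "fst ?v \<noteq> snd ?v" by (auto simp: swap_def prod_eq_iff)
    moreover have "?v \<in> ?p ` {..<k}" using off(1) by blast
    moreover have "swap ?v \<in> ?p ` {..<k}" using symp off(1) by blast
    ultimately show ?thesis by (metis linorder_neqE_nat swap_simps(3,4))
  qed
  then obtain w where "w \<in> ?p ` {..<k} \<and> snd w < fst w" by blast
  from ex_has_least_nat[of "\<lambda>v. v \<in> ?p ` {..<k} \<and> snd v < fst v", OF this, of "\<lambda>v. fst v + snd v"]
  obtain v where v: "v \<in> ?p ` {..<k}" "snd v < fst v"
    and least: "\<And>u. u \<in> ?p ` {..<k} \<Longrightarrow> snd u < fst u \<Longrightarrow> fst v + snd v \<le> fst u + snd u"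
    by (elim exE conjE) (simp del: split_paired_All)
  obtain x0 y0 where xy: "v = (x0, y0)" by fastforce
  obtain m1 where m1: "m1 < k" "?p m1 = (x0, y0)" using v(1) xy by auto
  obtain m2 where m2: "m2 < k" "?p m2 = (y0, x0)" using symp[OF v(1)] xy by auto
  have "diagonal_pair n k ?p m1 m2 x0 y0"
  proof
    show "even n" "m1 < k" "m2 < k" "?p m1 = (x0, y0)" "?p m2 = (y0, x0)" by (fact n m1 m2)+
    show "y0 < x0" using v(2) xy by simp
    show "inj_on ?p {..<k}" unfolding \<psi>_def by (rule inj_comp_flips[OF inj0 grid0])
    show "?p ` {..<k} \<subseteq> grid n" unfolding \<psi>_def by (rule grid_comp_flips[OF grid0])
    show "\<not> is_corner n (?p r)" if "r < k" for r
      using corner0 that is_corner_dih[of "pos0 r" n False a b] g unfolding \<psi>_def by blast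
    show "swap u \<in> ?p ` {..<k}" if "u \<in> ?p ` {..<k}" for u by (rule symp[OF that])
    show "x0 + y0 \<le> fst u + snd u" if "u \<in> ?p ` {..<k}" "snd u < fst u" for u
      using least[OF that] xy by simp
    have "(\<Sum>v\<in>\<psi> ` ?O. int n - 1 - 2 * int (fst v)) = h a"
      unfolding h_def sum.reindex[OF inj_on_subset[OF grid_aut_inj_on[OF \<psi>] grid0]]
      by (simp add: \<psi>_def dih_def)
    then show "0 \<le> (\<Sum>v\<in>?p ` {..<k}. int n - 1 - 2 * int (fst v))" using a unfolding img by simp
    show "dih n False a' b' ` (?p ` {..<k}) \<noteq> ?p ` {..<k}" if "a' \<or> b'" for a' b'
    proof
      assume eq: "dih n False a' b' ` (?p ` {..<k}) = ?p ` {..<k}"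
      \<comment> \<open>Flips of the coordinates commute, so a forbidden symmetry of the moved
        configuration would be one of the original.\<close>
      have "dih n False a' b' ` \<psi> ` ?O = \<psi> ` dih n False a' b' ` ?O"
        unfolding image_image \<psi>_def using dih_flips_commute g by (intro image_cong) auto
      then have "\<psi> ` dih n False a' b' ` ?O = \<psi> ` ?O" using eq unfolding img by simp
      moreover have "dih n False a' b' ` ?O \<subseteq> grid n" using g dih_in by blast
      ultimately have "dih n False a' b' ` ?O = ?O"
        using inj_on_image_eq_iff[OF grid_aut_inj_on[OF \<psi>] _ grid0] by metis
      then show False using asym[OF that] by simp
    qed
  qed
  then have "gatherable_one_crash n k ?p" by (rule diagonal_pair.gatherable)
  then show ?thesis by (rule gatherable_transport[OF \<psi> grid0])
qed

theorem theorem7: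
  fixes n k :: nat and pos0 :: "nat \<Rightarrow> nat \<times> nat"
  assumes "even n" and "k \<ge> 3"
    and "inj_on pos0 {..<k}" and "pos0 ` {..<k} \<subseteq> grid n"
    and "\<not> partitive n (cfg k pos0)"
    and "\<forall>c\<in>mes_corners n (cfg k pos0). cfg k pos0 c = 0"
  shows "gatherable_one_crash n k pos0"
proof -
  let ?f = "cfg k pos0" and ?O = "pos0 ` {..<k}"
  have k: "0 < k" using assms(2) by simp
  then have "pos0 0 \<in> grid n" using assms(4) by blast
  then have n0: "0 < n" by (cases "pos0 0") auto
  then obtain m where m: "n = 2 * m" "0 < m" using assms(1) by auto
  have n2: "2 \<le> n" using m by simp
  have corner0: "\<forall>r<k. \<not> is_corner n (pos0 r)"
    using no_robot_on_grid_corner[OF m k assms(4,6)] by blast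
  have off: "\<exists>r<k. \<exists>c. cdist n c (pos0 r) < n - 2"
    by (rule some_robot_off_centre[OF m k assms(4,6)])
  have no_flip: False if "a \<or> b" "\<And>v. v \<in> grid n \<Longrightarrow> ?f (dih n False a b v) = ?f v" for a b
    using dih_invariant_partitive[OF assms(1) n0 that(1), of ?f] that(2) assms(5) by blast
  show ?thesis
  proof (cases "\<forall>\<phi> r. grid_aut n \<phi> \<longrightarrow> view n ?f \<phi> = ?f \<longrightarrow> r < k \<longrightarrow> \<phi> (pos0 r) = pos0 r")
    case True
    then show ?thesis using gatherable_rigid[OF assms(1,3,4) k corner0 off] by blast
  next
    case False
    then obtain \<phi> r where \<phi>: "grid_aut n \<phi>" "view n ?f \<phi> = ?f" "r < k" "\<phi> (pos0 r) \<noteq> pos0 r" by blast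
    obtain s a b where d: "\<And>v. v \<in> grid n \<Longrightarrow> \<phi> v = dih n s a b v"
      using grid_aut_cases[OF \<phi>(1) n2] by metis
    have inv: "?f (dih n s a b v) = ?f v" if "v \<in> grid n" for v
      using fun_cong[OF \<phi>(2), of v] view_apply[OF that] d[OF that] by simp
    have gr: "pos0 r \<in> grid n" using assms(4) \<phi>(3) by blast
    \<comment> \<open>Without the transposition the symmetry would be a flip, excluded by
      non-partitivity, or the identity, which displaces no robot.\<close>
    have s: s
    proof (rule ccontr)
      assume "\<not> s"
      then have "\<not> (a \<or> b)" using no_flip[of a b] inv by auto
      then show False using \<phi>(4) d[OF gr] \<open>\<not> s\<close> dih_id[OF gr] by simp
    qed
    \<comment> \<open>A transposition with a single flip is a quarter turn, whose square is the
      excluded half turn. Only reflections in a diagonal remain.\<close>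
    have ab: "a = b"
    proof (rule ccontr)
      assume ne: "a \<noteq> b"
      have "?f (dih n False True True v) = ?f v" if "v \<in> grid n" for v
      proof -
        have "dih n False True True v = dih n s a b (dih n s a b v)"
          using s ne that by (cases v; cases a; cases b) (auto simp: dih_def flip_def)
        then show ?thesis using inv[OF that] inv[OF dih_in[OF that]] by simp
      qed
      then show False using no_flip[of True True] by blast
    qed
    show ?thesis
    proof (rule gatherable_symmetric[OF assms(1,3,4) corner0 _ \<phi>(3)])
      have "\<phi> ` ?O = dih n True a a ` ?O"
      proof (rule image_cong)
        fix v assume "v \<in> ?O"
        then have "v \<in> grid n" using assms(4) by blast
        then show "\<phi> v = dih n True a a v" using d s ab by simp
      qed simp
      then show "dih n True a a ` ?O = ?O"
        using view_eq_cfg_image[OF \<phi>(1) assms(4,4) \<phi>(2)] by simp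
      show "dih n True a a (pos0 r) \<noteq> pos0 r" using \<phi>(4) d[OF gr] s ab by simp
      show "dih n False a b ` ?O \<noteq> ?O" if "a \<or> b" for a b
      proof
        assume eq: "dih n False a b ` ?O = ?O"
        have "?f (dih n False a b v) = ?f v" if v: "v \<in> grid n" for v
        proof -
          \<comment> \<open>Robots start on distinct nodes, so the set of occupied nodes determines
            the configuration.\<close>
          have "dih n False a b v \<in> ?O \<longleftrightarrow> v \<in> ?O"
            using eq inj_on_image_mem_iff[OF grid_aut_inj_on[OF grid_aut_dih] v assms(4)] by metis
          then show ?thesis by (simp add: cfg_inj[OF assms(3)])
        qed
        then show False using no_flip that by blast
      qed
    qed
  qed
qed

end
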